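(* Let $\mathcal{A}$ be a line arrangement in $\mathbb{P}^2$ of $d=8$ lines whose maximal point multiplicity is $m=4$, and let $r=e_1$ be the minimal degree of a Jacobian relation. Then $\tau(\mathcal{A})\in\{31,32,33,34,35,36,37\}$ and the possible cases are the following. (1) If $\tau(\mathcal{A})=37$, then $\mathcal{A}$ is free with exponents $(3,4)$. (2) If $\tau(\mathcal{A})=36$, then $\mathcal{A}$ is nearly free with exponents $(4,4,4)$. (3) If $\tau(\mathcal{A})=35$, then $\mathcal{A}$ is minimal POG with exponents $(4,4,5)$. (4) If $\tau(\mathcal{A})=34$, then $r=4$ and $(n_3,n_4)$ is either $(0,2)$ or $(3,1)$. More precisely: (a) If $(n_3,n_4)=(0,2)$, then $\mathcal{A}$ is a POG arrangement with exponents $(4,4,6)$. (b) If $(n_3,n_4)=(3,1)$, then one of two exponent sequences occurs: either $\mathcal{A}$ is a POG arrangement with exponents $(4,4,6)$, or $\mathcal{A}$ has type $2$ with exponents $(4,5,5,5)$. (5) If $\tau(\mathcal{A})=33$, then $(n_3,n_4)=(2,1)$, $r=4$, and one of the following two cases occurs: (a) $\mathcal{A}$ has type $2$ with exponents $(4,5,5)$; (b) $\mathcal{A}$ has type $2$ with exponents $(4,5,5,6)$. (6) If $\tau(\mathcal{A})=32$, then $\mathcal{A}$ has type $2$ with exponents $(4,5,6,6)$. (7) If $\tau(\mathcal{A})=31$, then $\mathcal{A}$ has type $3$ with exponents $(4,6,6,6,6)$.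
   Context: Let $S=\mathbb{C}[x,y,z]$ with the standard grading. A line arrangement $\mathcal{A}: f=0$ in $\mathbb{P}^2=\mathbb{P}^2_{\mathbb{C}}$ is given by $f=\ell_1\cdots\ell_d$ with $\ell_i\in S_1$ pairwise non-proportional. The multiplicity of a point is the number of lines of $\mathcal{A}$ through it; $n_k$ is the number of points of multiplicity exactly $k$; the total Tjurina number is $\tau(\mathcal{A})=\sum_{k\geq 2}n_k(k-1)^2$. Let $AR(f)=\{(a,b,c)\in S^3: af_x+bf_y+cf_z=0\}$, graded by the common degree of $a,b,c$. The exponents $(e_1,\ldots,e_s)$, $e_1\leq\cdots\leq e_s$, of $\mathcal{A}$ are the degrees of a minimal homogeneous generating set of $AR(f)$; $r=\mathrm{mdr}(f)=e_1$. $\mathcal{A}$ is free if $AR(f)$ is a free $S$-module (equivalently $s=2$). $\mathcal{A}$ is plus-one generated (POG) if $s=3$ and $e_1+e_2=d$; it is nearly free if moreover $e_3=e_2$, and minimal POG if moreover $e_3=e_2+1$. The type of $\mathcal{A}$ is $t(\mathcal{A})=e_1+e_2-d+1$. *)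

theory Defs
  imports "HOL-Analysis.Analysis" "HOL-Library.Poly_Mapping"
begin

section \<open>The graded polynomial ring\<close>

text \<open>The ring \<open>S = \<complex>[x,y,z]\<close>. The variables are indexed by the three-element type \<^typ>\<open>3\<close>,
  a monomial is its exponent vector, and a polynomial maps monomials to coefficients; the
  ring structure (convolution) is the one of HOL-Library.\<close>

type_synonym spoly = "(3 \<Rightarrow>\<^sub>0 nat) \<Rightarrow>\<^sub>0 complex"

definition Const :: "complex \<Rightarrow> spoly" where
  "Const c = Poly_Mapping.single 0 c"

definition mdegree :: "(3 \<Rightarrow>\<^sub>0 nat) \<Rightarrow> nat" where
  "mdegree m = (\<Sum>i\<in>UNIV. Poly_Mapping.lookup m i)"

text \<open>Membership in the graded piece \<open>S\<^sub>k\<close>; the zero polynomial lies in every piece.\<close>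

definition homogeneous :: "nat \<Rightarrow> spoly \<Rightarrow> bool" where
  "homogeneous k p \<longleftrightarrow> (\<forall>m\<in>Poly_Mapping.keys p. mdegree m = k)"

text \<open>Subtraction of exponents is truncated, but where it truncates the factor
  \<open>of_nat (lookup m i)\<close> vanishes.\<close>

definition pdiff :: "3 \<Rightarrow> spoly \<Rightarrow> spoly" where
  "pdiff i p = (\<Sum>m\<in>Poly_Mapping.keys p.
     Poly_Mapping.single (m - Poly_Mapping.single i 1)
       (of_nat (Poly_Mapping.lookup m i) * Poly_Mapping.lookup p m))"

definition eval_poly :: "spoly \<Rightarrow> complex ^ 3 \<Rightarrow> complex" where
  "eval_poly p v = (\<Sum>m\<in>Poly_Mapping.keys p.
     Poly_Mapping.lookup p m * (\<Prod>i\<in>UNIV. (v $ i) ^ Poly_Mapping.lookup m i))"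

section \<open>Line arrangements and their points\<close>

text \<open>An arrangement is given by the set of its linear forms \<open>\<ell>\<^sub>1, \<dots>, \<ell>\<^sub>d\<close>; since they are pairwise
  non-proportional, nothing is lost by using a set, and \<open>d\<close> is its cardinality.\<close>

definition line_arrangement :: "spoly set \<Rightarrow> bool" where
  "line_arrangement A \<longleftrightarrow> finite A \<and> (\<forall>l\<in>A. l \<noteq> 0 \<and> homogeneous 1 l) \<and>
     pairwise (\<lambda>l l'. \<nexists>c. l' = Const c * l) A"

definition defining_poly :: "spoly set \<Rightarrow> spoly" where
  "defining_poly A = \<Prod>A"

text \<open>The points of the complex projective plane are the one-dimensional subspaces of
  \<open>\<complex>\<^sup>3\<close>; \<^term>\<open>vec.span\<close> is the span over the complex scalars.\<close>

definition proj_plane :: "(complex ^ 3) set set" where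
  "proj_plane = {vec.span {v} | v. v \<noteq> 0}"

definition mult_at :: "spoly set \<Rightarrow> (complex ^ 3) set \<Rightarrow> nat" where
  "mult_at A P = card {l \<in> A. \<forall>v\<in>P. eval_poly l v = 0}"

definition num_points :: "spoly set \<Rightarrow> nat \<Rightarrow> nat" where
  "num_points A k = card {P \<in> proj_plane. mult_at A P = k}"

definition max_mult :: "spoly set \<Rightarrow> nat" where
  "max_mult A = Max (mult_at A ` proj_plane)"

text \<open>No point has multiplicity above \<^term>\<open>card A\<close>, so the sum over all \<open>k \<ge> 2\<close> stops there.\<close>

definition total_tjurina :: "spoly set \<Rightarrow> nat" where
  "total_tjurina A = (\<Sum>k = 2..card A. num_points A k * (k - 1)\<^sup>2)"

section \<open>Jacobian relations and exponents\<close>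

interpretation S3: module "(*s) :: spoly \<Rightarrow> spoly ^ 3 \<Rightarrow> spoly ^ 3"
  by unfold_locales (simp_all add: vec_eq_iff algebra_simps)

definition AR :: "spoly \<Rightarrow> (spoly ^ 3) set" where
  "AR f = {g. (\<Sum>i\<in>UNIV. g $ i * pdiff i f) = 0}"

definition homogeneous3 :: "nat \<Rightarrow> spoly ^ 3 \<Rightarrow> bool" where
  "homogeneous3 k g \<longleftrightarrow> (\<forall>i. homogeneous k (g $ i))"

definition mdr :: "spoly \<Rightarrow> nat" where
  "mdr f = (LEAST k. \<exists>g\<in>AR f. g \<noteq> 0 \<and> homogeneous3 k g)"

definition minimal_generating_set :: "(spoly ^ 3) set \<Rightarrow> (spoly ^ 3) set \<Rightarrow> bool" where
  "minimal_generating_set M G \<longleftrightarrow> S3.span G = M \<and> (\<forall>H. H \<subset> G \<longrightarrow> S3.span H \<noteq> M)"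

text \<open>The degree list, in increasing order, of a finite minimal homogeneous generating set of
  \<open>AR f\<close>. By the graded Nakayama lemma it does not depend on the generating set, which justifies
  the definite description. The minimality keeps 0 out of the generating set, so that every
  generator has a unique degree.\<close>

definition exponents :: "spoly \<Rightarrow> nat list" where
  "exponents f = (THE es. \<exists>gs. distinct gs \<and> minimal_generating_set (AR f) (set gs) \<and>
     list_all2 homogeneous3 es gs \<and> sorted es)"

definition free_arr :: "spoly set \<Rightarrow> bool" where
  "free_arr A \<longleftrightarrow> (\<exists>B. S3.independent B \<and> S3.span B = AR (defining_poly A))"

text \<open>List positions start at 0: \<open>e\<^sub>1, e\<^sub>2, e\<^sub>3\<close> are \<open>es ! 0, es ! 1, es ! 2\<close>.\<close>

definition POG :: "spoly set \<Rightarrow> bool" where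
  "POG A \<longleftrightarrow> (let es = exponents (defining_poly A) in
     length es = 3 \<and> es ! 0 + es ! 1 = card A)"

definition nearly_free :: "spoly set \<Rightarrow> bool" where
  "nearly_free A \<longleftrightarrow> POG A \<and> (let es = exponents (defining_poly A) in es ! 2 = es ! 1)"

definition minimal_POG :: "spoly set \<Rightarrow> bool" where
  "minimal_POG A \<longleftrightarrow> POG A \<and> (let es = exponents (defining_poly A) in es ! 2 = es ! 1 + 1)"

definition arr_type :: "spoly set \<Rightarrow> int" where
  "arr_type A = (let es = exponents (defining_poly A) in
     int (es ! 0) + int (es ! 1) - int (card A) + 1)"

end

theory Submission
  imports Defs
begin

text \<open>
  Let \<open>p\<close> be a point of multiplicity four of the arrangement. A derivation of \<open>S\<close> that preserves the four lines through
  \<open>p\<close> is, up to multiples of the Euler field, of the form \<open>v \<eta> - c \<partial>\<^sub>p\<close>, where \<open>\<eta>\<close> is a fixed cubic field and \<open>\<partial>\<^sub>p\<close> is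
  the derivative in direction \<open>p\<close>. It preserves the other four lines iff \<open>c\<close> takes prescribed values \<open>v q\<^sub>i\<close> on
  them. Thus the slope \<open>v\<close> of a Jacobian relation ranges over an ideal \<open>I\<close> of \<open>S\<close>, and the relations of slope 0
  are the multiples of a single relation of degree 4: there is an exact sequence
  \<open>0 \<longrightarrow> S(-4) \<longrightarrow> AR(f) \<longrightarrow> I(-3) \<longrightarrow> 0\<close> (\<open>vertical_relation\<close>, \<open>homogeneous_lift\<close>). So the exponents are 4 and the
  degrees of the minimal generators of \<open>I\<close>, raised by 3, with \<open>(3, 4)\<close> as the case \<open>I = S\<close>
  (\<open>exponents_of_proper_slope_ideal\<close>, \<open>exponents_of_unit_slope_ideal\<close>). That the exponents are well defined is
  the graded Nakayama lemma (\<open>minimal_generators_degrees_unique\<close>).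

  The ideal \<open>I\<close> is computed from the four lines off \<open>p\<close>. Interpolation on several lines is obstructed only
    where they
  meet, and not even there if one of the four lines through \<open>p\<close> passes through the point. At an intersection point
  of \<open>k\<close> lines off the lines through \<open>p\<close>, the obstruction is a curvilinear scheme of length \<open>k - 1\<close> in the direction
  of \<open>p\<close> (\<open>slope_ideal_concurrent_off\<close>, \<open>slope_ideal_concurrent_on\<close>, \<open>slope_ideal_insert_transversal\<close>). Altogether, \<open>I\<close> is
  the ideal of a scheme of length \<open>9 - n\<^sub>3 - 3 n\<^sub>4 = 37 - \<tau>\<close>, at most 6.

  There are few possibilities. If the four lines are in general position, the scheme is a subset of their six
  intersection points and corresponds to a graph on four vertices; otherwise three or four of the lines are
  concurrent. In every case the generators of \<open>I\<close> are found by adding one point after the other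
  (\<open>ideal_gen_meet\<close>). They are minimal because each of them has a witness, a common zero of the others at which
  it does not vanish. The result is a table of thirteen triples \<open>(n\<^sub>3, n\<^sub>4, exponents)\<close>; the theorem follows
  with \<open>\<tau> = 28 + n\<^sub>3 + 3 n\<^sub>4\<close>, obtained by counting pairs of lines.
\<close>

section \<open>The polynomial ring\<close>

definition Var :: "3 \<Rightarrow> spoly" where
  "Var i = Poly_Mapping.single (Poly_Mapping.single i 1) 1"

lemma Const_0 [simp]: "Const 0 = 0"
  and Const_1 [simp]: "Const 1 = 1"
  and Const_add: "Const (a + b) = Const a + Const b"
  and Const_diff: "Const (a - b) = Const a - Const b"
  and Const_minus: "Const (- a) = - Const a"
  and Const_mult: "Const (a * b) = Const a * Const b"
  by (simp_all add: Const_def single_add single_diff single_uminus mult_single)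

lemma Const_eq_iff [simp]: "Const a = Const b \<longleftrightarrow> a = b"
  by (simp add: Const_def) (metis lookup_single_eq)

lemma Const_eq_0_iff [simp]: "Const a = 0 \<longleftrightarrow> a = 0"
  using Const_eq_iff[of a 0] by (simp del: Const_eq_iff)

lemma Const_sum: "Const (sum g X) = (\<Sum>x\<in>X. Const (g x))"
  by (induction X rule: infinite_finite_induct) (auto simp: Const_add)

lemma Const_of_nat: "Const (of_nat n) = of_nat n"
  by (simp add: Const_def)

text \<open>A polynomial is a sum of terms; this induction turns an identity that is additive in a polynomial
  into its instance on single terms.\<close>

lemma additive_induct [case_names single add]:
  fixes p :: spoly
  assumes "\<And>m c. P (Poly_Mapping.single m c)" and "\<And>p q. P p \<Longrightarrow> P q \<Longrightarrow> P (p + q)"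
  shows "P p"
proof (induction p rule: update_induct)
  case const
  show ?case using assms(1)[of 0 0] by simp
next
  case (update q a b)
  have "Poly_Mapping.update a b q = q + Poly_Mapping.single a b"
    using update(1) by (intro poly_mapping_eqI)
      (auto simp: lookup_update lookup_add lookup_single in_keys_iff when_def)
  then show ?case using assms update by metis
qed

subsection \<open>Evaluation homomorphisms\<close>

text \<open>Substitution of ring elements \<open>a i\<close> for the variables, with the coefficients sent along \<open>h\<close>.
  The two instances below are the evaluation at a point of \<open>\<complex>\<^sup>3\<close> (\<open>h\<close> the identity) and, with \<open>h = Const\<close>,
  substitutions of polynomials, which restrict a polynomial to a line.\<close>

definition insertion :: "(complex \<Rightarrow> 'b::comm_ring_1) \<Rightarrow> (3 \<Rightarrow> 'b) \<Rightarrow> spoly \<Rightarrow> 'b" where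
  "insertion h a p = (\<Sum>m\<in>Poly_Mapping.keys p.
     h (Poly_Mapping.lookup p m) * (\<Prod>i\<in>UNIV. a i ^ Poly_Mapping.lookup m i))"

locale coefficient_hom =
  fixes h :: "complex \<Rightarrow> 'b::comm_ring_1"
  assumes hom_add: "h (x + y) = h x + h y" and hom_mult: "h (x * y) = h x * h y"
    and hom_1: "h 1 = 1"
begin

lemma hom_0: "h 0 = 0"
  using hom_add[of 0 0] by simp

lemma insertion_superset:
  assumes "finite X" "Poly_Mapping.keys p \<subseteq> X"
  shows "insertion h a p = (\<Sum>m\<in>X. h (Poly_Mapping.lookup p m) * (\<Prod>i\<in>UNIV. a i ^ Poly_Mapping.lookup m i))"
  unfolding insertion_def using assms
  by (intro sum.mono_neutral_left) (auto simp: in_keys_iff hom_0)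

lemma insertion_add: "insertion h a (p + q) = insertion h a p + insertion h a q"
proof -
  let ?X = "Poly_Mapping.keys p \<union> Poly_Mapping.keys q"
  have "Poly_Mapping.keys (p + q) \<subseteq> ?X" by (rule keys_add)
  then show ?thesis
    by (simp add: insertion_superset[of ?X] lookup_add hom_add algebra_simps sum.distrib)
qed

lemma insertion_single:
  "insertion h a (Poly_Mapping.single m c) = h c * (\<Prod>i\<in>UNIV. a i ^ Poly_Mapping.lookup m i)"
  using insertion_superset[of "{m}" "Poly_Mapping.single m c" a] by (simp split: if_splits)

lemma insertion_mult: "insertion h a (p * q) = insertion h a p * insertion h a q"
proof (induction p rule: additive_induct)
  case (single m c)
  show ?case
    by (induction q rule: additive_induct)
      (simp_all add: mult_single insertion_single hom_mult lookup_add power_add prod.distrib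
        distrib_left insertion_add algebra_simps)
next
  case (add p1 p2)
  then show ?case by (simp add: distrib_right insertion_add)
qed

lemma insertion_Const: "insertion h a (Const c) = h c"
  by (simp add: Const_def insertion_single)

lemma insertion_Var: "insertion h a (Var i) = a i"
proof -
  have "(\<Prod>j\<in>UNIV. a j ^ Poly_Mapping.lookup (Poly_Mapping.single i (1::nat)) j) =
      (\<Prod>j\<in>UNIV. if j = i then a i else 1)"
    by (rule prod.cong) (auto simp: lookup_single when_def)
  then show ?thesis by (simp add: Var_def insertion_single hom_1)
qed

end

lemma single_eq_monomial:
  "Poly_Mapping.single m c = Const c * (\<Prod>i\<in>UNIV. Var i ^ Poly_Mapping.lookup m i)"
proof -
  have pow: "Var i ^ n = Poly_Mapping.single (Poly_Mapping.single i n) 1" for i n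
    by (induction n) (auto simp: Var_def mult_single single_add[symmetric])
  have "(\<Prod>i\<in>X. Var i ^ Poly_Mapping.lookup m i) =
      Poly_Mapping.single (\<Sum>i\<in>X. Poly_Mapping.single i (Poly_Mapping.lookup m i)) 1"
    if "finite X" for X
    using that by (induction X) (simp_all add: pow mult_single)
  moreover have "(\<Sum>i\<in>UNIV. Poly_Mapping.single i (Poly_Mapping.lookup m i)) = m"
    by (rule poly_mapping_eqI) (simp add: lookup_sum lookup_single when_def)
  ultimately have "(\<Prod>i\<in>UNIV. Var i ^ Poly_Mapping.lookup m i) = Poly_Mapping.single m 1"
    by simp
  then show ?thesis by (simp add: Const_def mult_single)
qed

lemma spoly_induct [case_names Const Var add mult]:
  fixes p :: spoly
  assumes C: "\<And>c. P (Const c)" and V: "\<And>i. P (Var i)"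
    and a: "\<And>p q. P p \<Longrightarrow> P q \<Longrightarrow> P (p + q)" and m: "\<And>p q. P p \<Longrightarrow> P q \<Longrightarrow> P (p * q)"
  shows "P p"
proof (induction p rule: additive_induct)
  case (single k c)
  have pw: "P (Var i ^ n)" for i n
    by (induction n) (auto intro: m V C[of 1, simplified])
  have pr: "P (\<Prod>i\<in>X. Var i ^ Poly_Mapping.lookup k i)" if "finite X" for X
    using that by (induction X) (auto intro: m pw C[of 1, simplified])
  show ?case unfolding single_eq_monomial by (intro m C pr) simp
next
  case (add p q) then show ?case by (rule a)
qed

lemma eval_poly_insertion: "eval_poly p v = insertion (\<lambda>c. c) (($) v) p"
  by (simp add: eval_poly_def insertion_def)

interpretation ev: coefficient_hom "\<lambda>c::complex. c" by unfold_locales auto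

lemma eval_add [simp]: "eval_poly (p + q) v = eval_poly p v + eval_poly q v"
  and eval_mult [simp]: "eval_poly (p * q) v = eval_poly p v * eval_poly q v"
  and eval_Const [simp]: "eval_poly (Const c) v = c"
  and eval_Var [simp]: "eval_poly (Var i) v = v $ i"
  by (simp_all add: eval_poly_insertion ev.insertion_add ev.insertion_mult
      ev.insertion_Const ev.insertion_Var)

lemma eval_0 [simp]: "eval_poly 0 v = 0" and eval_1 [simp]: "eval_poly 1 v = 1"
  using eval_Const[of 0 v] eval_Const[of 1 v] by simp_all

lemma eval_minus [simp]: "eval_poly (- p) v = - eval_poly p v"
  using eval_add[of p "- p" v] by (simp del: eval_add add: eq_neg_iff_add_eq_0 add.commute)

lemma eval_diff [simp]: "eval_poly (p - q) v = eval_poly p v - eval_poly q v"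
  using eval_add[of p "- q" v] by (simp del: eval_add)

lemma eval_sum [simp]: "eval_poly (sum g X) v = (\<Sum>x\<in>X. eval_poly (g x) v)"
  by (induction X rule: infinite_finite_induct) auto

lemma eval_power [simp]: "eval_poly (p ^ n) v = eval_poly p v ^ n"
  by (induction n) auto

lemma eval_prod [simp]: "eval_poly (prod g X) v = (\<Prod>x\<in>X. eval_poly (g x) v)"
  by (induction X rule: infinite_finite_induct) auto

subsection \<open>Partial derivatives\<close>

lemma pdiff_superset:
  assumes "finite X" "Poly_Mapping.keys p \<subseteq> X"
  shows "pdiff i p = (\<Sum>m\<in>X. Poly_Mapping.single (m - Poly_Mapping.single i 1)
       (of_nat (Poly_Mapping.lookup m i) * Poly_Mapping.lookup p m))"
  unfolding pdiff_def using assms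
  by (intro sum.mono_neutral_left) (auto simp: in_keys_iff)

lemma pdiff_add: "pdiff i (p + q) = pdiff i p + pdiff i q"
proof -
  let ?X = "Poly_Mapping.keys p \<union> Poly_Mapping.keys q"
  have "Poly_Mapping.keys (p + q) \<subseteq> ?X" by (rule keys_add)
  then show ?thesis
    by (simp add: pdiff_superset[of ?X] lookup_add algebra_simps sum.distrib single_add)
qed

lemma pdiff_single: "pdiff i (Poly_Mapping.single m c) =
    Poly_Mapping.single (m - Poly_Mapping.single i 1) (of_nat (Poly_Mapping.lookup m i) * c)"
  using pdiff_superset[of "{m}" "Poly_Mapping.single m c" i] by (simp split: if_splits)

lemma pdiff_mult: "pdiff i (p * q) = pdiff i p * q + p * pdiff i q"
proof (induction p rule: additive_induct)
  case (single m c)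
  show ?case
  proof (induction q rule: additive_induct)
    case (single n d)
    let ?e = "Poly_Mapping.single i (1::nat)"
    have shift: "m + n - ?e = (m - ?e) + n" if "Poly_Mapping.lookup m i \<noteq> 0" for m n :: "3 \<Rightarrow>\<^sub>0 nat"
      using that by (intro poly_mapping_eqI) (auto simp: lookup_add lookup_minus lookup_single when_def)
    (* Where the truncated subtraction destroys the exponent identity, the coefficient is 0. *)
    have 1: "Poly_Mapping.single (m + n - ?e) (of_nat (Poly_Mapping.lookup m i) * (c * d)) =
        Poly_Mapping.single ((m - ?e) + n) (of_nat (Poly_Mapping.lookup m i) * (c * d))"
      using shift[of m n] by (cases "Poly_Mapping.lookup m i = 0") auto
    have 2: "Poly_Mapping.single (m + n - ?e) (of_nat (Poly_Mapping.lookup n i) * (c * d)) =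
        Poly_Mapping.single (m + (n - ?e)) (of_nat (Poly_Mapping.lookup n i) * (c * d))"
      using shift[of n m] by (cases "Poly_Mapping.lookup n i = 0") (auto simp: add.commute)
    have "pdiff i (Poly_Mapping.single m c * Poly_Mapping.single n d) =
        Poly_Mapping.single (m + n - ?e) (of_nat (Poly_Mapping.lookup m i) * (c * d)) +
        Poly_Mapping.single (m + n - ?e) (of_nat (Poly_Mapping.lookup n i) * (c * d))"
      by (simp add: mult_single pdiff_single lookup_add algebra_simps single_add)
    then show ?case unfolding 1 2 by (simp add: mult_single pdiff_single algebra_simps)
  next
    case (add q1 q2)
    then show ?case by (simp add: distrib_left pdiff_add algebra_simps)
  qed
next
  case (add p1 p2)
  then show ?case by (simp add: distrib_right pdiff_add algebra_simps)
qed

lemma pdiff_Const [simp]: "pdiff i (Const c) = 0"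
  by (simp add: Const_def pdiff_single)

lemma pdiff_Var: "pdiff i (Var j) = (if i = j then 1 else 0)"
  by (simp add: Var_def pdiff_single lookup_single when_def)

subsection \<open>Homogeneous polynomials and homogeneous components\<close>

lemma mdegree_add: "mdegree (m + n) = mdegree m + mdegree n"
  by (simp add: mdegree_def lookup_add sum.distrib)

lemma homogeneous_0 [simp]: "homogeneous k 0"
  by (simp add: homogeneous_def)

lemma homogeneous_lookup: "homogeneous k p \<longleftrightarrow> (\<forall>m. Poly_Mapping.lookup p m \<noteq> 0 \<longrightarrow> mdegree m = k)"
  by (auto simp: homogeneous_def in_keys_iff)

lemma homogeneous_add: "homogeneous k p \<Longrightarrow> homogeneous k q \<Longrightarrow> homogeneous k (p + q)"
  unfolding homogeneous_def using keys_add[of p q] by blast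

lemma homogeneous_minus: "homogeneous k p \<Longrightarrow> homogeneous k (- p)"
  by (simp add: homogeneous_lookup)

lemma homogeneous_diff: "homogeneous k p \<Longrightarrow> homogeneous k q \<Longrightarrow> homogeneous k (p - q)"
  using homogeneous_add[of k p "- q"] homogeneous_minus by simp

lemma homogeneous_sum: "(\<And>x. x \<in> X \<Longrightarrow> homogeneous k (g x)) \<Longrightarrow> homogeneous k (sum g X)"
  by (induction X rule: infinite_finite_induct) (auto intro: homogeneous_add)

lemma homogeneous_mult: "homogeneous j p \<Longrightarrow> homogeneous k q \<Longrightarrow> homogeneous (j + k) (p * q)"
  unfolding homogeneous_def using keys_mult[of p q] by (fastforce simp: mdegree_add)

lemma homogeneous_Const [simp]: "homogeneous 0 (Const c)"
  by (auto simp: homogeneous_lookup Const_def lookup_single when_def mdegree_def)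

lemma homogeneous_1 [simp]: "homogeneous 0 1"
  using homogeneous_Const[of 1] by simp

lemma homogeneous_Const_mult: "homogeneous k p \<Longrightarrow> homogeneous k (Const c * p)"
  using homogeneous_mult[of 0 "Const c" k p] by simp

lemma mdegree_single: "mdegree (Poly_Mapping.single i n) = n"
  by (simp add: mdegree_def lookup_single when_def)

lemma homogeneous_Var [simp]: "homogeneous 1 (Var i)"
  by (auto simp: homogeneous_lookup Var_def lookup_single when_def mdegree_single)

lemma homogeneous_prod:
  "finite X \<Longrightarrow> (\<And>x. x \<in> X \<Longrightarrow> homogeneous 1 (g x)) \<Longrightarrow> homogeneous (card X) (prod g X)"
proof (induction X rule: finite_induct)
  case (insert x X)
  then show ?case using homogeneous_mult[of 1 "g x" "card X" "prod g X"] by simp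
qed auto

lemma homogeneous_0_Const: "homogeneous 0 p \<Longrightarrow> p = Const (Poly_Mapping.lookup p 0)"
proof (rule poly_mapping_eqI)
  fix m assume "homogeneous 0 p"
  moreover have "m = 0" if "mdegree m = 0"
    using that by (intro poly_mapping_eqI) (simp add: mdegree_def)
  ultimately show "Poly_Mapping.lookup p m = Poly_Mapping.lookup (Const (Poly_Mapping.lookup p 0)) m"
    by (auto simp: homogeneous_lookup Const_def lookup_single when_def)
qed

definition component :: "nat \<Rightarrow> spoly \<Rightarrow> spoly" where
  "component k p = (\<Sum>m\<in>{m\<in>Poly_Mapping.keys p. mdegree m = k}. Poly_Mapping.single m (Poly_Mapping.lookup p m))"

lemma lookup_component: "Poly_Mapping.lookup (component k p) m = (if mdegree m = k then Poly_Mapping.lookup p m else 0)"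
proof -
  have "Poly_Mapping.lookup (component k p) m =
      (\<Sum>n\<in>{m\<in>Poly_Mapping.keys p. mdegree m = k}. if n = m then Poly_Mapping.lookup p m else 0)"
    unfolding component_def lookup_sum by (rule sum.cong) (auto simp: lookup_single when_def)
  then show ?thesis by (auto simp: in_keys_iff)
qed

lemma homogeneous_component [simp]: "homogeneous k (component k p)"
  by (auto simp: homogeneous_lookup lookup_component split: if_splits)

lemma component_add: "component k (p + q) = component k p + component k q"
  by (rule poly_mapping_eqI) (simp add: lookup_component lookup_add)

lemma component_0 [simp]: "component k 0 = 0"
  by (rule poly_mapping_eqI) (simp add: lookup_component)

lemma component_diff: "component k (p - q) = component k p - component k q"
  by (rule poly_mapping_eqI) (simp add: lookup_component lookup_minus)

lemma component_sum: "component k (sum g X) = (\<Sum>x\<in>X. component k (g x))"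
  by (induction X rule: infinite_finite_induct) (auto simp: component_add)

lemma component_homogeneous: "homogeneous j p \<Longrightarrow> component k p = (if j = k then p else 0)"
  by (rule poly_mapping_eqI) (auto simp: lookup_component homogeneous_lookup)

lemma component_single: "component k (Poly_Mapping.single m c) = (if mdegree m = k then Poly_Mapping.single m c else 0)"
  by (rule poly_mapping_eqI) (auto simp: lookup_component lookup_single when_def)

lemma homogeneous_single: "homogeneous (mdegree m) (Poly_Mapping.single m c)"
  by (auto simp: homogeneous_lookup lookup_single when_def)

text \<open>Multiplication by a homogeneous polynomial shifts components. This is how a relation between
  polynomials is replaced by a relation between their components of the expected degree.\<close>

lemma component_mult_homogeneous:
  assumes "homogeneous j p"
  shows "component k (p * q) = (if j \<le> k then p * component (k - j) q else 0)"
proof (induction q rule: additive_induct)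
  case (single m c)
  have "homogeneous (j + mdegree m) (p * Poly_Mapping.single m c)"
    by (intro homogeneous_mult assms homogeneous_single)
  then show ?case by (auto simp: component_homogeneous component_single)
next
  case (add q1 q2)
  then show ?case by (simp add: distrib_left component_add)
qed

section \<open>Linear forms\<close>

(* Linear forms are written as homogeneous 1 throughout, so 1 must not be rewritten to Suc 0. *)
declare One_nat_def [simp del]

text \<open>The coefficient of the \<open>i\<close>-th variable, read off as a value because linear forms are determined by their values.\<close>

definition lcoeff :: "spoly \<Rightarrow> 3 \<Rightarrow> complex" where
  "lcoeff l i = eval_poly l (axis i 1)"

lemma linear_expansion:
  assumes "homogeneous 1 l"
  shows "l = (\<Sum>i\<in>UNIV. Const (lcoeff l i) * Var i)"
proof -
  define c where "c i = Poly_Mapping.lookup l (Poly_Mapping.single i 1)" for i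
  have e: "l = (\<Sum>i\<in>UNIV. Const (c i) * Var i)"
  proof (rule poly_mapping_eqI)
    fix m
    show "Poly_Mapping.lookup l m = Poly_Mapping.lookup (\<Sum>i\<in>UNIV. Const (c i) * Var i) m"
    proof (cases "mdegree m = 1")
      case True
      then obtain j where j: "m = Poly_Mapping.single j 1"
      proof -
        from True have "m \<noteq> 0" by (auto simp: mdegree_def)
        then obtain j where "Poly_Mapping.lookup m j \<noteq> 0"
          by (metis poly_mapping_eqI lookup_zero)
        moreover have "mdegree m = Poly_Mapping.lookup m j + (\<Sum>i\<in>UNIV - {j}. Poly_Mapping.lookup m i)"
          unfolding mdegree_def by (subst sum.remove[of _ j]) auto
        ultimately have "Poly_Mapping.lookup m j = 1" "(\<Sum>i\<in>UNIV - {j}. Poly_Mapping.lookup m i) = 0"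
          using True by linarith+
        then have "Poly_Mapping.lookup m j = 1" "\<forall>i\<in>UNIV-{j}. Poly_Mapping.lookup m i = 0"
          by (simp_all only: sum_eq_0_iff finite)
        then have "m = Poly_Mapping.single j 1"
          by (intro poly_mapping_eqI) (auto simp: lookup_single when_def)
        then show ?thesis by (rule that)
      qed
      have "Poly_Mapping.single i (1::nat) = Poly_Mapping.single j 1 \<longleftrightarrow> i = j" for i j :: 3
        by (metis lookup_single_eq lookup_single_not_eq zero_neq_one)
      then show ?thesis unfolding j
        by (simp add: lookup_sum c_def Const_def Var_def mult_single lookup_single when_def)
    next
      case False
      have "homogeneous 1 (\<Sum>i\<in>UNIV. Const (c i) * Var i)"
        by (intro homogeneous_sum homogeneous_Const_mult homogeneous_Var)
      then have "Poly_Mapping.lookup (\<Sum>i\<in>UNIV. Const (c i) * Var i) m = 0"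
        using False unfolding homogeneous_lookup by blast
      moreover have "Poly_Mapping.lookup l m = 0"
        using assms False unfolding homogeneous_lookup by blast
      ultimately show ?thesis by simp
    qed
  qed
  have "lcoeff l i = c i" for i
    unfolding lcoeff_def by (subst e) (simp add: axis_def if_distrib[of "(*) _"] cong: if_cong)
  then show ?thesis using e by simp
qed

lemma eval_linear:
  assumes "homogeneous 1 l"
  shows "eval_poly l v = (\<Sum>i\<in>UNIV. lcoeff l i * v $ i)"
  by (subst linear_expansion[OF assms]) simp

lemma eval_linear3:
  assumes "homogeneous 1 l"
  shows "eval_poly l v = lcoeff l 1 * v $ 1 + lcoeff l 2 * v $ 2 + lcoeff l 3 * v $ 3"
  by (simp add: eval_linear[OF assms] sum_3)

lemma eval_linear_add: "homogeneous 1 l \<Longrightarrow> eval_poly l (u + v) = eval_poly l u + eval_poly l v"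
  and eval_linear_scale: "homogeneous 1 l \<Longrightarrow> eval_poly l (c *s v) = c * eval_poly l v"
  by (simp_all add: eval_linear3 algebra_simps)

lemma eval_linear_zero [simp]: "homogeneous 1 l \<Longrightarrow> eval_poly l 0 = 0"
  by (simp add: eval_linear3)

lemma linear_eqI:
  assumes "homogeneous 1 l" "homogeneous 1 l'" "lcoeff l 1 = lcoeff l' 1" "lcoeff l 2 = lcoeff l' 2"
    "lcoeff l 3 = lcoeff l' 3"
  shows "l = l'"
  using linear_expansion[OF assms(1)] linear_expansion[OF assms(2)] assms(3-)
  by (simp add: sum_3)

lemma pdiff_linear: "homogeneous 1 l \<Longrightarrow> pdiff i l = Const (lcoeff l i)"
  by (subst linear_expansion, assumption)
    (auto simp: sum_3 pdiff_add pdiff_mult pdiff_Var; use exhaust_3[of i] in auto)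

lemma linear_nonzero_value:
  assumes "homogeneous 1 l" "l \<noteq> 0"
  obtains q where "eval_poly l q = 1"
proof -
  obtain i where "lcoeff l i \<noteq> 0"
  proof (rule ccontr)
    assume "\<not> thesis"
    then have "\<And>i. lcoeff l i = 0" using that by blast
    then show False using linear_expansion[OF assms(1)] assms(2) by simp
  qed
  then have "eval_poly l ((1 / lcoeff l i) *s axis i 1) = 1"
    by (simp add: eval_linear_scale[OF assms(1)] lcoeff_def)
  then show ?thesis by (rule that)
qed

subsection \<open>Restriction to a line\<close>

interpretation sub: coefficient_hom Const
  by unfold_locales (simp_all add: Const_add Const_mult)

text \<open>An endomorphism \<open>\<sigma>\<close> of \<open>S\<close> that models the quotient \<open>S/(l)\<close> inside \<open>S\<close>: it kills exactly the
  multiples of \<open>l\<close> and changes every polynomial by a multiple of \<open>l\<close> only. Since its values lie in an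
  integral domain, this replaces the theory of quotient rings and gives the primality of \<open>l\<close>; that linear forms
  move only by constant multiples of \<open>l\<close> makes it possible to compare several lines after restriction.\<close>

definition restriction :: "spoly \<Rightarrow> (spoly \<Rightarrow> spoly) \<Rightarrow> bool" where
  "restriction l \<sigma> \<longleftrightarrow> (\<forall>x y. \<sigma> (x + y) = \<sigma> x + \<sigma> y) \<and> (\<forall>x y. \<sigma> (x * y) = \<sigma> x * \<sigma> y) \<and> \<sigma> 1 = 1 \<and>
     (\<forall>x. l dvd x - \<sigma> x) \<and> (\<forall>x. \<sigma> x = 0 \<longleftrightarrow> l dvd x) \<and>
     (\<forall>l'. homogeneous 1 l' \<longrightarrow> (\<exists>c. \<sigma> l' = l' - Const c * l))"

lemma restrictionD:
  assumes "restriction l \<sigma>"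
  shows "\<sigma> (x + y) = \<sigma> x + \<sigma> y" "\<sigma> (x * y) = \<sigma> x * \<sigma> y" "\<sigma> 1 = 1" "l dvd x - \<sigma> x"
    "\<sigma> x = 0 \<longleftrightarrow> l dvd x" "homogeneous 1 l' \<Longrightarrow> \<exists>c. \<sigma> l' = l' - Const c * l"
proof -
  note r = assms[unfolded restriction_def]
  show "\<sigma> (x + y) = \<sigma> x + \<sigma> y" by (rule r[THEN conjunct1, rule_format])
  show "\<sigma> (x * y) = \<sigma> x * \<sigma> y" by (rule r[THEN conjunct2, THEN conjunct1, rule_format])
  show "\<sigma> 1 = 1" by (rule r[THEN conjunct2, THEN conjunct2, THEN conjunct1])
  show "l dvd x - \<sigma> x"
    by (rule r[THEN conjunct2, THEN conjunct2, THEN conjunct2, THEN conjunct1, rule_format])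
  show "\<sigma> x = 0 \<longleftrightarrow> l dvd x"
    by (rule r[THEN conjunct2, THEN conjunct2, THEN conjunct2, THEN conjunct2, THEN conjunct1, rule_format])
  show "\<exists>c. \<sigma> l' = l' - Const c * l" if "homogeneous 1 l'"
    using that
    by (rule r[THEN conjunct2, THEN conjunct2, THEN conjunct2, THEN conjunct2, THEN conjunct2, rule_format])
qed

text \<open>If \<open>l(q) = 1\<close>, the projection along \<open>q\<close> onto the plane \<open>l = 0\<close> sends \<open>X\<close> to \<open>X - l(X) q\<close>;
  composing polynomials with it has the required properties.\<close>

lemma restriction_exists:
  assumes l: "homogeneous 1 l" "l \<noteq> 0"
  obtains \<sigma> where "restriction l \<sigma>"
proof -
  obtain q where q: "eval_poly l q = 1" using linear_nonzero_value[OF l] .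
  define \<sigma> where "\<sigma> = insertion Const (\<lambda>i. Var i - Const (q $ i) * l)"
  have add: "\<sigma> (x + y) = \<sigma> x + \<sigma> y" and mult: "\<sigma> (x * y) = \<sigma> x * \<sigma> y" for x y
    by (simp_all add: \<sigma>_def sub.insertion_add sub.insertion_mult)
  have C: "\<sigma> (Const c) = Const c" for c by (simp add: \<sigma>_def sub.insertion_Const)
  have V: "\<sigma> (Var i) = Var i - Const (q $ i) * l" for i by (simp add: \<sigma>_def sub.insertion_Var)
  have lin: "\<sigma> l' = l' - Const (eval_poly l' q) * l" if "homogeneous 1 l'" for l'
  proof -
    have "\<sigma> l' = (\<Sum>i\<in>UNIV. Const (lcoeff l' i) * Var i) - Const (eval_poly l' q) * l"
      by (subst linear_expansion[OF that])
        (simp add: sum_3 add mult C V eval_linear3[OF that] algebra_simps Const_add Const_mult)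
    then show ?thesis using linear_expansion[OF that] by simp
  qed
  have red: "l dvd x - \<sigma> x" for x
  proof (induction x rule: spoly_induct)
    case (add x y)
    then show ?case using dvd_add[of l "x - \<sigma> x" "y - \<sigma> y"] by (simp add: \<open>\<And>x y. \<sigma> (x + y) = _\<close> algebra_simps)
  next
    case (mult x y)
    have "x * y - \<sigma> (x * y) = (x - \<sigma> x) * y + \<sigma> x * (y - \<sigma> y)"
      by (simp add: \<open>\<And>x y. \<sigma> (x * y) = _\<close> algebra_simps)
    then show ?case using mult by (metis dvd_add dvd_mult dvd_mult2)
  qed (auto simp: C V)
  have "\<sigma> l = 0" using lin[OF l(1)] q by simp
  then have "\<sigma> x = 0 \<longleftrightarrow> l dvd x" for x
    using red[of x] by (auto simp: mult)
  moreover have "\<sigma> 1 = 1" using C[of 1] by simp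
  ultimately have "restriction l \<sigma>" unfolding restriction_def using add mult red lin by blast
  then show ?thesis by (rule that)
qed

lemma linear_prime:
  assumes l: "homogeneous 1 l" "l \<noteq> 0"
  shows "prime_elem l"
proof (rule prime_elemI)
  obtain \<sigma> where "restriction l \<sigma>" using restriction_exists[OF l] .
  note s = restrictionD(2,3)[OF this] and s0 = restrictionD(5)[OF this]
  show "l \<noteq> 0" by fact
  show "\<not> l dvd 1" using s(2) s0[of 1] by simp
  show "l dvd a \<or> l dvd b" if "l dvd a * b" for a b
    using that s0[of "a * b"] s0[of a] s0[of b] s(1)[of a b] by simp
qed

lemma linear_dvd_linear:
  assumes "homogeneous 1 l" "homogeneous 1 l'" "l dvd l'"
  obtains c where "l' = Const c * l"
proof -
  obtain k where "l' = l * k" using assms(3) by (auto elim: dvdE)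
  then have "component 1 l' = l * component 0 k"
    using component_mult_homogeneous[OF assms(1), of 1 k] by simp
  then have "l' = l * component 0 k" using assms(2) by (simp add: component_homogeneous)
  then show ?thesis using that homogeneous_0_Const[of "component 0 k"]
    by (metis homogeneous_component mult.commute)
qed

subsection \<open>Two lines and the point where they meet\<close>

definition distinct_lines :: "spoly \<Rightarrow> spoly \<Rightarrow> bool" where
  "distinct_lines l l' \<longleftrightarrow> homogeneous 1 l \<and> homogeneous 1 l' \<and> l \<noteq> 0 \<and> l' \<noteq> 0 \<and>
     (\<forall>c. l' \<noteq> Const c * l)"

lemma distinct_lines_sym: "distinct_lines l l' \<Longrightarrow> distinct_lines l' l"
  unfolding distinct_lines_def
proof (elim conjE, intro conjI allI notI)
  fix c assume n: "\<forall>c. l' \<noteq> Const c * l" and "l = Const c * l'" "l \<noteq> 0"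
  then have "c \<noteq> 0" by auto
  then have "Const (1 / c) * l = l'"
    using \<open>l = Const c * l'\<close> by (simp add: mult.assoc[symmetric] Const_mult[symmetric])
  with n show False by metis
qed auto

lemma distinct_lines_not_dvd: "distinct_lines l l' \<Longrightarrow> \<not> l dvd l'"
  unfolding distinct_lines_def by (metis linear_dvd_linear)

definition in_span :: "spoly \<Rightarrow> spoly \<Rightarrow> spoly \<Rightarrow> bool" where
  "in_span l l' x \<longleftrightarrow> (\<exists>s t. x = Const s * l + Const t * l')"

lemma in_span_self: "in_span x y x" "in_span x y y"
  unfolding in_span_def by (rule exI[of _ 1], rule exI[of _ 0], simp) (rule exI[of _ 0], rule exI[of _ 1], simp)

lemma in_span_sym: "in_span l l' x \<longleftrightarrow> in_span l' l x"
  unfolding in_span_def by (metis add.commute)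

text \<open>The cross product of the coefficient vectors; for two distinct lines it represents the point in
  which they meet.\<close>

definition cross :: "spoly \<Rightarrow> spoly \<Rightarrow> complex ^ 3" where
  "cross a b = vector [lcoeff a 2 * lcoeff b 3 - lcoeff a 3 * lcoeff b 2,
     lcoeff a 3 * lcoeff b 1 - lcoeff a 1 * lcoeff b 3,
     lcoeff a 1 * lcoeff b 2 - lcoeff a 2 * lcoeff b 1]"

definition dot :: "complex ^ 3 \<Rightarrow> complex ^ 3 \<Rightarrow> complex" where
  "dot u v = u $ 1 * v $ 1 + u $ 2 * v $ 2 + u $ 3 * v $ 3"

lemma cross_nonzero:
  assumes "distinct_lines a b"
  shows "cross a b \<noteq> 0"
proof
  assume z: "cross a b = 0"
  have h: "homogeneous 1 a" "homogeneous 1 b" "a \<noteq> 0" "\<And>c. b \<noteq> Const c * a"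
    using assms by (auto simp: distinct_lines_def)
  obtain q where q: "eval_poly a q = 1" using linear_nonzero_value[OF h(1,3)] .
  let ?c = "eval_poly b q"
  have lc: "lcoeff (Const ?c * a) i = ?c * lcoeff a i" for i by (simp add: lcoeff_def)
  have q': "lcoeff a 1 * q $ 1 + lcoeff a 2 * q $ 2 + lcoeff a 3 * q $ 3 = 1"
    using q eval_linear3[OF h(1)] by simp
  have w: "lcoeff a 2 * lcoeff b 3 = lcoeff a 3 * lcoeff b 2"
    "lcoeff a 3 * lcoeff b 1 = lcoeff a 1 * lcoeff b 3"
    "lcoeff a 1 * lcoeff b 2 = lcoeff a 2 * lcoeff b 1"
    using z by (auto simp: cross_def vec_eq_iff forall_3)
  have sym: "lcoeff a i * lcoeff b j = lcoeff a j * lcoeff b i" for i j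
    using w exhaust_3[of i] exhaust_3[of j] by (elim disjE) (simp_all add: mult.commute)
  have "lcoeff b i = lcoeff (Const ?c * a) i" for i
  proof -
    have "lcoeff b i = lcoeff b i * (lcoeff a 1 * q $ 1 + lcoeff a 2 * q $ 2 + lcoeff a 3 * q $ 3)"
      using q' by simp
    also have "\<dots> = (lcoeff a 1 * lcoeff b i) * q $ 1 + (lcoeff a 2 * lcoeff b i) * q $ 2
        + (lcoeff a 3 * lcoeff b i) * q $ 3" by (simp add: algebra_simps)
    also have "\<dots> = (lcoeff a i * lcoeff b 1) * q $ 1 + (lcoeff a i * lcoeff b 2) * q $ 2
        + (lcoeff a i * lcoeff b 3) * q $ 3" by (simp only: sym[of _ i])
    also have "\<dots> = ?c * lcoeff a i" unfolding eval_linear3[OF h(2)] by (simp add: algebra_simps)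
    finally show ?thesis by (simp add: lc)
  qed
  then have "b = Const ?c * a"
    by (intro linear_eqI homogeneous_Const_mult h) auto
  then show False using h(4) by blast
qed

lemma cross_dual:
  assumes "distinct_lines a b"
  obtains u where "dot u (cross a b) = 1"
proof -
  obtain i where i: "cross a b $ i \<noteq> 0" using cross_nonzero[OF assms] by (auto simp: vec_eq_iff)
  have "dot ((1 / cross a b $ i) *s axis i 1) (cross a b) = 1"
    using i exhaust_3[of i] by (auto simp: dot_def axis_def)
  then show ?thesis by (rule that)
qed

lemma common_zero_exists:
  assumes "distinct_lines a b"
  obtains v where "v \<noteq> 0" "eval_poly a v = 0" "eval_poly b v = 0"
proof -
  have h: "homogeneous 1 a" "homogeneous 1 b" using assms by (auto simp: distinct_lines_def)
  have "eval_poly a (cross a b) = 0" "eval_poly b (cross a b) = 0"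
    by (simp_all add: eval_linear3[OF h(1)] eval_linear3[OF h(2)] cross_def algebra_simps)
  then show ?thesis using that cross_nonzero[OF assms] by blast
qed

text \<open>Expanding \<open>v\<close> in the vectors \<open>a \<times> b\<close>, \<open>b \<times> u\<close>, \<open>u \<times> a\<close> dual to \<open>u\<close>, \<open>a\<close>, \<open>b\<close>,
  the last two coefficients are \<open>a(v)\<close> and \<open>b(v)\<close>.\<close>

lemma common_zero_cross:
  assumes "distinct_lines a b" "eval_poly a v = 0" "eval_poly b v = 0" "dot u (cross a b) = 1"
  shows "v = dot u v *s cross a b"
proof -
  have h: "homogeneous 1 a" "homogeneous 1 b" using assms by (auto simp: distinct_lines_def)
  let ?A = "lcoeff a" and ?B = "lcoeff b" and ?c = "cross a b"
  have "v $ 1 * dot u ?c = dot u v * ?c $ 1 + eval_poly a v * (?B 2 * u $ 3 - ?B 3 * u $ 2)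
      + eval_poly b v * (u $ 2 * ?A 3 - u $ 3 * ?A 2)"
    "v $ 2 * dot u ?c = dot u v * ?c $ 2 + eval_poly a v * (?B 3 * u $ 1 - ?B 1 * u $ 3)
      + eval_poly b v * (u $ 3 * ?A 1 - u $ 1 * ?A 3)"
    "v $ 3 * dot u ?c = dot u v * ?c $ 3 + eval_poly a v * (?B 1 * u $ 2 - ?B 2 * u $ 1)
      + eval_poly b v * (u $ 1 * ?A 2 - u $ 2 * ?A 1)"
    by (simp_all add: eval_linear3[OF h(1)] eval_linear3[OF h(2)] cross_def dot_def algebra_simps)
  then show ?thesis using assms(2-) by (simp add: vec_eq_iff forall_3)
qed

lemma common_zero_unique:
  assumes "distinct_lines a b" "v \<noteq> 0" "eval_poly a v = 0" "eval_poly b v = 0"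
    "eval_poly a w = 0" "eval_poly b w = 0"
  obtains c where "w = c *s v"
proof -
  obtain u where u: "dot u (cross a b) = 1" using cross_dual[OF assms(1)] .
  have v: "v = dot u v *s cross a b" and w: "w = dot u w *s cross a b"
    using common_zero_cross[OF assms(1) _ _ u] assms(3-) by auto
  have "dot u v \<noteq> 0" using v assms(2) by auto
  then have "(dot u w / dot u v) *s (dot u v *s cross a b) = dot u w *s cross a b"
    by simp
  then show ?thesis using that v w by metis
qed

lemma in_span_if_common_zero:
  assumes "distinct_lines a b" "v \<noteq> 0" "eval_poly a v = 0" "eval_poly b v = 0"
    "homogeneous 1 c" "eval_poly c v = 0"
  shows "in_span a b c"
proof -
  have h: "homogeneous 1 a" "homogeneous 1 b" using assms by (auto simp: distinct_lines_def)
  obtain u where u: "dot u (cross a b) = 1" using cross_dual[OF assms(1)] .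
  have v: "v = dot u v *s cross a b" using common_zero_cross[OF assms(1) _ _ u] assms(3-) by auto
  then have "dot u v \<noteq> 0" using assms(2) by auto
  moreover have "dot u v * eval_poly c (cross a b) = 0"
    using assms(6) v eval_linear_scale[OF assms(5)] by metis
  ultimately have D: "eval_poly c (cross a b) = 0" by simp
  let ?s = "dot u (cross c b)" and ?t = "dot u (cross a c)"
  have lc: "lcoeff (Const ?s * a + Const ?t * b) i = ?s * lcoeff a i + ?t * lcoeff b i" for i
    by (simp add: lcoeff_def)
  (* Cramer's rule for the vectors a, b, u. *)
  have cramer: "lcoeff c 1 * dot u (cross a b) = ?s * lcoeff a 1 + ?t * lcoeff b 1 + eval_poly c (cross a b) * u $ 1"
    "lcoeff c 2 * dot u (cross a b) = ?s * lcoeff a 2 + ?t * lcoeff b 2 + eval_poly c (cross a b) * u $ 2"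
    "lcoeff c 3 * dot u (cross a b) = ?s * lcoeff a 3 + ?t * lcoeff b 3 + eval_poly c (cross a b) * u $ 3"
    by (simp_all add: eval_linear3[OF assms(5)] cross_def dot_def algebra_simps)
  have "c = Const ?s * a + Const ?t * b"
    by (rule linear_eqI[OF assms(5)], intro homogeneous_add homogeneous_Const_mult h)
      (use cramer u D lc in simp_all)
  then show ?thesis by (auto simp: in_span_def)
qed

lemma in_span_zero: "in_span a b c \<Longrightarrow> eval_poly a v = 0 \<Longrightarrow> eval_poly b v = 0 \<Longrightarrow> eval_poly c v = 0"
  by (auto simp: in_span_def)

subsection \<open>Ideals generated by a linear form and a power of another\<close>

definition ideal2 :: "spoly \<Rightarrow> spoly \<Rightarrow> spoly set" where
  "ideal2 a b = {x. \<exists>s t. x = s * a + t * b}"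

lemma ideal2_add: "x \<in> ideal2 a b \<Longrightarrow> y \<in> ideal2 a b \<Longrightarrow> x + y \<in> ideal2 a b"
proof -
  assume "x \<in> ideal2 a b" "y \<in> ideal2 a b"
  then obtain s t s' t' where "x = s * a + t * b" "y = s' * a + t' * b" by (auto simp: ideal2_def)
  then have "x + y = (s + s') * a + (t + t') * b" by (simp add: algebra_simps)
  then show ?thesis by (auto simp: ideal2_def)
qed

lemma ideal2_mult: "x \<in> ideal2 a b \<Longrightarrow> y * x \<in> ideal2 a b"
proof -
  assume "x \<in> ideal2 a b"
  then obtain s t where "x = s * a + t * b" by (auto simp: ideal2_def)
  then have "y * x = (y * s) * a + (y * t) * b" by (simp add: algebra_simps)
  then show ?thesis by (auto simp: ideal2_def)
qed

lemma ideal2_diff: "x \<in> ideal2 a b \<Longrightarrow> y \<in> ideal2 a b \<Longrightarrow> x - y \<in> ideal2 a b"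
  using ideal2_add[of x a b "- 1 * y"] ideal2_mult[of y a b "-1"] by simp

lemma ideal2_sym: "ideal2 a b = ideal2 b a"
  unfolding ideal2_def by (metis add.commute)

lemma ideal2_left [simp]: "a dvd x \<Longrightarrow> x \<in> ideal2 a b"
  unfolding ideal2_def by (auto simp: dvd_def) (metis add.right_neutral mult.commute mult_zero_left)

lemma ideal2_right [simp]: "b dvd x \<Longrightarrow> x \<in> ideal2 a b"
  by (metis ideal2_left ideal2_sym)

lemma prime_power_dvd_cancel:
  fixes q :: "'a::idom"
  assumes "prime_elem q" "\<not> q dvd a" "q ^ n dvd a * b"
  shows "q ^ n dvd b"
  using assms(3)
proof (induction n arbitrary: b)
  case (Suc n)
  then have "q dvd a * b" by (metis dvd_mult_left power_Suc)
  then obtain b' where b': "b = q * b'" using assms(1,2) by (auto simp: prime_elem_dvd_mult_iff elim: dvdE)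
  have "q * q ^ n dvd q * (a * b')" using Suc(2) unfolding b' by (simp add: ac_simps)
  then have "q ^ n dvd a * b'" using assms(1) by (simp add: prime_elem_def)
  then have "q ^ n dvd b'" by (rule Suc.IH)
  then show ?case unfolding b' power_Suc by (intro mult_dvd_mono dvd_refl)
qed auto

lemma in_span_reduction:
  assumes "distinct_lines a b" "homogeneous 1 l" "\<not> in_span a b l"
  shows "distinct_lines (b - Const s * a) (l - Const t * a)"
  unfolding distinct_lines_def
proof (intro conjI allI notI)
  have h: "homogeneous 1 a" "homogeneous 1 b" "\<And>c. b \<noteq> Const c * a"
    using assms by (auto simp: distinct_lines_def)
  show "homogeneous 1 (b - Const s * a)" "homogeneous 1 (l - Const t * a)"
    by (intro homogeneous_diff homogeneous_Const_mult h assms)+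
  show "b - Const s * a = 0 \<Longrightarrow> False" using h(3)[of s] by simp
  show "l - Const t * a = 0 \<Longrightarrow> False"
    using assms(3) unfolding in_span_def by (metis Const_0 add.right_neutral eq_iff_diff_eq_0 mult_zero_left)
  show False if "l - Const t * a = Const c * (b - Const s * a)" for c
  proof -
    from that have "l = Const (t - c * s) * a + Const c * b"
      by (simp add: Const_diff Const_mult algebra_simps)
    then show False using assms(3) by (auto simp: in_span_def)
  qed
qed

text \<open>After restriction to the line \<open>a\<close>, the forms \<open>b\<close> and \<open>l\<close> stay non-proportional, hence \<open>l\<close> is coprime to
  the power of the prime \<open>b\<close>. Geometrically, \<open>(a, b\<^sup>n)\<close> is primary to the point where \<open>a\<close> and \<open>b\<close> meet, and \<open>l\<close>
  misses that point.\<close>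

lemma ideal2_cancel:
  assumes "distinct_lines a b" "homogeneous 1 l" "\<not> in_span a b l" "l * w \<in> ideal2 a (b ^ n)"
  shows "w \<in> ideal2 a (b ^ n)"
proof -
  have ha: "homogeneous 1 a" "a \<noteq> 0" "homogeneous 1 b" using assms(1) by (auto simp: distinct_lines_def)
  obtain \<sigma> where "restriction a \<sigma>" using restriction_exists[OF ha(1,2)] .
  note \<sigma> = restrictionD[OF this]
  have pw: "\<sigma> (b ^ n) = \<sigma> b ^ n" by (induction n) (auto simp: \<sigma>)
  have dl: "distinct_lines (\<sigma> b) (\<sigma> l)"
    using in_span_reduction[OF assms(1-3)] \<sigma>(6)[OF ha(3)] \<sigma>(6)[OF assms(2)] by auto
  have \<sigma>a: "\<sigma> a = 0" using \<sigma>(5)[of a] by simp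
  obtain s t where st: "l * w = s * a + t * b ^ n" using assms(4) by (auto simp: ideal2_def)
  have "\<sigma> l * \<sigma> w = \<sigma> t * \<sigma> b ^ n"
    using arg_cong[OF st, of \<sigma>] by (simp add: \<sigma>(1,2) \<sigma>a pw)
  then have "\<sigma> b ^ n dvd \<sigma> l * \<sigma> w" by simp
  moreover have "prime_elem (\<sigma> b)" using dl by (intro linear_prime) (auto simp: distinct_lines_def)
  ultimately have "\<sigma> b ^ n dvd \<sigma> w"
    using prime_power_dvd_cancel distinct_lines_not_dvd[OF dl] by blast
  then obtain k where k: "\<sigma> w = \<sigma> b ^ n * k" by (rule dvdE)
  have w: "w = ((w - \<sigma> w) - (b ^ n - \<sigma> b ^ n) * k) + b ^ n * k" by (simp add: k algebra_simps)
  have "a dvd b ^ n - \<sigma> b ^ n" using \<sigma>(4)[of "b ^ n"] unfolding pw .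
  then have "a dvd (w - \<sigma> w) - (b ^ n - \<sigma> b ^ n) * k"
    by (intro dvd_diff[OF \<sigma>(4)] dvd_mult2)
  then show ?thesis by (subst w) (intro ideal2_add ideal2_left ideal2_right dvd_triv_left)
qed

lemma ideal2_cancel1:
  assumes "distinct_lines a b" "homogeneous 1 l" "\<not> in_span a b l" "l * w \<in> ideal2 a b"
  shows "w \<in> ideal2 a b"
  using ideal2_cancel[of a b l w 1] assms by simp

lemma prime_elem_dvd_prodD:
  assumes "finite C" "prime_elem p" "p dvd prod g C"
  shows "\<exists>j\<in>C. p dvd g j"
  using assms(1,3)
proof (induction C rule: finite_induct)
  case empty
  then show ?case using prime_elem_not_unit[OF assms(2)] by simp
next
  case (insert j C)
  then show ?case using assms(2) by (auto simp: prime_elem_dvd_mult_iff)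
qed

lemma prod_dvd_of_distinct_lines:
  assumes "finite C" "\<And>i. i \<in> C \<Longrightarrow> g i dvd x"
    "\<And>i j. i \<in> C \<Longrightarrow> j \<in> C \<Longrightarrow> i \<noteq> j \<Longrightarrow> distinct_lines (g i) (g j)"
    "\<And>i. i \<in> C \<Longrightarrow> homogeneous 1 (g i) \<and> g i \<noteq> 0"
  shows "prod g C dvd x"
  using assms
proof (induction C rule: finite_induct)
  case (insert i C)
  then have "prod g C dvd x" by auto
  then obtain y where y: "x = prod g C * y" by (auto elim: dvdE)
  have p: "prime_elem (g i)" using insert by (auto intro: linear_prime)
  have "\<not> g i dvd prod g C"
  proof
    assume "g i dvd prod g C"
    then obtain j where "j \<in> C" "g i dvd g j"
      using prime_elem_dvd_prodD[OF insert(1) p] by blast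
    then show False using insert(2) insert.prems(2)[of i j] distinct_lines_not_dvd by auto
  qed
  moreover have "g i dvd prod g C * y" using insert.prems(1)[of i] y by simp
  ultimately have "g i dvd y" using p by (simp add: prime_elem_dvd_mult_iff)
  then show ?case using insert(1,2) unfolding y by (simp add: mult.commute mult_dvd_mono)
qed auto

section \<open>Graded submodules of the free module of rank three\<close>

definition component3 :: "nat \<Rightarrow> spoly ^ 3 \<Rightarrow> spoly ^ 3" where
  "component3 k g = (\<chi> i. component k (g $ i))"

lemma homogeneous3_component3 [simp]: "homogeneous3 k (component3 k g)"
  by (simp add: homogeneous3_def component3_def)

lemma component3_sum: "component3 k (sum g X) = (\<Sum>x\<in>X. component3 k (g x))"
  by (simp add: component3_def vec_eq_iff component_sum)

lemma component3_homogeneous: "homogeneous3 j g \<Longrightarrow> component3 k g = (if j = k then g else 0)"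
  using component_homogeneous[of j _ k] by (simp add: component3_def homogeneous3_def vec_eq_iff)

lemma component3_scale_homogeneous:
  assumes "homogeneous3 j g"
  shows "component3 k (a *s g) = (if j \<le> k then component (k - j) a *s g else 0)"
proof -
  have "component k (a * g $ i) = (if j \<le> k then component (k - j) a * g $ i else 0)" for i
    using component_mult_homogeneous[of j "g $ i" k a] assms by (auto simp: homogeneous3_def mult.commute)
  then show ?thesis by (auto simp: component3_def vec_eq_iff)
qed

lemma span_set_iff:
  "x \<in> S3.span (set gs) \<longleftrightarrow> (\<exists>a. x = (\<Sum>i<length gs. a i *s gs ! i))"
proof (induction gs arbitrary: x)
  case (Cons g gs)
  have "x \<in> S3.span (set (g # gs)) \<longleftrightarrow> (\<exists>k a. x - k *s g = (\<Sum>i<length gs. a i *s gs ! i))"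
    by (simp add: S3.span_insert Cons.IH)
  also have "\<dots> \<longleftrightarrow> (\<exists>a. x = (\<Sum>i<length (g # gs). a i *s (g # gs) ! i))"
  proof (safe)
    fix k a assume "x - k *s g = (\<Sum>i<length gs. a i *s gs ! i)"
    then have "x = (\<Sum>i<length (g # gs). (case i of 0 \<Rightarrow> k | Suc j \<Rightarrow> a j) *s (g # gs) ! i)"
      by (simp add: sum.lessThan_Suc_shift del: sum.lessThan_Suc) (metis add.commute diff_add_cancel)
    then show "\<exists>a. x = (\<Sum>i<length (g # gs). a i *s (g # gs) ! i)"
      by (rule exI[where x = "\<lambda>i. case i of 0 \<Rightarrow> k | Suc j \<Rightarrow> a j"])
  next
    fix a assume "x = (\<Sum>i<length (g # gs). a i *s (g # gs) ! i)"
    then have "(\<Sum>i<length (g # gs). a i *s (g # gs) ! i) - a 0 *s g = (\<Sum>i<length gs. a (Suc i) *s gs ! i)"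
      by (simp add: sum.lessThan_Suc_shift del: sum.lessThan_Suc)
    then show "\<exists>k b. (\<Sum>i<length (g # gs). a i *s (g # gs) ! i) - k *s g = (\<Sum>i<length gs. b i *s gs ! i)"
      by - (rule exI[of _ "a 0"], rule exI[of _ "\<lambda>i. a (Suc i)"])
  qed
  finally show ?case .
qed auto

lemma span_indexed_sum:
  assumes "\<And>i. i \<in> X \<Longrightarrow> a i \<noteq> 0 \<Longrightarrow> g i \<in> G"
  shows "(\<Sum>i\<in>X. a i *s g i) \<in> S3.span G"
proof (rule S3.span_sum)
  fix i assume "i \<in> X"
  then show "a i *s g i \<in> S3.span G"
    using assms[of i] by (cases "a i = 0") (auto intro: S3.span_scale S3.span_base S3.span_zero)
qed

text \<open>A homogeneous element of the span of homogeneous generators is a combination with homogeneous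
  coefficients of the complementary degrees: take the component of degree \<open>k\<close> of any combination.\<close>

lemma homogeneous_in_span:
  assumes "list_all2 homogeneous3 es gs" "homogeneous3 k x" "x \<in> S3.span (set gs)"
  shows "\<exists>a. x = (\<Sum>i<length gs. a i *s gs ! i) \<and>
    (\<forall>i<length gs. if es ! i \<le> k then homogeneous (k - es ! i) (a i) else a i = 0)"
proof -
  obtain b where b: "x = (\<Sum>i<length gs. b i *s gs ! i)" using assms(3) span_set_iff by blast
  have h: "homogeneous3 (es ! i) (gs ! i)" if "i < length gs" for i
    using assms(1) that by (simp add: list_all2_conv_all_nth)
  define a where "a i = (if es ! i \<le> k then component (k - es ! i) (b i) else 0)" for i
  have "x = component3 k x" using assms(2) by (simp add: component3_homogeneous)
  also have "\<dots> = (\<Sum>i<length gs. a i *s gs ! i)"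
    unfolding b component3_sum
    by (rule sum.cong) (auto simp: component3_scale_homogeneous[OF h] a_def)
  finally show ?thesis by (intro exI[of _ a]) (simp add: a_def)
qed

lemma minimal_generating_set_not_in_span:
  assumes "minimal_generating_set M G" "g \<in> G"
  shows "g \<notin> S3.span (G - {g})"
proof
  assume g: "g \<in> S3.span (G - {g})"
  have "x \<in> S3.span (G - {g})" if "x \<in> G" for x
    using g S3.span_base[of x "G - {g}"] that by (cases "x = g") simp_all
  then have "G \<subseteq> S3.span (G - {g})" by (rule subsetI)
  then have "S3.span G \<subseteq> S3.span (G - {g})" by (rule S3.span_minimal[OF _ S3.subspace_span])
  moreover have "S3.span (G - {g}) \<subseteq> S3.span G" by (intro S3.span_mono) auto
  ultimately have "S3.span (G - {g}) = M"
    using assms by (simp add: minimal_generating_set_def)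
  moreover have "G - {g} \<subset> G" using assms(2) by auto
  ultimately show False using assms(1) unfolding minimal_generating_set_def by metis
qed

lemma minimal_generating_setI:
  assumes "S3.span G = M" "\<And>g. g \<in> G \<Longrightarrow> g \<notin> S3.span (G - {g})"
  shows "minimal_generating_set M G"
  unfolding minimal_generating_set_def
proof (intro conjI allI impI notI)
  fix H assume "H \<subset> G" and H: "S3.span H = M"
  then obtain g where g: "g \<in> G" "H \<subseteq> G - {g}" by blast
  then have "S3.span H \<subseteq> S3.span (G - {g})" by (intro S3.span_mono)
  moreover have "g \<in> S3.span H" using g(1) H assms(1) S3.span_base by blast
  ultimately show False using assms(2) g by blast
qed fact

text \<open>Fewer homogeneous linear equations than unknowns: Gaussian elimination of one unknown per equation.\<close>

lemma homogeneous_system_solvable: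
  fixes c :: "'a \<Rightarrow> 'b \<Rightarrow> complex"
  assumes "finite J" "finite I" "card J < card I"
  shows "\<exists>x. (\<exists>i\<in>I. x i \<noteq> 0) \<and> (\<forall>j\<in>J. (\<Sum>i\<in>I. x i * c i j) = 0)"
  using assms
proof (induction J arbitrary: I c rule: finite_induct)
  case empty
  then have "I \<noteq> {}" by auto
  then show ?case by (intro exI[of _ "\<lambda>_. 1"]) auto
next
  case (insert j J)
  show ?case
  proof (cases "\<forall>i\<in>I. c i j = 0")
    case True
    have "card J < card I" using insert by simp
    then obtain x where x: "\<exists>i\<in>I. x i \<noteq> 0" "\<forall>j\<in>J. (\<Sum>i\<in>I. x i * c i j) = 0"
      using insert.IH[OF insert.prems(1), of c] by blast
    moreover have "(\<Sum>i\<in>I. x i * c i j) = 0" using True by simp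
    ultimately show ?thesis by blast
  next
    case False
    then obtain k where k: "k \<in> I" "c k j \<noteq> 0" by blast
    let ?d = "\<lambda>i j'. c i j' - c i j / c k j * c k j'"
    have "card J < card (I - {k})" using insert k by simp
    then obtain x where x: "\<exists>i\<in>I - {k}. x i \<noteq> 0" "\<forall>j'\<in>J. (\<Sum>i\<in>I - {k}. x i * ?d i j') = 0"
      using insert.IH[of "I - {k}" ?d] insert.prems(1) by blast
    define y where "y i = (if i = k then - (\<Sum>i\<in>I - {k}. x i * c i j / c k j) else x i)" for i
    have y: "(\<Sum>i\<in>I. y i * c i j') = (\<Sum>i\<in>I - {k}. x i * ?d i j')" for j'
    proof -
      have "(\<Sum>i\<in>I. y i * c i j') = y k * c k j' + (\<Sum>i\<in>I - {k}. y i * c i j')"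
        using k insert.prems(1) by (simp add: sum.remove)
      also have "(\<Sum>i\<in>I - {k}. y i * c i j') = (\<Sum>i\<in>I - {k}. x i * c i j')"
        by (rule sum.cong) (auto simp: y_def)
      also have "y k * c k j' = - (\<Sum>i\<in>I - {k}. x i * (c i j / c k j * c k j'))"
        by (simp add: y_def sum_distrib_left sum_distrib_right mult_ac)
      finally show ?thesis by (simp add: right_diff_distrib sum_subtractf)
    qed
    have "(\<Sum>i\<in>I. y i * c i j) = 0" unfolding y using k by simp
    moreover have "\<exists>i\<in>I. y i \<noteq> 0" using x(1) by (auto simp: y_def)
    ultimately show ?thesis using x(2) y by auto
  qed
qed

text \<open>The graded Nakayama lemma in the form of an exchange argument. Modulo the submodule \<open>U\<close> generated in degrees
  below \<open>k\<close>, which is the same for both generating sets, each generator of degree \<open>k\<close> in \<open>gs\<close> is a linear combination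
  over \<open>\<complex>\<close> of those in \<open>gs'\<close>. If \<open>gs\<close> had more of them, a non-trivial combination of them would lie in \<open>U\<close>, and
  one of them would be redundant.\<close>

lemma minimal_generators_degree_count_le:
  assumes gs: "distinct gs" "minimal_generating_set M (set gs)" "list_all2 homogeneous3 es gs"
    and gs': "S3.span (set gs') = M" "list_all2 homogeneous3 es' gs'"
  shows "card {i. i < length gs \<and> es ! i = k} \<le> card {j. j < length gs' \<and> es' ! j = k}"
proof (rule ccontr)
  let ?N = "{i. i < length gs \<and> es ! i = k}" and ?N' = "{j. j < length gs' \<and> es' ! j = k}"
  let ?U = "S3.span {gs ! i | i. i < length gs \<and> es ! i < k}"
  assume "\<not> card ?N \<le> card ?N'"
  then have less: "card ?N' < card ?N" by simp
  have span: "S3.span (set gs) = M" using gs(2) by (simp add: minimal_generating_set_def)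
  have h: "homogeneous3 (es ! i) (gs ! i)" if "i < length gs" for i
    using gs(3) that by (simp add: list_all2_conv_all_nth)
  have h': "homogeneous3 (es' ! i) (gs' ! i)" if "i < length gs'" for i
    using gs'(2) that by (simp add: list_all2_conv_all_nth)
  have low: "gs' ! j \<in> ?U" if j: "j < length gs'" "es' ! j < k" for j
  proof -
    have "gs' ! j \<in> S3.span (set gs)" using j gs'(1) span S3.span_base[of "gs' ! j" "set gs'"] by auto
    then obtain a where a: "gs' ! j = (\<Sum>i<length gs. a i *s gs ! i)"
      "\<forall>i<length gs. if es ! i \<le> es' ! j then homogeneous (es' ! j - es ! i) (a i) else a i = 0"
      using homogeneous_in_span[OF gs(3) h'[OF j(1)]] by blast
    have "(\<Sum>i<length gs. a i *s gs ! i) \<in> ?U"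
    proof (rule span_indexed_sum)
      fix i assume i: "i \<in> {..<length gs}" "a i \<noteq> 0"
      then have "es ! i \<le> es' ! j" using a(2) by (metis lessThan_iff)
      then show "gs ! i \<in> {gs ! i | i. i < length gs \<and> es ! i < k}" using i j(2) by auto
    qed
    then show ?thesis using a(1) by simp
  qed
  have "\<exists>c. gs ! i - (\<Sum>j\<in>?N'. Const (c j) *s gs' ! j) \<in> ?U" if i: "i \<in> ?N" for i
  proof -
    have "gs ! i \<in> S3.span (set gs')" using i gs'(1) span S3.span_base[of "gs ! i" "set gs"] by auto
    moreover have "homogeneous3 k (gs ! i)" using h i by auto
    ultimately obtain a where a: "gs ! i = (\<Sum>j<length gs'. a j *s gs' ! j)"
      and a2: "\<forall>j<length gs'. if es' ! j \<le> k then homogeneous (k - es' ! j) (a j) else a j = 0"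
      using homogeneous_in_span[OF gs'(2)] by blast
    define c where "c j = Poly_Mapping.lookup (a j) 0" for j
    have c: "a j = Const (c j)" if "j \<in> ?N'" for j
      using a2[rule_format, of j] that homogeneous_0_Const[of "a j"] by (simp add: c_def)
    have "gs ! i = (\<Sum>j\<in>?N'. a j *s gs' ! j) + (\<Sum>j\<in>{..<length gs'} - ?N'. a j *s gs' ! j)"
      unfolding a by (subst add.commute, rule sum.subset_diff) auto
    moreover have "(\<Sum>j\<in>?N'. a j *s gs' ! j) = (\<Sum>j\<in>?N'. Const (c j) *s gs' ! j)"
      by (rule sum.cong) (use c in auto)
    ultimately have "gs ! i - (\<Sum>j\<in>?N'. Const (c j) *s gs' ! j) = (\<Sum>j\<in>{..<length gs'} - ?N'. a j *s gs' ! j)"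
      by simp
    moreover have "\<dots> \<in> ?U"
    proof (rule S3.span_sum)
      fix j assume j: "j \<in> {..<length gs'} - ?N'"
      show "a j *s gs' ! j \<in> ?U"
        using j low[of j] a2[rule_format, of j]
          by (cases "es' ! j < k") (auto intro: S3.span_scale S3.span_zero)
    qed
    ultimately show ?thesis by (intro exI[of _ c]) (simp only:)
  qed
  then have "\<forall>i\<in>?N. \<exists>c. gs ! i - (\<Sum>j\<in>?N'. Const (c j) *s gs' ! j) \<in> ?U" by (rule ballI)
  from bchoice[OF this] obtain c
    where c: "\<forall>i\<in>?N. gs ! i - (\<Sum>j\<in>?N'. Const (c i j) *s gs' ! j) \<in> ?U" ..
  obtain x where x: "\<exists>i\<in>?N. x i \<noteq> 0" "\<forall>j\<in>?N'. (\<Sum>i\<in>?N. x i * c i j) = 0"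
    using homogeneous_system_solvable[OF _ _ less, of c] by auto
  then obtain k0 where k0: "k0 \<in> ?N" "x k0 \<noteq> 0" by blast
  have "(\<Sum>i\<in>?N. Const (x i) *s (gs ! i - (\<Sum>j\<in>?N'. Const (c i j) *s gs' ! j))) \<in> ?U"
    by (intro S3.span_sum S3.span_scale c[rule_format])
  moreover have "(\<Sum>i\<in>?N. Const (x i) *s (\<Sum>j\<in>?N'. Const (c i j) *s gs' ! j)) =
      (\<Sum>j\<in>?N'. Const (\<Sum>i\<in>?N. x i * c i j) *s gs' ! j)"
    unfolding S3.scale_sum_right
    by (subst sum.swap) (simp add: Const_sum Const_mult S3.scale_sum_left vector_smult_assoc)
  then have "(\<Sum>i\<in>?N. Const (x i) *s (\<Sum>j\<in>?N'. Const (c i j) *s gs' ! j)) = 0"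
    using x(2) by (simp add: vec_eq_iff)
  ultimately have *: "(\<Sum>i\<in>?N. Const (x i) *s gs ! i) \<in> ?U"
    by (simp add: S3.scale_right_diff_distrib sum_subtractf)
  let ?V = "S3.span (set gs - {gs ! k0})"
  have ne: "gs ! i \<in> set gs - {gs ! k0}" if "i < length gs" "i \<noteq> k0" for i
    using that k0 gs(1) by (auto simp: nth_eq_iff_index_eq)
  have "?U \<subseteq> ?V"
    using k0 ne by (intro S3.span_mono) fastforce
  with * have all: "(\<Sum>i\<in>?N. Const (x i) *s gs ! i) \<in> ?V" by blast
  have "(\<Sum>i\<in>?N. Const (x i) *s gs ! i) =
      Const (x k0) *s gs ! k0 + (\<Sum>i\<in>?N - {k0}. Const (x i) *s gs ! i)"
    using k0 by (simp add: sum.remove)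
  then have split: "Const (x k0) *s gs ! k0 =
      (\<Sum>i\<in>?N. Const (x i) *s gs ! i) - (\<Sum>i\<in>?N - {k0}. Const (x i) *s gs ! i)"
    by simp
  have "(\<Sum>i\<in>?N - {k0}. Const (x i) *s gs ! i) \<in> ?V"
    by (rule span_indexed_sum, rule ne) auto
  with all have "Const (x k0) *s gs ! k0 \<in> ?V" unfolding split by (rule S3.span_diff)
  then have "Const (1 / x k0) *s (Const (x k0) *s gs ! k0) \<in> ?V" by (rule S3.span_scale)
  then have "gs ! k0 \<in> ?V"
    using k0(2) by (simp add: vector_smult_assoc Const_mult[symmetric] del: One_nat_def)
  then show False using minimal_generating_set_not_in_span[OF gs(2), of "gs ! k0"] k0 by auto
qed

lemma minimal_generators_degrees_unique:
  assumes "distinct gs" "minimal_generating_set M (set gs)" "list_all2 homogeneous3 es gs" "sorted es"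
    and "distinct gs'" "minimal_generating_set M (set gs')" "list_all2 homogeneous3 es' gs'" "sorted es'"
  shows "es = es'"
proof -
  have len: "length es = length gs" "length es' = length gs'"
    using assms by (auto dest: list_all2_lengthD)
  have sp: "S3.span (set gs) = M" "S3.span (set gs') = M"
    using assms by (auto simp: minimal_generating_set_def)
  have "card {i. i < length es \<and> es ! i = k} = card {i. i < length es' \<and> es' ! i = k}" for k
    unfolding len
    using minimal_generators_degree_count_le[OF assms(1-3) sp(2) assms(7), of k]
      minimal_generators_degree_count_le[OF assms(5-7) sp(1) assms(3), of k] by simp
  moreover have "count (mset xs) k = card {i. i < length xs \<and> xs ! i = k}" for xs :: "nat list" and k
    by (simp add: count_mset count_list_eq_length_filter length_filter_conv_card eq_commute[of k])
  ultimately have "count (mset es) k = count (mset es') k" for k by simp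
  then have "mset es = mset es'" by (rule multiset_eqI)
  then show ?thesis using assms(4,8) by (metis properties_for_sort)
qed

lemma exponents_eqI:
  assumes "distinct gs" "minimal_generating_set (AR f) (set gs)" "list_all2 homogeneous3 es gs" "sorted es"
  shows "exponents f = es"
  unfolding exponents_def
  by (rule the_equality) (use assms minimal_generators_degrees_unique in blast)+

lemma mdr_eqI:
  assumes "minimal_generating_set (AR f) (set gs)" "list_all2 homogeneous3 es gs" "sorted es" "gs \<noteq> []"
  shows "mdr f = hd es"
  unfolding mdr_def
proof (rule Least_equality)
  have len: "length es = length gs" using assms by (auto dest: list_all2_lengthD)
  have span: "S3.span (set gs) = AR f" using assms by (simp add: minimal_generating_set_def)
  have "gs ! 0 \<in> set gs" using assms(4) by simp
  then have "gs ! 0 \<noteq> 0"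
    using minimal_generating_set_not_in_span[OF assms(1)] S3.span_zero by metis
  moreover have "gs ! 0 \<in> AR f" using \<open>gs ! 0 \<in> set gs\<close> span S3.span_base by blast
  moreover have "homogeneous3 (hd es) (gs ! 0)"
  proof -
    have "hd es = es ! 0" using assms(4) len by (cases es) auto
    then show ?thesis using assms(2,4) by (simp add: list_all2_conv_all_nth)
  qed
  ultimately show "\<exists>g\<in>AR f. g \<noteq> 0 \<and> homogeneous3 (hd es) g" by blast
  fix k assume "\<exists>g\<in>AR f. g \<noteq> 0 \<and> homogeneous3 k g"
  then obtain g where g: "g \<in> S3.span (set gs)" "g \<noteq> 0" "homogeneous3 k g" using span by blast
  obtain a where a: "g = (\<Sum>i<length gs. a i *s gs ! i)"
      "\<forall>i<length gs. if es ! i \<le> k then homogeneous (k - es ! i) (a i) else a i = 0"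
    using homogeneous_in_span[OF assms(2) g(3,1)] by blast
  show "hd es \<le> k"
  proof (rule ccontr)
    assume n: "\<not> hd es \<le> k"
    have "a i = 0" if i: "i < length gs" for i
    proof -
      have "es ! 0 \<le> es ! i" using assms(3) i len by (intro sorted_nth_mono) auto
      then have "\<not> es ! i \<le> k" using n i len by (cases es) auto
      then show ?thesis using a(2) i by metis
    qed
    then have "g = 0" unfolding a(1) by (intro sum.neutral) auto
    then show False using g by simp
  qed
qed

section \<open>Jacobian relations as derivations\<close>

text \<open>The derivation \<open>\<Sum> \<theta>\<^sub>i \<partial>\<^sub>i\<close> with coefficient vector \<open>\<theta>\<close>. Jacobian relations of \<open>f\<close> are the derivations that
  kill \<open>f\<close>.\<close>

definition der :: "spoly ^ 3 \<Rightarrow> spoly \<Rightarrow> spoly" where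
  "der \<theta> q = (\<Sum>i\<in>UNIV. \<theta> $ i * pdiff i q)"

lemma AR_iff: "\<theta> \<in> AR f \<longleftrightarrow> der \<theta> f = 0"
  by (simp add: AR_def der_def)

lemma der_add: "der (\<theta> + \<eta>) q = der \<theta> q + der \<eta> q"
  and der_diff: "der (\<theta> - \<eta>) q = der \<theta> q - der \<eta> q"
  and der_scale: "der (a *s \<theta>) q = a * der \<theta> q"
  and der_zero [simp]: "der 0 q = 0"
  by (simp_all add: der_def sum_3 algebra_simps)

lemma der_mult: "der \<theta> (q * r) = der \<theta> q * r + q * der \<theta> r"
  by (simp add: der_def sum_3 pdiff_mult algebra_simps)

lemma der_Const [simp]: "der \<theta> (Const c) = 0"
  by (simp add: der_def)

lemma der_1 [simp]: "der \<theta> 1 = 0"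
  using der_Const[of \<theta> 1] by simp

lemma der_linear: "homogeneous 1 l \<Longrightarrow> der \<theta> l = (\<Sum>i\<in>UNIV. \<theta> $ i * Const (lcoeff l i))"
  by (simp add: der_def pdiff_linear)

lemma AR_subspace: "S3.subspace (AR f)"
  by (rule S3.subspaceI) (simp_all add: AR_iff der_add der_scale)

lemma AR_Const_mult: "k \<noteq> 0 \<Longrightarrow> AR (Const k * f) = AR f"
  by (auto simp: AR_iff der_mult)

definition euler :: "spoly ^ 3" where
  "euler = (\<chi> i. Var i)"

definition const_field :: "complex ^ 3 \<Rightarrow> spoly ^ 3" where
  "const_field p = (\<chi> i. Const (p $ i))"

lemma der_euler_linear: "homogeneous 1 l \<Longrightarrow> der euler l = l"
  using linear_expansion[of l] by (simp add: der_linear euler_def mult.commute)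

lemma der_const_field: "homogeneous 1 l \<Longrightarrow> der (const_field p) l = Const (eval_poly l p)"
  by (simp add: der_linear const_field_def eval_linear3 sum_3 Const_add Const_mult mult.commute)

lemma der_euler_prod:
  assumes "finite B" "\<And>l. l \<in> B \<Longrightarrow> homogeneous 1 l"
  shows "der euler (\<Prod>B) = of_nat (card B) * \<Prod>B"
  using assms by (induction B rule: finite_induct) (simp_all add: der_mult der_euler_linear algebra_simps)

text \<open>The next two lemmas say that a derivation preserves the ideal of a product of pairwise coprime primes
  iff it preserves the ideal of each factor; both come from the Leibniz rule.\<close>

lemma prod_dvd_der_prod:
  assumes "finite B" "\<And>l. l \<in> B \<Longrightarrow> l dvd der \<theta> l"
  shows "\<Prod>B dvd der \<theta> (\<Prod>B)"
  using assms
proof (induction B rule: finite_induct)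
  case (insert l B)
  then have "l dvd der \<theta> l" "\<Prod>B dvd der \<theta> (\<Prod>B)" by auto
  then show ?case using insert(1,2) by (simp add: der_mult dvd_add mult_dvd_mono)
qed auto

lemma dvd_der_if_der_prod_zero:
  assumes "finite B" "l \<in> B" "der \<theta> (\<Prod>B) = 0" "prime_elem l" "\<And>l'. l' \<in> B - {l} \<Longrightarrow> \<not> l dvd l'"
  shows "l dvd der \<theta> l"
proof -
  let ?R = "\<Prod>(B - {l})"
  have "\<Prod>B = l * ?R" using prod.remove[OF assms(1,2), of "\<lambda>x. x"] .
  then have "der \<theta> l * ?R = - (l * der \<theta> ?R)"
    using assms(3) by (simp add: der_mult eq_neg_iff_add_eq_0)
  then have "l dvd der \<theta> l * ?R" by simp
  moreover have "\<not> l dvd ?R"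
    using prime_elem_dvd_prodD[of "B - {l}" l "\<lambda>x. x"] assms(1,4,5) by blast
  ultimately show ?thesis using assms(4) prime_elem_dvd_multD by blast
qed

lemma homogeneous_pdiff:
  assumes "homogeneous (Suc n) q"
  shows "homogeneous n (pdiff i q)"
  unfolding pdiff_def
proof (rule homogeneous_sum)
  fix m assume "m \<in> Poly_Mapping.keys q"
  then have m: "mdegree m = Suc n" using assms by (simp add: homogeneous_def)
  show "homogeneous n (Poly_Mapping.single (m - Poly_Mapping.single i 1)
      (of_nat (Poly_Mapping.lookup m i) * Poly_Mapping.lookup q m))"
  proof (cases "Poly_Mapping.lookup m i = 0")
    case False
    then have "m = (m - Poly_Mapping.single i 1) + Poly_Mapping.single i 1"
      by (intro poly_mapping_eqI) (auto simp: lookup_add lookup_minus lookup_single when_def)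
    then have "mdegree m = mdegree (m - Poly_Mapping.single i 1) + 1"
      using mdegree_add[of "m - Poly_Mapping.single i 1" "Poly_Mapping.single i 1"]
      by (simp add: mdegree_single)
    then have "mdegree (m - Poly_Mapping.single i 1) = n" using m by simp
    then show ?thesis using homogeneous_single by metis
  qed simp
qed

lemma der_component3:
  assumes "homogeneous (Suc j) q"
  shows "der (component3 k \<theta>) q = component (j + k) (der \<theta> q)"
proof -
  have "component (j + k) (\<theta> $ i * pdiff i q) = component k (\<theta> $ i) * pdiff i q" for i
    using component_mult_homogeneous[OF homogeneous_pdiff[OF assms, of i], of "j + k" "\<theta> $ i"]
    by (simp add: mult.commute)
  then show ?thesis by (simp add: der_def component3_def component_sum)
qed

lemma component3_AR: "homogeneous (Suc j) f \<Longrightarrow> \<theta> \<in> AR f \<Longrightarrow> component3 k \<theta> \<in> AR f"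
  by (simp add: AR_iff der_component3)

text \<open>A vector field with \<open>\<theta>(a) = \<theta>(b) = 0\<close> is parallel to the direction \<open>p\<close> in which \<open>a\<close> and \<open>b\<close> vanish. The proof is
  that of \<open>common_zero_cross\<close> with polynomial entries, which gives a polynomial multiplier without denominators.\<close>

lemma const_field_multiple:
  assumes ab: "distinct_lines a b" and p: "p \<noteq> 0" "eval_poly a p = 0" "eval_poly b p = 0"
    and w: "der w a = 0" "der w b = 0"
  obtains c where "w = c *s const_field p"
proof -
  have h: "homogeneous 1 a" "homogeneous 1 b" using ab by (auto simp: distinct_lines_def)
  obtain u where u: "dot u (cross a b) = 1" using cross_dual[OF ab] .
  have pp: "p = dot u p *s cross a b" using common_zero_cross[OF ab p(2,3) u] .
  let ?A = "\<lambda>i. Const (lcoeff a i)" and ?B = "\<lambda>i. Const (lcoeff b i)" and ?u = "\<lambda>i. Const (u $ i)"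
  define d where "d = ?u 1 * w $ 1 + ?u 2 * w $ 2 + ?u 3 * w $ 3"
  let ?n1 = "?A 2 * ?B 3 - ?A 3 * ?B 2" and ?n2 = "?A 3 * ?B 1 - ?A 1 * ?B 3"
    and ?n3 = "?A 1 * ?B 2 - ?A 2 * ?B 1"
  have n: "Const (cross a b $ 1) = ?n1" "Const (cross a b $ 2) = ?n2" "Const (cross a b $ 3) = ?n3"
    by (simp_all add: cross_def Const_diff Const_mult)
  have w': "?A 1 * w $ 1 + ?A 2 * w $ 2 + ?A 3 * w $ 3 = 0" "?B 1 * w $ 1 + ?B 2 * w $ 2 + ?B 3 * w $ 3 = 0"
    using w by (simp_all add: der_linear h sum_3 mult.commute)
  have one: "?u 1 * ?n1 + ?u 2 * ?n2 + ?u 3 * ?n3 = 1"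
    using arg_cong[OF u, of Const] unfolding dot_def Const_add Const_mult n by simp
  have "w $ 1 * (?u 1 * ?n1 + ?u 2 * ?n2 + ?u 3 * ?n3) = d * ?n1
      + (?A 1 * w $ 1 + ?A 2 * w $ 2 + ?A 3 * w $ 3) * (?B 2 * ?u 3 - ?B 3 * ?u 2)
      + (?B 1 * w $ 1 + ?B 2 * w $ 2 + ?B 3 * w $ 3) * (?u 2 * ?A 3 - ?u 3 * ?A 2)"
    "w $ 2 * (?u 1 * ?n1 + ?u 2 * ?n2 + ?u 3 * ?n3) = d * ?n2
      + (?A 1 * w $ 1 + ?A 2 * w $ 2 + ?A 3 * w $ 3) * (?B 3 * ?u 1 - ?B 1 * ?u 3)
      + (?B 1 * w $ 1 + ?B 2 * w $ 2 + ?B 3 * w $ 3) * (?u 3 * ?A 1 - ?u 1 * ?A 3)"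
    "w $ 3 * (?u 1 * ?n1 + ?u 2 * ?n2 + ?u 3 * ?n3) = d * ?n3
      + (?A 1 * w $ 1 + ?A 2 * w $ 2 + ?A 3 * w $ 3) * (?B 1 * ?u 2 - ?B 2 * ?u 1)
      + (?B 1 * w $ 1 + ?B 2 * w $ 2 + ?B 3 * w $ 3) * (?u 1 * ?A 2 - ?u 2 * ?A 1)"
    by (simp_all only: d_def algebra_simps)
  then have wn: "w = d *s const_field (cross a b)"
    unfolding one w' by (simp add: vec_eq_iff forall_3 const_field_def n)
  have nz: "dot u p \<noteq> 0" using pp p(1) by auto
  have "const_field p $ i = Const (dot u p) * const_field (cross a b) $ i" for i
  proof -
    have "p $ i = dot u p * cross a b $ i" by (subst pp) simp
    then show ?thesis by (simp add: const_field_def Const_mult)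
  qed
  then have "const_field (cross a b) = Const (1 / dot u p) *s const_field p"
    using nz by (simp add: vec_eq_iff mult.assoc[symmetric] Const_mult[symmetric])
  then have "w = (d * Const (1 / dot u p)) *s const_field p"
    using wn by (simp add: vector_smult_assoc)
  then show ?thesis by (rule that)
qed

section \<open>An arrangement seen from one of its points\<close>

text \<open>The polynomials \<open>v\<close> for which the values \<open>l(e) v G\<close> prescribed on the lines \<open>l\<close> of \<open>C\<close> are interpolated by
  one polynomial \<open>c\<close>.\<close>

definition slope_ideal :: "complex ^ 3 \<Rightarrow> spoly \<Rightarrow> spoly set \<Rightarrow> spoly set" where
  "slope_ideal e G C = {v. \<exists>c. \<forall>l\<in>C. l dvd c - Const (eval_poly l e) * (v * G)}"

text \<open>An arrangement of eight lines with a point \<open>[p]\<close> of multiplicity four: \<open>\<alpha>\<close>, \<open>\<beta>\<close>, \<open>\<gamma>\<close>, \<open>\<delta>\<close> are the lines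
  through it and \<open>Os\<close> contains the others, scaled to \<open>l(p) = 1\<close>. The vector \<open>e\<close> is independent of \<open>p\<close> and lies on the
  line \<open>\<beta>\<close>; together with the Euler field, \<open>e\<close> and \<open>p\<close> span all derivations generically.\<close>

locale pencil =
  fixes p e :: "complex ^ 3" and \<alpha> \<beta> \<gamma> \<delta> :: spoly and Os :: "spoly set"
  assumes dl: "distinct_lines \<alpha> \<beta>" "distinct_lines \<alpha> \<gamma>" "distinct_lines \<alpha> \<delta>"
      "distinct_lines \<beta> \<gamma>" "distinct_lines \<beta> \<delta>" "distinct_lines \<gamma> \<delta>"
    and p: "p \<noteq> 0" "eval_poly \<alpha> p = 0" "eval_poly \<beta> p = 0" "eval_poly \<gamma> p = 0" "eval_poly \<delta> p = 0"
    and e: "eval_poly \<alpha> e = 1" "eval_poly \<beta> e = 0"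
    and Os: "finite Os" "card Os = 4" "\<And>l. l \<in> Os \<Longrightarrow> homogeneous 1 l" "\<And>l. l \<in> Os \<Longrightarrow> eval_poly l p = 1"
begin

definition G :: spoly where "G = \<alpha> * \<gamma> * \<delta>"
definition B :: "spoly set" where "B = {\<alpha>, \<beta>, \<gamma>, \<delta>} \<union> Os"
definition F :: spoly where "F = \<Prod>B"
definition h :: spoly where "h = \<Prod>Os"

lemma lin: "homogeneous 1 \<alpha>" "homogeneous 1 \<beta>" "homogeneous 1 \<gamma>" "homogeneous 1 \<delta>"
  and nz: "\<alpha> \<noteq> 0" "\<beta> \<noteq> 0" "\<gamma> \<noteq> 0" "\<delta> \<noteq> 0"
  using dl unfolding distinct_lines_def by blast+

lemma Os_nz: "l \<in> Os \<Longrightarrow> l \<noteq> 0"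
  using Os(4)[of l] by auto

lemma not_in_Os: "\<alpha> \<notin> Os" "\<beta> \<notin> Os" "\<gamma> \<notin> Os" "\<delta> \<notin> Os"
  using p(2-) Os(4) by (metis zero_neq_one)+

lemma distinct_four: "\<alpha> \<noteq> \<beta>" "\<alpha> \<noteq> \<gamma>" "\<alpha> \<noteq> \<delta>" "\<beta> \<noteq> \<gamma>" "\<beta> \<noteq> \<delta>" "\<gamma> \<noteq> \<delta>"
  using dl distinct_lines_not_dvd dvd_refl by metis+

lemma B_finite: "finite B" and B_card: "card B = 8"
  using Os(1,2) not_in_Os distinct_four by (auto simp: B_def)

lemma B_lin: "l \<in> B \<Longrightarrow> homogeneous 1 l" and B_nz: "l \<in> B \<Longrightarrow> l \<noteq> 0"
  using lin nz Os(3) Os_nz by (auto simp: B_def)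

lemma Os_distinct_lines:
  assumes "l \<in> Os" "l' \<in> Os" "l \<noteq> l'"
  shows "distinct_lines l l'"
  unfolding distinct_lines_def
proof (intro conjI allI notI)
  fix c assume c: "l' = Const c * l"
  then have "eval_poly l' p = c * eval_poly l p" by simp
  then have "c = 1" using Os(4)[OF assms(1)] Os(4)[OF assms(2)] by simp
  then show False using c assms(3) by simp
qed (use assms Os Os_nz in auto)

lemma pencil_Os_distinct_lines:
  assumes "homogeneous 1 g" "g \<noteq> 0" "eval_poly g p = 0" "l \<in> Os"
  shows "distinct_lines g l"
  unfolding distinct_lines_def
proof (intro conjI allI notI)
  fix c assume c: "l = Const c * g"
  then have "eval_poly l p = 0" using assms by simp
  then show False using Os(4)[OF assms(4)] by simp
qed (use assms Os Os_nz in auto)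

lemma B_distinct_lines:
  assumes "l \<in> B" "l' \<in> B" "l \<noteq> l'"
  shows "distinct_lines l l'"
proof -
  let ?P = "{\<alpha>, \<beta>, \<gamma>, \<delta>}"
  have P: "distinct_lines l l'" if "l \<in> ?P" "l' \<in> ?P"
    using that assms(3) dl dl[THEN distinct_lines_sym] by blast
  have PO: "distinct_lines x y" if "x \<in> ?P" "y \<in> Os" for x y
    using that lin nz p by (intro pencil_Os_distinct_lines) auto
  show ?thesis
    using assms P PO[of l l'] PO[of l' l, THEN distinct_lines_sym] Os_distinct_lines unfolding B_def by blast
qed

lemma F_nz: "F \<noteq> 0" and h_nz: "h \<noteq> 0"
  using B_nz B_finite Os_nz Os(1) by (auto simp: F_def h_def)

lemma F_homogeneous: "homogeneous 8 F"
  using homogeneous_prod[OF B_finite, of "\<lambda>x. x"] B_lin B_card unfolding F_def by simp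

lemma h_homogeneous: "homogeneous 4 h"
  using homogeneous_prod[OF Os(1), of "\<lambda>x. x"] Os unfolding h_def by simp

lemma G_beta_nz: "G * \<beta> \<noteq> 0"
  using nz by (simp add: G_def)

lemma G_beta_homogeneous: "homogeneous 4 (G * \<beta>)"
  using homogeneous_mult[OF homogeneous_mult[OF homogeneous_mult[OF lin(1,3)] lin(4)] lin(2)]
  by (simp add: G_def)

lemma dvd_der:
  assumes "\<theta> \<in> AR F" "l \<in> B"
  shows "l dvd der \<theta> l"
proof (rule dvd_der_if_der_prod_zero[OF B_finite assms(2)])
  show "der \<theta> (\<Prod>B) = 0" using assms(1) by (simp add: AR_iff F_def)
  show "prime_elem l" using assms(2) by (intro linear_prime B_lin B_nz)
  show "\<not> l dvd l'" if "l' \<in> B - {l}" for l'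
    using that assms(2) by (intro distinct_lines_not_dvd B_distinct_lines) auto
qed

text \<open>The slope of a derivation measures how it moves the lines through \<open>p\<close> among each other: in coordinates
  \<open>\<alpha>, \<beta>\<close> on the pencil of these lines, \<open>\<theta>(\<alpha>) \<beta> - \<theta>(\<beta>) \<alpha>\<close> is the determinant of \<open>\<theta>\<close> against the Euler field, and
  if \<open>\<theta>\<close> preserves the four lines, then this determinant is divisible by their product \<open>G \<beta>\<close>.\<close>

definition slope :: "spoly ^ 3 \<Rightarrow> spoly \<Rightarrow> bool" where
  "slope \<theta> v \<longleftrightarrow> der \<theta> \<alpha> * \<beta> - der \<theta> \<beta> * \<alpha> = v * (G * \<beta>)"

lemma slope_unique: "slope \<theta> v \<Longrightarrow> slope \<theta> w \<Longrightarrow> v = w"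
  using G_beta_nz by (simp add: slope_def)

lemma slope_add: "slope \<theta> v \<Longrightarrow> slope \<eta> w \<Longrightarrow> slope (\<theta> + \<eta>) (v + w)"
  unfolding slope_def der_add by (simp add: algebra_simps)

lemma slope_scale: "slope \<theta> v \<Longrightarrow> slope (a *s \<theta>) (a * v)"
  unfolding slope_def der_scale by (simp only: mult.assoc right_diff_distrib[symmetric])

lemma slope_zero: "slope 0 0"
  by (simp add: slope_def)

lemma slope_diff: "slope \<theta> v \<Longrightarrow> slope \<eta> w \<Longrightarrow> slope (\<theta> - \<eta>) (v - w)"
  unfolding slope_def der_diff by (simp add: algebra_simps)

lemma slope_sum: "(\<And>i. i \<in> X \<Longrightarrow> slope (g i) (v i)) \<Longrightarrow> slope (\<Sum>i\<in>X. a i *s g i) (\<Sum>i\<in>X. a i * v i)"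
  by (induction X rule: infinite_finite_induct) (auto intro: slope_add slope_scale slope_zero)

text \<open>Each of the four lines is a combination \<open>s \<alpha> + t \<beta>\<close>, so \<open>\<alpha>\<close> or \<open>\<beta>\<close> can be eliminated in favour of
  \<open>l\<close>.\<close>

lemma pencil_dvd:
  assumes "\<theta> \<in> AR F" "l \<in> {\<alpha>, \<beta>, \<gamma>, \<delta>}"
  shows "l dvd der \<theta> \<alpha> * \<beta> - der \<theta> \<beta> * \<alpha>"
proof -
  have l: "l dvd der \<theta> l" "homogeneous 1 l" using dvd_der[OF assms(1)] assms(2) lin by (auto simp: B_def)
  have "eval_poly l p = 0" using assms(2) p by auto
  then have "in_span \<alpha> \<beta> l" using in_span_if_common_zero[OF dl(1) p(1-3) l(2)] by simp
  then obtain s t where st: "l = Const s * \<alpha> + Const t * \<beta>" by (auto simp: in_span_def)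
  have dlst: "der \<theta> l = Const s * der \<theta> \<alpha> + Const t * der \<theta> \<beta>"
    unfolding st by (simp add: der_def sum_3 pdiff_add pdiff_mult algebra_simps)
  have "l \<noteq> 0" using assms(2) nz by auto
  then consider "s \<noteq> 0" | "t \<noteq> 0" using st by fastforce
  then show ?thesis
  proof cases
    case 1
    have "Const s * (der \<theta> \<alpha> * \<beta> - der \<theta> \<beta> * \<alpha>) = der \<theta> l * \<beta> - der \<theta> \<beta> * l"
      unfolding dlst by (simp add: st algebra_simps)
    then have "l dvd Const s * (der \<theta> \<alpha> * \<beta> - der \<theta> \<beta> * \<alpha>)" using l(1) by simp
    then have "l dvd Const (1 / s) * (Const s * (der \<theta> \<alpha> * \<beta> - der \<theta> \<beta> * \<alpha>))" by (rule dvd_mult)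
    then show ?thesis using 1 by (simp add: mult.assoc[symmetric] Const_mult[symmetric])
  next
    case 2
    have "Const t * (der \<theta> \<alpha> * \<beta> - der \<theta> \<beta> * \<alpha>) = der \<theta> \<alpha> * l - der \<theta> l * \<alpha>"
      unfolding dlst by (simp add: st algebra_simps)
    then have "l dvd Const t * (der \<theta> \<alpha> * \<beta> - der \<theta> \<beta> * \<alpha>)" using l(1) by simp
    then have "l dvd Const (1 / t) * (Const t * (der \<theta> \<alpha> * \<beta> - der \<theta> \<beta> * \<alpha>))" by (rule dvd_mult)
    then show ?thesis using 2 by (simp add: mult.assoc[symmetric] Const_mult[symmetric])
  qed
qed

lemma slope_exists:
  assumes "\<theta> \<in> AR F"
  obtains v where "slope \<theta> v"
proof -
  have "(\<Prod>l\<in>{\<alpha>, \<beta>, \<gamma>, \<delta>}. l) dvd der \<theta> \<alpha> * \<beta> - der \<theta> \<beta> * \<alpha>"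
    using B_distinct_lines lin nz
    by (intro prod_dvd_of_distinct_lines pencil_dvd[OF assms]) (auto simp: B_def)
  also have "(\<Prod>l\<in>{\<alpha>, \<beta>, \<gamma>, \<delta>}. l) = G * \<beta>"
    using distinct_four by (simp add: G_def mult_ac)
  finally obtain v where "der \<theta> \<alpha> * \<beta> - der \<theta> \<beta> * \<alpha> = (G * \<beta>) * v" by (rule dvdE)
  then have "slope \<theta> v" unfolding slope_def by (simp only: mult.commute[of v])
  then show ?thesis by (rule that)
qed

text \<open>The derivations preserving the four lines through \<open>p\<close> form a free module with basis the Euler field,
  \<open>G e\<close> and \<open>p\<close>; the second coordinate is the slope. The field \<open>G e\<close> preserves \<open>\<beta>\<close> because \<open>\<beta>(e) = 0\<close> and the
  other three lines because they divide \<open>G\<close>.\<close>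

lemma decomposition:
  assumes "slope \<theta> v"
  obtains u c where "\<theta> = u *s euler + (v * G) *s const_field e - c *s const_field p"
proof -
  let ?\<theta> = "\<theta> - (v * G) *s const_field e"
  have a: "der ?\<theta> \<alpha> = der \<theta> \<alpha> - v * G" and b: "der ?\<theta> \<beta> = der \<theta> \<beta>"
    by (simp_all add: der_diff der_scale der_const_field lin e)
  have eq: "der ?\<theta> \<alpha> * \<beta> = der ?\<theta> \<beta> * \<alpha>"
    using assms unfolding a b slope_def by (simp add: algebra_simps)
  then have "\<alpha> dvd der ?\<theta> \<alpha> * \<beta>" by simp
  then have "\<alpha> dvd der ?\<theta> \<alpha>"
    using distinct_lines_not_dvd[OF dl(1)] prime_elem_dvd_multD[OF linear_prime[OF lin(1) nz(1)]] by blast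
  then obtain u where u: "der ?\<theta> \<alpha> = \<alpha> * u" by (rule dvdE)
  then have "\<alpha> * (u * \<beta>) = \<alpha> * der ?\<theta> \<beta>" using eq by (simp add: mult_ac)
  then have u': "der ?\<theta> \<beta> = u * \<beta>" using nz(1) by simp
  have "der (?\<theta> - u *s euler) \<alpha> = 0" "der (?\<theta> - u *s euler) \<beta> = 0"
    unfolding der_diff[of ?\<theta>] der_scale u u' by (simp_all add: der_euler_linear lin)
  then obtain c where "?\<theta> - u *s euler = c *s const_field p"
    using const_field_multiple[OF dl(1) p(1-3)] by blast
  then have "\<theta> = u *s euler + (v * G) *s const_field e - (- c) *s const_field p"
    by (simp add: algebra_simps vec_eq_iff)
  then show ?thesis by (rule that)
qed

lemma slope_of_decomposition:
  "slope (u *s euler + (v * G) *s const_field e - c *s const_field p) v"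
  by (simp add: slope_def der_add der_diff der_scale der_euler_linear der_const_field lin e p algebra_simps)

lemma der_decomposition:
  assumes "l \<in> Os"
  shows "der (u *s euler + (v * G) *s const_field e - c *s const_field p) l
    = u * l - (c - Const (eval_poly l e) * (v * G))"
  using Os(3,4)[OF assms]
  by (simp add: der_add der_diff der_scale der_euler_linear der_const_field algebra_simps)

text \<open>A derivation \<open>u E + v G e - c p\<close> preserves a line \<open>l\<close> off \<open>p\<close> iff \<open>l\<close> divides \<open>c - l(e) v G\<close>. Hence the slopes
  of Jacobian relations lie in the interpolation ideal; that they fill it is the content of the next two
  lemmas.\<close>

lemma slope_of_relation_in_slope_ideal:
  assumes "\<theta> \<in> AR F" "slope \<theta> v"
  shows "v \<in> slope_ideal e G Os"
proof -
  obtain u c where d: "\<theta> = u *s euler + (v * G) *s const_field e - c *s const_field p"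
    using decomposition[OF assms(2)] .
  have "l dvd c - Const (eval_poly l e) * (v * G)" if l: "l \<in> Os" for l
  proof -
    have "l dvd der \<theta> l" using dvd_der[OF assms(1)] l by (auto simp: B_def)
    then have "l dvd u * l - der \<theta> l" by simp
    then show ?thesis unfolding d der_decomposition[OF l] by simp
  qed
  then show ?thesis by (auto simp: slope_ideal_def)
qed

text \<open>A derivation \<open>\<theta>\<close> preserving all lines has \<open>\<theta>(F) = w F\<close>; as the Euler field multiplies \<open>F\<close> by 8, subtracting \<open>w/8\<close>
  times it makes \<open>\<theta>\<close> a Jacobian relation without changing its slope.\<close>

lemma relation_exists:
  assumes "\<And>l. l \<in> Os \<Longrightarrow> l dvd c - Const (eval_poly l e) * (v * G)"
  obtains u where "u *s euler + (v * G) *s const_field e - c *s const_field p \<in> AR F"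
proof -
  let ?\<theta> = "(v * G) *s const_field e - c *s const_field p"
  have "l dvd der ?\<theta> l" if l: "l \<in> B" for l
  proof -
    consider "l \<in> {\<alpha>, \<gamma>, \<delta>}" | "l = \<beta>" | "l \<in> Os" using l unfolding B_def by blast
    then show ?thesis
    proof cases
      case 1
      then have "l dvd G" by (auto simp: G_def)
      then show ?thesis using 1 lin p by (auto simp: der_diff der_scale der_const_field)
    next
      case 2
      then show ?thesis using lin p e by (simp add: der_diff der_scale der_const_field)
    next
      case 3
      have "der ?\<theta> l = Const (eval_poly l e) * (v * G) - c" using der_decomposition[OF 3, of 0 v c] by simp
      also have "\<dots> = - (c - Const (eval_poly l e) * (v * G))" by simp
      finally show ?thesis using assms[OF 3] by (simp only: dvd_minus_iff)
    qed
  qed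
  then have "F dvd der ?\<theta> F" unfolding F_def using B_finite by (intro prod_dvd_der_prod) auto
  then obtain w where w: "der ?\<theta> F = F * w" by (rule dvdE)
  have X: "der euler F = Const 8 * F"
    using der_euler_prod[OF B_finite B_lin] Const_of_nat[of 8] by (simp add: F_def B_card)
  have "der ((- (Const (1/8) * w)) *s euler + ?\<theta>) F = - (Const (1/8) * w) * (Const 8 * F) + F * w"
    unfolding der_add der_scale w X by simp
  also have "\<dots> = (1 - Const (1/8) * Const 8) * (F * w)" by (simp add: algebra_simps)
  also have "\<dots> = 0" by (simp add: Const_mult[symmetric])
  finally have "(- (Const (1/8) * w)) *s euler + ?\<theta> \<in> AR F" by (simp add: AR_iff)
  then show ?thesis by (intro that) (simp only: add_diff_eq)
qed

lemma homogeneous_lift: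
  assumes "v \<in> slope_ideal e G Os" "homogeneous d v"
  obtains \<theta> where "\<theta> \<in> AR F" "slope \<theta> v" "homogeneous3 (d + 3) \<theta>"
proof -
  obtain c where "\<And>l. l \<in> Os \<Longrightarrow> l dvd c - Const (eval_poly l e) * (v * G)"
    using assms(1) by (auto simp: slope_ideal_def)
  then obtain u where AR: "u *s euler + (v * G) *s const_field e - c *s const_field p \<in> AR F" (is "?\<theta> \<in> _")
    using relation_exists by blast
  have "slope ?\<theta> v" by (rule slope_of_decomposition)
  then have "component (d + 4) (\<beta> * der ?\<theta> \<alpha> - \<alpha> * der ?\<theta> \<beta>) = component (d + 4) (v * (G * \<beta>))"
    by (simp add: slope_def mult.commute)
  also have "\<dots> = v * (G * \<beta>)"
    using homogeneous_mult[OF assms(2) G_beta_homogeneous] by (simp add: component_homogeneous)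
  finally have hc: "component (d + 4) (\<beta> * der ?\<theta> \<alpha> - \<alpha> * der ?\<theta> \<beta>) = v * (G * \<beta>)" .
  have ab: "der (component3 (d + 3) ?\<theta>) \<alpha> = component (d + 3) (der ?\<theta> \<alpha>)"
    "der (component3 (d + 3) ?\<theta>) \<beta> = component (d + 3) (der ?\<theta> \<beta>)"
    using der_component3[OF lin(1)[unfolded One_nat_def], of "d + 3" ?\<theta>]
      der_component3[OF lin(2)[unfolded One_nat_def], of "d + 3" ?\<theta>] by simp_all
  have sub: "d + 4 - 1 = d + 3" "1 \<le> d + 4" by simp_all
  have "component (d + 4) (\<beta> * x) = \<beta> * component (d + 3) x" "component (d + 4) (\<alpha> * x) = \<alpha> * component (d + 3) x" for x
    using component_mult_homogeneous[OF lin(2), of "d + 4" x] component_mult_homogeneous[OF lin(1), of "d + 4" x]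
    unfolding sub(1) if_P[OF sub(2)] by blast+
  then have "slope (component3 (d + 3) ?\<theta>) v"
    using hc unfolding slope_def ab component_diff by (simp only: mult.commute[of \<beta>] mult.commute[of \<alpha>])
  moreover have "component3 (d + 3) ?\<theta> \<in> AR F"
    by (rule component3_AR[OF _ AR, of 7]) (use F_homogeneous in simp)
  ultimately show ?thesis using that by simp
qed

text \<open>The relations of slope 0 are the multiples of one relation \<open>\<psi>\<close> of degree 4, the field \<open>h p\<close> corrected
  by the Euler field: in \<open>u E - c p\<close> the coefficient \<open>c\<close> must be divisible by every line in \<open>Os\<close>. So the module of
  Jacobian relations is an extension of the slope ideal, shifted by 3, by \<open>S(-4)\<close>.\<close>

lemma vertical_relation:
  obtains \<psi> where "\<psi> \<in> AR F" "slope \<psi> 0" "homogeneous3 4 \<psi>" "\<psi> \<noteq> 0"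
    "\<And>\<theta>. \<theta> \<in> AR F \<Longrightarrow> slope \<theta> 0 \<Longrightarrow> \<exists>t. \<theta> = t *s \<psi>"
proof -
  have "\<And>l. l \<in> Os \<Longrightarrow> l dvd h - Const (eval_poly l e) * (0 * G)"
    using Os(1) unfolding h_def by (auto intro: dvd_prodI[of _ _ "\<lambda>x. x"])
  then obtain u where "u *s euler + (0 * G) *s const_field e - h *s const_field p \<in> AR F"
    using relation_exists by blast
  then have "u *s euler - h *s const_field p \<in> AR F" by simp
  (* The component of degree 4 leaves h p alone and makes the Euler coefficient homogeneous. *)
  then have "component3 4 (u *s euler - h *s const_field p) \<in> AR F"
    by (intro component3_AR[of 7]) (use F_homogeneous in simp_all)
  moreover have "component3 4 (u *s euler - h *s const_field p) = component 3 u *s euler - h *s const_field p"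
  proof -
    have "component 4 (u * Var i - h * Const (p $ i)) = component 3 u * Var i - h * Const (p $ i)" for i
      using component_mult_homogeneous[OF homogeneous_Var, of 4 i u]
        homogeneous_mult[OF h_homogeneous homogeneous_Const[of "p $ i"]]
      by (simp add: component_diff component_homogeneous mult.commute)
    then show ?thesis by (simp add: component3_def euler_def const_field_def vec_eq_iff)
  qed
  moreover define u0 where "u0 = component 3 u"
  ultimately have u0: "component3 4 (u *s euler - h *s const_field p) = u0 *s euler - h *s const_field p"
    and AR: "u0 *s euler - h *s const_field p \<in> AR F" (is "?\<psi> \<in> _") by simp_all
  have hom: "homogeneous3 4 ?\<psi>" using homogeneous3_component3 unfolding u0[symmetric] .
  have sl: "slope ?\<psi> 0" using slope_of_decomposition[of u0 0 h] by simp
  have ne: "?\<psi> \<noteq> 0"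
  proof
    assume z: "?\<psi> = 0"
    have "der ?\<psi> \<alpha> = u0 * \<alpha>" by (simp add: der_diff der_scale der_euler_linear der_const_field lin p)
    then have "u0 = 0" using z nz by simp
    obtain l where l: "l \<in> Os" using Os(2) by fastforce
    have "der ?\<psi> l = u0 * l - h" using der_decomposition[OF l, of u0 0 h] by simp
    then show False using z \<open>u0 = 0\<close> h_nz by simp
  qed
  have "\<exists>t. \<theta> = t *s ?\<psi>" if \<theta>: "\<theta> \<in> AR F" "slope \<theta> 0" for \<theta>
  proof -
    obtain u c where d: "\<theta> = u *s euler + (0 * G) *s const_field e - c *s const_field p"
      using decomposition[OF \<theta>(2)] .
    have "l dvd c" if l: "l \<in> Os" for l
    proof -
      have "l dvd der \<theta> l" using dvd_der[OF \<theta>(1)] l by (auto simp: B_def)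
      then have "l dvd u * l - der \<theta> l" by simp
      then show ?thesis unfolding d der_decomposition[OF l] by simp
    qed
    then have "h dvd c" unfolding h_def
      using Os Os_nz Os_distinct_lines by (intro prod_dvd_of_distinct_lines) auto
    then obtain t where t: "c = h * t" by (rule dvdE)
    have eq: "\<theta> - t *s ?\<psi> = (u - t * u0) *s euler"
      unfolding d t by (simp add: vec_eq_iff algebra_simps)
    have "\<theta> - t *s ?\<psi> \<in> AR F"
      using \<theta>(1) AR AR_subspace S3.subspace_diff S3.subspace_scale by blast
    then have "(u - t * u0) * der euler F = 0" unfolding eq AR_iff der_scale .
    moreover have "der euler F \<noteq> 0"
      using der_euler_prod[OF B_finite B_lin] F_nz by (simp add: F_def B_card)
    ultimately have "u - t * u0 = 0" by simp
    then have "\<theta> - t *s ?\<psi> = 0" unfolding eq by simp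
    then show ?thesis by (intro exI[of _ t]) simp
  qed
  then show ?thesis using that AR hom sl ne by blast
qed

end

section \<open>From generators of the slope ideal to exponents\<close>

fun ideal_gen :: "spoly list \<Rightarrow> spoly set" where
  "ideal_gen [] = {0}"
| "ideal_gen (g # gs) = {x * g + y | x y. y \<in> ideal_gen gs}"

lemma ideal_gen_iff: "v \<in> ideal_gen gs \<longleftrightarrow> (\<exists>a. v = (\<Sum>i<length gs. a i * gs ! i))"
proof (induction gs arbitrary: v)
  case (Cons g gs)
  show ?case
  proof
    assume "v \<in> ideal_gen (g # gs)"
    then obtain x a where "v = x * g + (\<Sum>i<length gs. a i * gs ! i)" using Cons by auto
    then have "v = (\<Sum>i<length (g # gs). (case i of 0 \<Rightarrow> x | Suc j \<Rightarrow> a j) * (g # gs) ! i)"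
      by (simp add: sum.lessThan_Suc_shift del: sum.lessThan_Suc)
    then show "\<exists>a. v = (\<Sum>i<length (g # gs). a i * (g # gs) ! i)"
      by (rule exI[where x = "\<lambda>i. case i of 0 \<Rightarrow> x | Suc j \<Rightarrow> a j"])
  next
    assume "\<exists>a. v = (\<Sum>i<length (g # gs). a i * (g # gs) ! i)"
    then obtain a where "v = (\<Sum>i<length (g # gs). a i * (g # gs) ! i)" ..
    then have v: "v = a 0 * g + (\<Sum>i<length gs. a (Suc i) * gs ! i)"
      by (simp add: sum.lessThan_Suc_shift del: sum.lessThan_Suc)
    have "(\<Sum>i<length gs. a (Suc i) * gs ! i) \<in> ideal_gen gs"
      unfolding Cons by (rule exI[of _ "\<lambda>i. a (Suc i)"]) (rule refl)
    then show "v \<in> ideal_gen (g # gs)" unfolding v by auto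
  qed
qed simp

text \<open>A certificate for minimality: every generator is non-zero at some common zero of the others. It excludes at
  once that one generator is a combination of the others, and it is checked by plane geometry.\<close>

definition witnessed :: "spoly list \<Rightarrow> bool" where
  "witnessed vs \<longleftrightarrow> (\<forall>i<length vs. \<exists>x. eval_poly (vs ! i) x \<noteq> 0 \<and>
     (\<forall>j<length vs. j \<noteq> i \<longrightarrow> eval_poly (vs ! j) x = 0))"

context pencil
begin

lemma slope_value_in_span:
  assumes "\<theta> \<in> S3.span S" "\<And>\<eta>. \<eta> \<in> S \<Longrightarrow> \<exists>w. slope \<eta> w \<and> eval_poly w x = 0"
  shows "\<exists>w. slope \<theta> w \<and> eval_poly w x = 0"
  using assms(1)
proof (induction rule: S3.span_induct_alt)
  case base
  show ?case using slope_zero by (intro exI[of _ 0]) simp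
next
  case (step a \<eta> \<theta>')
  obtain w w' where w: "slope \<eta> w" "eval_poly w x = 0" "slope \<theta>' w'" "eval_poly w' x = 0"
    using step assms(2) by blast
  then have "slope (a *s \<eta> + \<theta>') (a * w + w')" by (intro slope_add slope_scale)
  then show ?case using w by (intro exI[of _ "a * w + w'"]) simp
qed

text \<open>Lifts of generators of the slope ideal generate the Jacobian relations together with \<open>\<psi>\<close>, and no lift is
  redundant: its slope would vanish at its witness.\<close>

lemma relations_from_generators:
  assumes I: "slope_ideal e G Os = ideal_gen vs" and hom: "list_all2 homogeneous ds vs"
    and wit: "witnessed vs"
  obtains \<psi> \<theta>s where "length \<theta>s = length vs" "\<And>i. i < length vs \<Longrightarrow> slope (\<theta>s ! i) (vs ! i)"
    "list_all2 homogeneous3 (map (\<lambda>d. d + 3) ds) \<theta>s" "slope \<psi> 0" "homogeneous3 4 \<psi>" "\<psi> \<noteq> 0"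
    "distinct (\<psi> # \<theta>s)" "S3.span (set (\<psi> # \<theta>s)) = AR F"
    "\<And>\<theta>. \<theta> \<in> set \<theta>s \<Longrightarrow> \<theta> \<notin> S3.span (set (\<psi> # \<theta>s) - {\<theta>})"
proof -
  have "vs ! i \<in> slope_ideal e G Os" if "i < length vs" for i
    unfolding I ideal_gen_iff
    using that by (intro exI[of _ "\<lambda>j. if j = i then 1 else 0"]) (simp add: if_distrib[of "\<lambda>a. a * _"] cong:
      if_cong)
  then have "\<exists>\<theta>. \<theta> \<in> AR F \<and> slope \<theta> (vs ! i) \<and> homogeneous3 (ds ! i + 3) \<theta>" if "i < length vs" for i
    using homogeneous_lift[of "vs ! i" "ds ! i"] hom that by (metis list_all2_conv_all_nth)
  then obtain t where t: "\<And>i. i < length vs \<Longrightarrow> t i \<in> AR F \<and> slope (t i) (vs ! i) \<and> homogeneous3 (ds ! i + 3) (t i)"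
    by metis
  obtain \<psi> where \<psi>: "\<psi> \<in> AR F" "slope \<psi> 0" "homogeneous3 4 \<psi>" "\<psi> \<noteq> 0"
    "\<And>\<theta>. \<theta> \<in> AR F \<Longrightarrow> slope \<theta> 0 \<Longrightarrow> \<exists>t. \<theta> = t *s \<psi>" by (rule vertical_relation) (rule that, assumption+)
  define \<theta>s where "\<theta>s = map t [0..<length vs]"
  have len: "length \<theta>s = length vs" "length ds = length vs"
    using hom by (auto simp: \<theta>s_def dest: list_all2_lengthD)
  have nth: "\<theta>s ! i = t i" if "i < length vs" for i using that by (simp add: \<theta>s_def)
  have wi: "\<exists>x. eval_poly (vs ! i) x \<noteq> 0 \<and> (\<forall>j<length vs. j \<noteq> i \<longrightarrow> eval_poly (vs ! j) x = 0)"
    if "i < length vs" for i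
    using wit that unfolding witnessed_def by blast
  have inj: "i = j" if "i < length vs" "j < length vs" "t i = t j" for i j
    using t[OF that(1)] t[OF that(2)] wi[OF that(1)] that slope_unique by metis
  have ne: "t i \<noteq> \<psi>" if "i < length vs" for i
  proof
    assume "t i = \<psi>"
    then have "vs ! i = 0" using t[OF that] \<psi>(2) slope_unique by metis
    then show False using wi[OF that] by auto
  qed
  have "\<psi> \<notin> set \<theta>s"
  proof
    assume "\<psi> \<in> set \<theta>s"
    then obtain i where "i < length vs" "\<psi> = t i" by (auto simp: \<theta>s_def)
    then show False using ne[of i] by simp
  qed
  then have dist: "distinct (\<psi> # \<theta>s)"
    using inj by (auto simp: \<theta>s_def distinct_map inj_on_def)
  have "S3.span (set (\<psi> # \<theta>s)) = AR F"
  proof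
    show "S3.span (set (\<psi> # \<theta>s)) \<subseteq> AR F"
      using t \<psi>(1) by (intro S3.span_minimal AR_subspace) (auto simp: \<theta>s_def)
    show "AR F \<subseteq> S3.span (set (\<psi> # \<theta>s))"
    proof
      fix \<theta> assume \<theta>: "\<theta> \<in> AR F"
      obtain v where v: "slope \<theta> v" using slope_exists[OF \<theta>] .
      obtain a where a: "v = (\<Sum>i<length vs. a i * vs ! i)"
        using slope_of_relation_in_slope_ideal[OF \<theta> v] unfolding I ideal_gen_iff ..
      let ?\<eta> = "\<Sum>i<length vs. a i *s t i"
      have "slope ?\<eta> v" unfolding a using t by (intro slope_sum) auto
      then have "slope (\<theta> - ?\<eta>) 0" using slope_diff[OF v] by fastforce
      moreover have "?\<eta> \<in> AR F"
        using t by (intro S3.subspace_sum[OF AR_subspace] S3.subspace_scale[OF AR_subspace]) auto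
      then have "\<theta> - ?\<eta> \<in> AR F" using \<theta> S3.subspace_diff[OF AR_subspace] by blast
      ultimately obtain s where s: "\<theta> - ?\<eta> = s *s \<psi>" using \<psi>(5) by blast
      have "?\<eta> \<in> S3.span (set (\<psi> # \<theta>s))" by (rule span_indexed_sum) (auto simp: \<theta>s_def)
      moreover have "s *s \<psi> \<in> S3.span (set (\<psi> # \<theta>s))" by (intro S3.span_scale S3.span_base) simp
      ultimately have "s *s \<psi> + ?\<eta> \<in> S3.span (set (\<psi> # \<theta>s))" by (rule S3.span_add[rotated])
      then show "\<theta> \<in> S3.span (set (\<psi> # \<theta>s))" unfolding s[symmetric] by simp
    qed
  qed
  moreover have "\<theta> \<notin> S3.span (set (\<psi> # \<theta>s) - {\<theta>})" if th: "\<theta> \<in> set \<theta>s" for \<theta>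
  proof
    assume sp: "\<theta> \<in> S3.span (set (\<psi> # \<theta>s) - {\<theta>})"
    obtain i where i: "i < length vs" "\<theta> = t i" using th by (auto simp: \<theta>s_def)
    obtain x where x: "eval_poly (vs ! i) x \<noteq> 0" "\<And>j. j < length vs \<Longrightarrow> j \<noteq> i \<Longrightarrow> eval_poly (vs ! j) x = 0"
      using wi[OF i(1)] by blast
    have "\<exists>w. slope \<eta> w \<and> eval_poly w x = 0" if \<eta>: "\<eta> \<in> set (\<psi> # \<theta>s) - {\<theta>}" for \<eta>
    proof (cases "\<eta> = \<psi>")
      case True
      then show ?thesis using \<psi>(2) by (intro exI[of _ 0]) simp
    next
      case False
      then obtain j where j: "j < length vs" "\<eta> = t j" using \<eta> by (auto simp: \<theta>s_def)
      moreover have "j \<noteq> i" using j(2) \<eta> i(2) by blast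
      ultimately show ?thesis using t x(2) by blast
    qed
    then obtain w where "slope \<theta> w" "eval_poly w x = 0" using slope_value_in_span[OF sp] by blast
    then show False using t[OF i(1)] i(2) x(1) slope_unique by metis
  qed
  moreover have "list_all2 homogeneous3 (map (\<lambda>d. d + 3) ds) \<theta>s"
    using t len nth by (simp add: list_all2_conv_all_nth)
  ultimately show ?thesis using that[of \<theta>s \<psi>] len(1) nth t \<psi>(2-4) dist by simp
qed

text \<open>If the slope ideal has no generator of degree 0, then \<open>\<psi>\<close> is not redundant either: it could only be a
  combination with constant coefficients of lifts of degree 4; these constants give a relation between the
  linear generators of the slope ideal, and each of them vanishes by evaluation at the witness.\<close>

theorem exponents_of_proper_slope_ideal:
  assumes I: "slope_ideal e G Os = ideal_gen vs" and hom: "list_all2 homogeneous ds vs"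
    and wit: "witnessed vs" and ds: "sorted ds" "0 \<notin> set ds"
  shows "exponents F = 4 # map (\<lambda>d. d + 3) ds" and "mdr F = 4"
proof -
  obtain \<psi> \<theta>s where len: "length \<theta>s = length vs" and sl: "\<And>i. i < length vs \<Longrightarrow> slope (\<theta>s ! i) (vs ! i)"
    and hom3: "list_all2 homogeneous3 (map (\<lambda>d. d + 3) ds) \<theta>s" and \<psi>: "slope \<psi> 0" "homogeneous3 4 \<psi>" "\<psi> \<noteq> 0"
    and dist: "distinct (\<psi> # \<theta>s)" and span: "S3.span (set (\<psi> # \<theta>s)) = AR F"
    and min: "\<And>\<theta>. \<theta> \<in> set \<theta>s \<Longrightarrow> \<theta> \<notin> S3.span (set (\<psi> # \<theta>s) - {\<theta>})"
    by (rule relations_from_generators[OF I hom wit]) (rule that, assumption+)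
  have lds: "length ds = length vs" using hom by (auto dest: list_all2_lengthD)
  have "\<psi> \<notin> S3.span (set (\<psi> # \<theta>s) - {\<psi>})"
  proof
    assume "\<psi> \<in> S3.span (set (\<psi> # \<theta>s) - {\<psi>})"
    moreover have "set (\<psi> # \<theta>s) - {\<psi>} = set \<theta>s" using dist by auto
    ultimately have "\<psi> \<in> S3.span (set \<theta>s)" by simp
    from homogeneous_in_span[OF hom3 \<psi>(2) this]
    obtain a where a: "\<psi> = (\<Sum>i<length vs. a i *s \<theta>s ! i)"
      and a2: "\<forall>i<length vs. if map (\<lambda>d. d + 3) ds ! i \<le> 4
        then homogeneous (4 - map (\<lambda>d. d + 3) ds ! i) (a i) else a i = 0"
      unfolding len by blast
    have "map (\<lambda>d. d + 3) ds ! i = ds ! i + 3" if "i < length vs" for i using that lds by simp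
    then have ah: "\<forall>i<length vs. if ds ! i + 3 \<le> 4 then homogeneous (4 - (ds ! i + 3)) (a i) else a i = 0"
      using a2 by metis
    have aC: "a i = Const (Poly_Mapping.lookup (a i) 0)" if i: "i < length vs" for i
    proof (cases "ds ! i + 3 \<le> 4")
      case True
      have "ds ! i \<noteq> 0" using ds(2) i lds nth_mem by metis
      then have "4 - (ds ! i + 3) = 0" using True by simp
      then show ?thesis using ah i True homogeneous_0_Const[of "a i"] by metis
    next
      case False
      then show ?thesis using ah i by auto
    qed
    have "slope \<psi> (\<Sum>i<length vs. a i * vs ! i)" unfolding a using sl by (intro slope_sum) auto
    then have z: "(\<Sum>i<length vs. a i * vs ! i) = 0" using \<psi>(1) slope_unique by blast
    have "a k = 0" if k: "k < length vs" for k
    proof -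
      obtain x where x: "eval_poly (vs ! k) x \<noteq> 0" "\<forall>j<length vs. j \<noteq> k \<longrightarrow> eval_poly (vs ! j) x = 0"
        using wit k unfolding witnessed_def by blast
      have "0 = (\<Sum>i<length vs. eval_poly (a i) x * eval_poly (vs ! i) x)"
        using arg_cong[OF z, of "\<lambda>q. eval_poly q x"] by simp
      also have "\<dots> = (\<Sum>i<length vs. if i = k then eval_poly (a k) x * eval_poly (vs ! k) x else 0)"
        using x(2) by (intro sum.cong) auto
      also have "\<dots> = eval_poly (a k) x * eval_poly (vs ! k) x" using k by simp
      finally have "eval_poly (a k) x = 0" using x(1) by simp
      then show ?thesis using aC[OF k] by (metis Const_0 eval_Const)
    qed
    then have "\<psi> = 0" unfolding a by (intro sum.neutral) auto
    then show False using \<psi>(3) by simp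
  qed
  then have mg: "minimal_generating_set (AR F) (set (\<psi> # \<theta>s))"
    using span min by (intro minimal_generating_setI) auto
  moreover have hom3': "list_all2 homogeneous3 (4 # map (\<lambda>d. d + 3) ds) (\<psi> # \<theta>s)" using hom3 \<psi>(2) by simp
  moreover have srt: "sorted (4 # map (\<lambda>d. d + 3) ds)"
  proof -
    have "4 \<le> d + 3" if "d \<in> set ds" for d using ds(2) that by (cases d) auto
    moreover have "sorted (map (\<lambda>d. d + 3) ds)" using ds(1) by (simp add: sorted_map)
    ultimately show ?thesis by auto
  qed
  ultimately show "exponents F = 4 # map (\<lambda>d. d + 3) ds" using dist by (intro exponents_eqI)
  show "mdr F = 4" using mdr_eqI[OF mg hom3' srt] by simp
qed

text \<open>If the slope ideal is the unit ideal, a lift of 1 has degree 3 and forms a basis together with \<open>\<psi>\<close>: the slope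
  of a relation \<open>a \<theta> + b \<psi>\<close> is \<open>a\<close>.\<close>

theorem exponents_of_unit_slope_ideal:
  assumes I: "slope_ideal e G Os = UNIV"
  shows "exponents F = [3, 4]" and "\<exists>X. S3.independent X \<and> S3.span X = AR F"
proof -
  have I': "slope_ideal e G Os = ideal_gen [1]" unfolding I by auto
  have hom: "list_all2 homogeneous [0] [1]" by simp
  have wit: "witnessed [1]" by (simp add: witnessed_def)
  obtain \<psi> \<theta>s where len: "length \<theta>s = length [1 :: spoly]"
    and sl: "\<And>i. i < length [1 :: spoly] \<Longrightarrow> slope (\<theta>s ! i) ([1] ! i)"
    and hom3: "list_all2 homogeneous3 (map (\<lambda>d. d + 3) [0]) \<theta>s" and \<psi>: "slope \<psi> 0" "homogeneous3 4 \<psi>" "\<psi> \<noteq> 0"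
    and dist: "distinct (\<psi> # \<theta>s)" and span: "S3.span (set (\<psi> # \<theta>s)) = AR F"
    and min: "\<And>\<theta>. \<theta> \<in> set \<theta>s \<Longrightarrow> \<theta> \<notin> S3.span (set (\<psi> # \<theta>s) - {\<theta>})"
    by (rule relations_from_generators[OF I' hom wit]) (rule that, assumption+)
  obtain \<theta> where \<theta>s: "\<theta>s = [\<theta>]" using len by (cases \<theta>s) auto
  have \<theta>: "slope \<theta> 1" "homogeneous3 3 \<theta>" "\<theta> \<noteq> \<psi>" using sl[of 0] hom3 dist by (auto simp: \<theta>s)
  have indep: "a = 0 \<and> b = 0" if "a *s \<theta> + b *s \<psi> = 0" for a b
  proof -
    have "slope (a *s \<theta> + b *s \<psi>) (a * 1 + b * 0)" using \<theta> \<psi> by (intro slope_add slope_scale)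
    then have a: "a = 0" unfolding that using slope_unique[OF _ slope_zero] by simp
    then have "b *s \<psi> = 0" using that by simp
    then show ?thesis using a \<psi>(3) by (auto simp: vec_eq_iff)
  qed
  have "\<psi> \<notin> S3.span {\<theta>}"
  proof
    assume "\<psi> \<in> S3.span {\<theta>}"
    then obtain k where "\<psi> = k *s \<theta>" using S3.span_singleton by auto
    then have "(- k) *s \<theta> + 1 *s \<psi> = 0" by simp
    then show False using indep by fastforce
  qed
  moreover have "{\<theta>, \<psi>} - {\<psi>} = {\<theta>}" using \<theta> by auto
  ultimately have "minimal_generating_set (AR F) (set [\<theta>, \<psi>])"
    using span min \<theta>(3) by (intro minimal_generating_setI) (auto simp: \<theta>s insert_commute)
  then show "exponents F = [3, 4]"
    using \<theta> \<psi> by (intro exponents_eqI[of "[\<theta>, \<psi>]"]) auto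
  have "\<not> S3.dependent {\<theta>, \<psi>}"
    unfolding S3.dependent_finite[of "{\<theta>, \<psi>}", simplified]
    using indep \<theta>(3) by auto
  then show "\<exists>X. S3.independent X \<and> S3.span X = AR F"
    using span by (intro exI[of _ "{\<theta>, \<psi>}"]) (simp add: \<theta>s insert_commute)
qed

section \<open>The slope ideal of a pencil and of a transversal line\<close>

text \<open>The intersection point of \<open>l\<close> and \<open>l'\<close> lies on none of the four lines through \<open>p\<close>.\<close>

definition off :: "spoly \<Rightarrow> spoly \<Rightarrow> bool" where
  "off l l' \<longleftrightarrow> (\<forall>g\<in>{\<alpha>, \<beta>, \<gamma>, \<delta>}. \<not> in_span l l' g)"

abbreviation slopes :: "spoly set \<Rightarrow> spoly set" where
  "slopes C \<equiv> slope_ideal e G C"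

lemma pencil_member:
  assumes l: "l1 \<in> Os" "l2 \<in> Os" "l1 \<noteq> l2" and "l \<in> Os" "in_span l1 l2 l"
  obtains t where "l = l1 + Const t * (l2 - l1)"
    "eval_poly l e = eval_poly l1 e + t * (eval_poly l2 e - eval_poly l1 e)"
proof -
  obtain s t where st: "l = Const s * l1 + Const t * l2" using assms(5) by (auto simp: in_span_def)
  have "eval_poly l p = s * eval_poly l1 p + t * eval_poly l2 p" unfolding st by simp
  then have s: "s = 1 - t" using Os(4) l assms(4) by (simp add: eq_diff_eq)
  show ?thesis by (rule that[of t]) (simp_all add: st s Const_diff algebra_simps)
qed

text \<open>Interpolation on concurrent lines. On the lines of the pencil spanned by \<open>l1\<close> and \<open>l2\<close>, the function
  \<open>l(e)\<close> equals \<open>(a1 l2 - a2 l1)/(l2 - l1)\<close>, because \<open>l(e)\<close> is affine in the parameter of \<open>l\<close>. Multiplying by \<open>l2 - l1\<close>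
  turns the conditions on the individual lines into one congruence modulo their product.\<close>

lemma interpolation_iff:
  assumes l: "l1 \<in> Os" "l2 \<in> Os" "l1 \<noteq> l2" and C: "C \<subseteq> Os" "\<And>l. l \<in> C \<Longrightarrow> in_span l1 l2 l"
  defines "a1 \<equiv> eval_poly l1 e" and "a2 \<equiv> eval_poly l2 e"
  shows "(\<forall>l\<in>C. l dvd c - Const (eval_poly l e) * (v * G)) \<longleftrightarrow>
    \<Prod>C dvd (l2 - l1) * c - v * G * (Const a1 * l2 - Const a2 * l1)" (is "?L \<longleftrightarrow> _ dvd ?K")
proof -
  have fin: "finite C" using C(1) Os(1) finite_subset by blast
  have key: "l dvd c - Const (eval_poly l e) * (v * G) \<longleftrightarrow> l dvd ?K" if lC: "l \<in> C" for l
  proof -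
    have lO: "l \<in> Os" using C(1) lC by blast
    obtain t where t: "l = l1 + Const t * (l2 - l1)" "eval_poly l e = a1 + t * (a2 - a1)"
      using pencil_member[OF l lO C(2)[OF lC]] unfolding a1_def a2_def by blast
    have eq: "(l2 - l1) * (c - Const (eval_poly l e) * (v * G)) = ?K - Const (a2 - a1) * v * G * l"
      unfolding t(2) by (subst t(1)) (simp add: Const_add Const_mult Const_diff algebra_simps)
    have pr: "prime_elem l" using lO by (intro linear_prime Os Os_nz)
    have "\<not> l dvd l2 - l1"
    proof
      assume d: "l dvd l2 - l1"
      have "homogeneous 1 (l2 - l1)" using l by (intro homogeneous_diff Os)
      then obtain k where k: "l2 - l1 = Const k * l" using d linear_dvd_linear Os(3)[OF lO] by blast
      then have "eval_poly (l2 - l1) p = k * eval_poly l p" by simp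
      then have "k = 0" using Os(4) l lO by simp
      then show False using k l(3) by simp
    qed
    then have "l dvd c - Const (eval_poly l e) * (v * G) \<longleftrightarrow> l dvd (l2 - l1) * (c - Const (eval_poly l e) * (v * G))"
      using pr by (simp add: prime_elem_dvd_mult_iff)
    also have "\<dots> \<longleftrightarrow> l dvd ?K"
    proof -
      have "l dvd Const (a2 - a1) * v * G * l" by simp
      then show ?thesis unfolding eq by (metis diff_add_cancel dvd_add dvd_diff)
    qed
    finally show ?thesis .
  qed
  have "(\<forall>l\<in>C. l dvd ?K) \<longleftrightarrow> \<Prod>C dvd ?K"
  proof
    assume "\<forall>l\<in>C. l dvd ?K"
    then show "\<Prod>C dvd ?K"
      using prod_dvd_of_distinct_lines[OF fin, of "\<lambda>x. x" ?K] C(1) Os_distinct_lines Os Os_nz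
      by (meson subsetD)
  next
    assume d: "\<Prod>C dvd ?K"
    show "\<forall>l\<in>C. l dvd ?K"
    proof
      fix l assume "l \<in> C"
      then have "l dvd \<Prod>C" using fin by (auto intro: dvd_prodI[of _ _ "\<lambda>x. x"])
      then show "l dvd ?K" using d by (rule dvd_trans)
    qed
  qed
  then show ?thesis using key by blast
qed

lemma prod_congruent_power:
  fixes x m :: "'a :: comm_ring_1"
  assumes "finite C" "\<And>l. l \<in> C \<Longrightarrow> m dvd l - x"
  shows "m dvd \<Prod>C - x ^ card C"
  using assms
proof (induction C rule: finite_induct)
  case (insert l C)
  have "\<Prod>(insert l C) - x ^ card (insert l C) = (l - x) * \<Prod>C + x * (\<Prod>C - x ^ card C)"
    using insert(1,2) by (simp add: algebra_simps)
  moreover have "m dvd l - x" "m dvd \<Prod>C - x ^ card C" using insert by auto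
  ultimately show ?case by simp
qed simp

lemma pencil_difference:
  assumes "l1 \<in> Os" "l2 \<in> Os" "l1 \<noteq> l2"
  shows "distinct_lines (l2 - l1) l1" "in_span (l2 - l1) l1 g \<Longrightarrow> in_span l1 l2 g"
    "eval_poly (l2 - l1) p = 0" "homogeneous 1 (l2 - l1)" "l2 - l1 \<noteq> 0"
proof -
  show z: "eval_poly (l2 - l1) p = 0" using assms Os(4) by simp
  show hm: "homogeneous 1 (l2 - l1)" using assms by (intro homogeneous_diff Os)
  show nz: "l2 - l1 \<noteq> 0" using assms by simp
  show "distinct_lines (l2 - l1) l1" by (rule pencil_Os_distinct_lines[OF hm nz z assms(1)])
  assume "in_span (l2 - l1) l1 g"
  then obtain s t where "g = Const s * (l2 - l1) + Const t * l1" by (auto simp: in_span_def)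
  then have "g = Const (t - s) * l1 + Const s * l2" by (simp add: Const_diff algebra_simps)
  then show "in_span l1 l2 g" by (auto simp: in_span_def)
qed

text \<open>If \<open>l1\<close> and \<open>l2\<close> agree at \<open>e\<close>, their difference vanishes at \<open>e\<close> and at \<open>p\<close> and is thus proportional to \<open>\<beta>\<close>.\<close>

lemma off_value_differs:
  assumes "l1 \<in> Os" "l2 \<in> Os" "l1 \<noteq> l2" "off l1 l2"
  shows "eval_poly l1 e \<noteq> eval_poly l2 e"
proof
  assume eq: "eval_poly l1 e = eval_poly l2 e"
  note d = pencil_difference[OF assms(1-3)]
  obtain s t where st: "l2 - l1 = Const s * \<alpha> + Const t * \<beta>"
    using in_span_if_common_zero[OF dl(1) p(1-3) d(4,3)] by (auto simp: in_span_def)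
  have "eval_poly (l2 - l1) e = s" unfolding st using e by simp
  then have "s = 0" using eq by simp
  then have lt: "l2 - l1 = Const t * \<beta>" using st by simp
  then have "t \<noteq> 0" using d(5) by auto
  then have "\<beta> = Const (1 / t) * (Const t * \<beta>)" by (simp add: mult.assoc[symmetric] Const_mult[symmetric])
  also have "\<dots> = Const (- (1 / t)) * l1 + Const (1 / t) * l2"
    unfolding lt[symmetric] by (simp add: Const_minus algebra_simps)
  finally have "in_span l1 l2 \<beta>" unfolding in_span_def by blast
  then show False using assms(4) by (simp add: off_def)
qed

text \<open>Let \<open>n + 1\<close> lines meet in a point \<open>Q\<close> off the four lines and let \<open>m = l2 - l1\<close> be the line joining \<open>Q\<close> to
  \<open>p\<close>. On \<open>m\<close> all the lines coincide with \<open>l1\<close>, so that the congruence of \<open>interpolation_iff\<close> becomes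
  \<open>v G a l1 + w l1\<^sup>n\<^sup>+\<^sup>1 = 0\<close> with a constant \<open>a \<noteq> 0\<close>; and \<open>G\<close> can be cancelled as it does not vanish at \<open>Q\<close>. The
  slope ideal is that of the curvilinear scheme of length \<open>n\<close> at \<open>Q\<close> in the direction of \<open>m\<close>.\<close>

theorem slope_ideal_concurrent_off:
  assumes l: "l1 \<in> C" "l2 \<in> C" "l1 \<noteq> l2" and C: "C \<subseteq> Os" "\<And>l. l \<in> C \<Longrightarrow> in_span l1 l2 l"
    and off: "off l1 l2" and n: "card C = Suc n"
  shows "slopes C = ideal2 (l2 - l1) (l1 ^ n)"
proof -
  have lO: "l1 \<in> Os" "l2 \<in> Os" using l C by auto
  have fin: "finite C" using C(1) Os(1) finite_subset by blast
  define m where "m = l2 - l1"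
  define a where "a = eval_poly l1 e - eval_poly l2 e"
  have a: "a \<noteq> 0" using off_value_differs[OF lO l(3) off] by (simp add: a_def)
  note d = pencil_difference[OF lO l(3), folded m_def]
  let ?N = "Const (eval_poly l1 e) * l2 - Const (eval_poly l2 e) * l1"
  (* Modulo m the interpolating numerator is a l1, as l2 = l1 + m. *)
  have N: "?N = Const a * l1 + Const (eval_poly l1 e) * m"
    by (simp add: a_def m_def Const_diff algebra_simps)
  have "m dvd l - l1" if lC: "l \<in> C" for l
  proof -
    obtain t where "l = l1 + Const t * (l2 - l1)" using pencil_member[OF lO l(3) _ C(2)[OF lC]] C(1) lC by blast
    then show ?thesis by (simp add: m_def)
  qed
  then have "m dvd \<Prod>C - l1 ^ Suc n" using prod_congruent_power[OF fin] n by metis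
  then obtain k where "\<Prod>C - l1 ^ Suc n = m * k" by (rule dvdE)
  then have k: "\<Prod>C = l1 ^ Suc n + m * k" by (simp add: algebra_simps)
  have I: "v \<in> slopes C \<longleftrightarrow> (\<exists>c w. m * c = v * G * ?N + w * \<Prod>C)" for v
  proof -
    have "v \<in> slopes C \<longleftrightarrow> (\<exists>c. \<Prod>C dvd m * c - v * G * ?N)"
      using interpolation_iff[OF lO l(3) C] by (simp add: slope_ideal_def m_def)
    also have "\<dots> \<longleftrightarrow> (\<exists>c w. m * c - v * G * ?N = w * \<Prod>C)" by (auto simp: dvd_def mult.commute)
    also have "\<dots> \<longleftrightarrow> (\<exists>c w. m * c = v * G * ?N + w * \<Prod>C)" by (simp add: diff_eq_eq add.commute)
    finally show ?thesis .
  qed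
  show ?thesis unfolding m_def[symmetric]
  proof (intro equalityI subsetI)
    fix v assume "v \<in> slopes C"
    then obtain c w where cw: "m * c = v * G * ?N + w * \<Prod>C" using I by blast
    then have "l1 * (Const a * (v * G) + w * l1 ^ n) = m * (c - v * G * Const (eval_poly l1 e) - w * k)"
      unfolding N k by (simp add: algebra_simps)
    then have "m dvd l1 * (Const a * (v * G) + w * l1 ^ n)" by simp
    then have "m dvd Const a * (v * G) + w * l1 ^ n"
      using prime_elem_dvd_multD[OF linear_prime[OF d(4,5)]] distinct_lines_not_dvd[OF d(1)] by blast
    then obtain q where "Const a * (v * G) + w * l1 ^ n = m * q" by (rule dvdE)
    then have "Const a * (v * G) = q * m + (- w) * l1 ^ n" by (simp add: algebra_simps)
    then have "Const a * (v * G) \<in> ideal2 m (l1 ^ n)" unfolding ideal2_def by blast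
    then have "Const (1 / a) * (Const a * (v * G)) \<in> ideal2 m (l1 ^ n)" by (rule ideal2_mult)
    moreover have "Const (1 / a) * (Const a * (v * G)) = v * G"
      using a by (simp add: mult.assoc[symmetric] Const_mult[symmetric])
    moreover have "v * G = \<alpha> * (\<gamma> * (\<delta> * v))" by (simp add: G_def mult_ac)
    ultimately have "\<alpha> * (\<gamma> * (\<delta> * v)) \<in> ideal2 m (l1 ^ n)" by (simp only:)
    moreover have "\<not> in_span m l1 g" if "g \<in> {\<alpha>, \<gamma>, \<delta>}" for g
      using off d(2)[of g] that by (auto simp: off_def)
    ultimately show "v \<in> ideal2 m (l1 ^ n)"
      using ideal2_cancel[OF d(1)] lin by (metis insertI1 insertI2)
  next
    fix v assume "v \<in> ideal2 m (l1 ^ n)"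
    then obtain s t where v: "v = s * m + t * l1 ^ n" by (auto simp: ideal2_def)
    have "m * (s * G * ?N + t * l1 ^ n * G * Const (eval_poly l1 e) - t * G * Const a * k)
        = v * G * ?N + (- (t * G * Const a)) * \<Prod>C"
      unfolding v N k by (simp add: algebra_simps)
    then show "v \<in> slopes C" using I by blast
  qed
qed

text \<open>If \<open>Q\<close> lies on one of the four lines, that line is \<open>m\<close>. If it is \<open>\<beta>\<close>, all values \<open>l(e)\<close> agree and \<open>c = l(e) v G\<close>
  interpolates; otherwise \<open>m\<close> divides \<open>G\<close> and the interpolating quotient is a polynomial.\<close>

theorem slope_ideal_concurrent_on:
  assumes l: "l1 \<in> C" "l2 \<in> C" "l1 \<noteq> l2" and C: "C \<subseteq> Os" "\<And>l. l \<in> C \<Longrightarrow> in_span l1 l2 l"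
    and on: "\<not> off l1 l2"
  shows "slopes C = UNIV"
proof -
  have lO: "l1 \<in> Os" "l2 \<in> Os" using l C by auto
  define m where "m = l2 - l1"
  let ?N = "Const (eval_poly l1 e) * l2 - Const (eval_poly l2 e) * l1"
  obtain g where g: "g \<in> {\<alpha>, \<beta>, \<gamma>, \<delta>}" "in_span l1 l2 g" using on by (auto simp: off_def)
  then obtain s t where st: "g = Const s * l1 + Const t * l2" by (auto simp: in_span_def)
  have "eval_poly g p = s * eval_poly l1 p + t * eval_poly l2 p" unfolding st by simp
  then have "s = - t" using g p Os(4) lO by (auto simp: eq_neg_iff_add_eq_0)
  then have gm: "g = Const t * m" unfolding st m_def by (simp add: Const_minus algebra_simps)
  have "g \<noteq> 0" using g nz by auto
  then have t: "t \<noteq> 0" using gm by auto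
  have "v \<in> slopes C" for v
  proof (cases "g = \<beta>")
    case True
    have "t * (eval_poly l2 e - eval_poly l1 e) = eval_poly g e" unfolding gm m_def by simp
    then have eq: "eval_poly l2 e = eval_poly l1 e" using True e t by simp
    have "l dvd Const (eval_poly l1 e) * (v * G) - Const (eval_poly l e) * (v * G)" if lC: "l \<in> C" for l
    proof -
      have "l \<in> Os" using C lC by auto
      then obtain t where "eval_poly l e = eval_poly l1 e + t * (eval_poly l2 e - eval_poly l1 e)"
        using pencil_member[OF lO l(3) _ C(2)[OF lC]] by blast
      then show ?thesis using eq by simp
    qed
    then show ?thesis by (auto simp: slope_ideal_def)
  next
    case False
    then have "g dvd G" using g by (auto simp: G_def)
    then obtain q where "G = g * q" by (rule dvdE)
    then have "m * (v * (Const t * q) * ?N) - v * G * ?N = 0" unfolding gm by (simp add: mult_ac)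
    then have "\<Prod>C dvd m * (v * (Const t * q) * ?N) - v * G * ?N" by (simp only: dvd_0_right)
    then show ?thesis using interpolation_iff[OF lO l(3) C] unfolding m_def slope_ideal_def by blast
  qed
  then show ?thesis by blast
qed

lemma slope_ideal_pair:
  assumes "l1 \<in> Os" "l2 \<in> Os" "l1 \<noteq> l2"
  shows "slopes {l1, l2} = (if off l1 l2 then ideal2 l1 l2 else UNIV)"
proof (cases "off l1 l2")
  case True
  have "slopes {l1, l2} = ideal2 (l2 - l1) (l1 ^ 1)"
    using assms in_span_self True by (intro slope_ideal_concurrent_off) auto
  also have "\<dots> = ideal2 l1 l2"
  proof (intro equalityI subsetI)
    fix x assume "x \<in> ideal2 (l2 - l1) (l1 ^ 1)"
    then obtain s t where "x = s * (l2 - l1) + t * l1" by (auto simp: ideal2_def)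
    then have "x = (t - s) * l1 + s * l2" by (simp add: algebra_simps)
    then show "x \<in> ideal2 l1 l2" unfolding ideal2_def by blast
  next
    fix x assume "x \<in> ideal2 l1 l2"
    then obtain s t where "x = s * l1 + t * l2" by (auto simp: ideal2_def)
    then have "x = t * (l2 - l1) + (s + t) * l1 ^ 1" by (simp add: algebra_simps)
    then show "x \<in> ideal2 (l2 - l1) (l1 ^ 1)" unfolding ideal2_def by blast
  qed
  finally show ?thesis using True by simp
next
  case False
  show ?thesis using slope_ideal_concurrent_on[of l1 "{l1, l2}" l2] assms in_span_self False by auto
qed

text \<open>A further line \<open>m\<close> that meets the lines of \<open>C\<close> in distinct points imposes only the conditions at these points:
  an interpolant for \<open>C\<close> may be changed by multiples of \<open>\<Prod>C\<close>, and on \<open>m\<close> the required change vanishes in the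
  intersection points, which are pairwise distinct, so that it is divisible by the product of their equations.\<close>

theorem slope_ideal_insert_transversal:
  assumes C: "C \<subseteq> Os" and m: "m \<in> Os" "m \<notin> C"
    and tr: "\<And>l l'. l \<in> C \<Longrightarrow> l' \<in> C \<Longrightarrow> l \<noteq> l' \<Longrightarrow> \<not> in_span l l' m"
  shows "slopes (insert m C) = slopes C \<inter> (\<Inter>l\<in>C. slopes {l, m})"
proof (intro equalityI subsetI)
  fix v assume "v \<in> slopes (insert m C)"
  then show "v \<in> slopes C \<inter> (\<Inter>l\<in>C. slopes {l, m})" unfolding slope_ideal_def by blast
next
  fix v assume v: "v \<in> slopes C \<inter> (\<Inter>l\<in>C. slopes {l, m})"
  have fin: "finite C" using C Os(1) finite_subset by blast
  obtain c where c: "\<And>l. l \<in> C \<Longrightarrow> l dvd c - Const (eval_poly l e) * (v * G)"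
    using v by (auto simp: slope_ideal_def)
  define x where "x = c - Const (eval_poly m e) * (v * G)"
  obtain \<sigma> where \<sigma>: "restriction m \<sigma>" using restriction_exists Os(3)[OF m(1)] Os_nz[OF m(1)] by blast
  have \<sigma>m: "\<sigma> m = 0" using restrictionD(5)[OF \<sigma>, of m] by simp
  have dvd: "\<sigma> l dvd \<sigma> x" if lC: "l \<in> C" for l
  proof -
    have "v \<in> slopes {l, m}" using v lC by blast
    then obtain c' where c': "l dvd c' - Const (eval_poly l e) * (v * G)" "m dvd c' - Const (eval_poly m e) * (v * G)"
      by (auto simp: slope_ideal_def)
    obtain q where "c - Const (eval_poly l e) * (v * G) - (c' - Const (eval_poly l e) * (v * G)) = l * q"
      using dvd_diff[OF c[OF lC] c'(1)] by (rule dvdE)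
    moreover obtain r where "c' - Const (eval_poly m e) * (v * G) = m * r"
      using c'(2) by (rule dvdE)
    ultimately have "x = l * q + m * r" by (simp add: x_def algebra_simps)
    then have "\<sigma> x = \<sigma> l * \<sigma> q" using restrictionD(1,2)[OF \<sigma>] \<sigma>m by simp
    then show ?thesis by simp
  qed
  have red: "distinct_lines (\<sigma> l) (\<sigma> l')" if ll: "l \<in> C" "l' \<in> C" "l \<noteq> l'" for l l'
  proof -
    have O: "l \<in> Os" "l' \<in> Os" "l \<noteq> m" using ll C m by auto
    have "\<not> in_span m l l'"
    proof
      assume "in_span m l l'"
      then obtain s t where st: "l' = Const s * m + Const t * l" by (auto simp: in_span_def)
      have "s \<noteq> 0" using st Os_distinct_lines[OF O(1,2) ll(3)] by (auto simp: distinct_lines_def)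
      then have "m = Const (1 / s) * (Const s * m)" by (simp add: mult.assoc[symmetric] Const_mult[symmetric])
      also have "\<dots> = Const (- (t / s)) * l + Const (1 / s) * l'"
        by (simp add: st Const_minus algebra_simps Const_mult[symmetric] mult.assoc[symmetric])
      finally show False using tr[OF ll] unfolding in_span_def by blast
    qed
    then show ?thesis
      using in_span_reduction[OF Os_distinct_lines[OF m(1) O(1) O(3)[symmetric]] Os(3)[OF O(2)]]
        restrictionD(6)[OF \<sigma> Os(3)[OF O(1)]] restrictionD(6)[OF \<sigma> Os(3)[OF O(2)]] by auto
  qed
  have lin1: "homogeneous 1 (\<sigma> l) \<and> \<sigma> l \<noteq> 0" if "l \<in> C" for l
  proof -
    have O: "l \<in> Os" "l \<noteq> m" using that C m by auto
    obtain k where k: "\<sigma> l = l - Const k * m" using restrictionD(6)[OF \<sigma> Os(3)[OF O(1)]] by blast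
    have "homogeneous 1 (\<sigma> l)" unfolding k by (intro homogeneous_diff homogeneous_Const_mult Os O m)
    moreover have "\<sigma> l \<noteq> 0"
      using distinct_lines_not_dvd[OF Os_distinct_lines[OF m(1) O(1) O(2)[symmetric]]] restrictionD(5)[OF \<sigma>]
        by simp
    ultimately show ?thesis by simp
  qed
  have "prod \<sigma> C dvd \<sigma> x" using fin dvd red lin1 by (rule prod_dvd_of_distinct_lines)
  moreover have "prod \<sigma> C = \<sigma> (\<Prod>C)"
    using fin by (induction C rule: finite_induct) (simp_all add: restrictionD(2,3)[OF \<sigma>])
  ultimately obtain k where k: "\<sigma> x = \<sigma> (\<Prod>C) * k" by (auto elim: dvdE)
  have split: "x - \<Prod>C * k = (x - \<sigma> x) - (\<Prod>C - \<sigma> (\<Prod>C)) * k" by (simp add: k algebra_simps)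
  have mx: "m dvd x - \<Prod>C * k" unfolding split by (intro dvd_diff dvd_mult2 restrictionD(4)[OF \<sigma>])
  have "l dvd (c - \<Prod>C * k) - Const (eval_poly l e) * (v * G)" if "l \<in> insert m C" for l
  proof (cases "l = m")
    case True
    then show ?thesis using mx by (simp add: x_def algebra_simps)
  next
    case False
    then have lC: "l \<in> C" using that by simp
    then have "l dvd \<Prod>C * k" using fin by (auto intro: dvd_mult2 dvd_prodI[of _ _ "\<lambda>x. x"])
    then have "l dvd (c - Const (eval_poly l e) * (v * G)) - \<Prod>C * k" using c[OF lC] by (rule dvd_diff[rotated])
    then show ?thesis by (simp add: algebra_simps)
  qed
  then show "v \<in> slopes (insert m C)" unfolding slope_ideal_def by blast
qed

end

section \<open>Intersections of ideals of points\<close>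

lemma ideal_gen_base: "g \<in> set gs \<Longrightarrow> g \<in> ideal_gen gs"
  and ideal_gen_zero: "0 \<in> ideal_gen gs"
proof (induction gs)
  case (Cons h gs)
  have mem: "x * h + y \<in> ideal_gen (h # gs)" if "y \<in> ideal_gen gs" for x y using that by auto
  have "0 \<in> ideal_gen (h # gs)" using mem[OF Cons(2), of 0] by (simp del: ideal_gen.simps)
  moreover have "h \<in> ideal_gen (h # gs)" using mem[OF Cons(2), of 1] by (simp del: ideal_gen.simps)
  moreover have "x \<in> ideal_gen (h # gs)" if "x \<in> ideal_gen gs" for x
    using mem[OF that, of 0] by (simp del: ideal_gen.simps)
  ultimately show "g \<in> set (h # gs) \<Longrightarrow> g \<in> ideal_gen (h # gs)" "0 \<in> ideal_gen (h # gs)"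
    using Cons(1) by auto
qed auto

lemma ideal_gen_mult: "x \<in> ideal_gen gs \<Longrightarrow> y * x \<in> ideal_gen gs"
proof -
  assume "x \<in> ideal_gen gs"
  then obtain a where "x = (\<Sum>i<length gs. a i * gs ! i)" unfolding ideal_gen_iff ..
  then have "y * x = (\<Sum>i<length gs. (y * a i) * gs ! i)" by (simp add: sum_distrib_left mult.assoc)
  then show ?thesis unfolding ideal_gen_iff by (intro exI[of _ "\<lambda>i. y * a i"])
qed

lemma ideal_gen_add: "x \<in> ideal_gen gs \<Longrightarrow> y \<in> ideal_gen gs \<Longrightarrow> x + y \<in> ideal_gen gs"
proof -
  assume "x \<in> ideal_gen gs" "y \<in> ideal_gen gs"
  then obtain a b where "x = (\<Sum>i<length gs. a i * gs ! i)" "y = (\<Sum>i<length gs. b i * gs ! i)"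
    unfolding ideal_gen_iff by blast
  then have "x + y = (\<Sum>i<length gs. (a i + b i) * gs ! i)" by (simp add: sum.distrib distrib_right)
  then show ?thesis unfolding ideal_gen_iff by (intro exI[of _ "\<lambda>i. a i + b i"])
qed

lemma ideal_gen_diff: "x \<in> ideal_gen gs \<Longrightarrow> y \<in> ideal_gen gs \<Longrightarrow> x - y \<in> ideal_gen gs"
  using ideal_gen_add[of x gs "- 1 * y"] ideal_gen_mult[of y gs "-1"] by simp

lemma ideal_gen_dvd: "g \<in> set gs \<Longrightarrow> g dvd x \<Longrightarrow> x \<in> ideal_gen gs"
  using ideal_gen_mult[OF ideal_gen_base] by (metis dvdE mult.commute)

lemma ideal_gen_subset:
  assumes "\<And>g. g \<in> set gs \<Longrightarrow> g \<in> J" "0 \<in> J" "\<And>x y. x \<in> J \<Longrightarrow> y \<in> J \<Longrightarrow> x + y \<in> J"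
    "\<And>x y. x \<in> J \<Longrightarrow> y * x \<in> J"
  shows "ideal_gen gs \<subseteq> J"
  using assms(1)
proof (induction gs)
  case (Cons g gs)
  then show ?case using assms(2-4) by auto
qed (use assms(2) in auto)

lemma ideal_gen_eqI:
  assumes "\<And>g. g \<in> set gs \<Longrightarrow> g \<in> ideal_gen hs" "\<And>h. h \<in> set hs \<Longrightarrow> h \<in> ideal_gen gs"
  shows "ideal_gen gs = ideal_gen hs"
  using assms by (intro equalityI ideal_gen_subset ideal_gen_zero ideal_gen_add ideal_gen_mult)

lemma ideal2_eq_ideal_gen: "ideal2 x y = ideal_gen [x, y]"
  by (auto simp: ideal2_def)

lemma ideal_gen_subset_ideal2:
  "(\<And>g. g \<in> set gs \<Longrightarrow> g \<in> ideal2 x y) \<Longrightarrow> ideal_gen gs \<subseteq> ideal2 x y"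
  unfolding ideal2_eq_ideal_gen
  by (intro ideal_gen_subset ideal_gen_zero ideal_gen_add ideal_gen_mult)

text \<open>For lines \<open>y\<close> and \<open>z\<close> this holds for the products of lines missing their intersection point.\<close>

definition nonzerodivisor_mod :: "spoly \<Rightarrow> spoly \<Rightarrow> spoly \<Rightarrow> bool" where
  "nonzerodivisor_mod y z g \<longleftrightarrow> (\<forall>w. w * g \<in> ideal2 y z \<longrightarrow> w \<in> ideal2 y z)"

lemma nonzerodivisor_mod_mult:
  "nonzerodivisor_mod y z g \<Longrightarrow> nonzerodivisor_mod y z h \<Longrightarrow> nonzerodivisor_mod y z (g * h)"
  unfolding nonzerodivisor_mod_def by (metis mult.assoc)

lemma nonzerodivisor_mod_line:
  "distinct_lines y z \<Longrightarrow> homogeneous 1 l \<Longrightarrow> \<not> in_span y z l \<Longrightarrow> nonzerodivisor_mod y z l"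
  unfolding nonzerodivisor_mod_def using ideal2_cancel1 by (metis mult.commute)

text \<open>Adding one point to a scheme whose ideal is known: if all generators but \<open>g\<close> vanish at the point
  \<open>y = z = 0\<close> and \<open>g\<close> does not, then \<open>g\<close> is replaced by \<open>y g\<close> and \<open>z g\<close>. All ideals of points below arise by
  repeated use of this step.\<close>

lemma ideal_gen_meet:
  assumes "\<And>x. x \<in> set gs \<Longrightarrow> x \<in> ideal2 y z" "nonzerodivisor_mod y z g"
  shows "ideal_gen (g # gs) \<inter> ideal2 y z = ideal_gen (y * g # z * g # gs)"
proof (intro equalityI subsetI)
  fix v assume v: "v \<in> ideal_gen (g # gs) \<inter> ideal2 y z"
  then obtain t r where tr: "v = t * g + r" "r \<in> ideal_gen gs" by auto
  have "r \<in> ideal2 y z" using tr(2) ideal_gen_subset_ideal2[OF assms(1)] by blast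
  then have "v - r \<in> ideal2 y z" using v by (intro ideal2_diff) auto
  then have "t * g \<in> ideal2 y z" using tr(1) by simp
  then have "t \<in> ideal2 y z" using assms(2) by (auto simp: nonzerodivisor_mod_def)
  then obtain p q where "t = p * y + q * z" by (auto simp: ideal2_def)
  then have "v = p * (y * g) + (q * (z * g) + r)" using tr(1) by (simp add: algebra_simps)
  then show "v \<in> ideal_gen (y * g # z * g # gs)" using tr(2) by auto
next
  fix v assume v: "v \<in> ideal_gen (y * g # z * g # gs)"
  have "ideal_gen (y * g # z * g # gs) \<subseteq> ideal2 y z"
    using assms(1) by (intro ideal_gen_subset_ideal2) auto
  moreover have "ideal_gen (y * g # z * g # gs) \<subseteq> ideal_gen (g # gs)"
    by (intro ideal_gen_subset ideal_gen_zero ideal_gen_add ideal_gen_mult)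
      (auto intro: ideal_gen_dvd ideal_gen_base simp del: ideal_gen.simps)
  ultimately show "v \<in> ideal_gen (g # gs) \<inter> ideal2 y z" using v by blast
qed

subsection \<open>Points witnessing minimality\<close>

lemma point_on_line_off_line:
  assumes "distinct_lines y l"
  obtains x where "eval_poly y x = 0" "eval_poly l x \<noteq> 0"
proof -
  have h: "homogeneous 1 y" "homogeneous 1 l" "y \<noteq> 0" using assms by (auto simp: distinct_lines_def)
  obtain q0 where q0: "eval_poly y q0 = 1" using linear_nonzero_value[OF h(1,3)] .
  let ?l = "l - Const (eval_poly l q0) * y"
  have "homogeneous 1 ?l" by (intro homogeneous_diff homogeneous_Const_mult h)
  moreover have "?l \<noteq> 0" using assms by (auto simp: distinct_lines_def)
  ultimately obtain q where q: "eval_poly ?l q = 1" using linear_nonzero_value by blast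
  let ?x = "q + (- eval_poly y q) *s q0"
  have "eval_poly y ?x = 0"
    by (simp only: eval_linear_add[OF h(1)] eval_linear_scale[OF h(1)] q0) simp
  moreover have "eval_poly l ?x = eval_poly ?l q"
    by (simp only: eval_linear_add[OF h(2)] eval_linear_scale[OF h(2)]) simp
  ultimately show ?thesis using that q by simp
qed

lemma point_on_line_off_lines:
  assumes "finite X" "homogeneous 1 y" "\<And>l. l \<in> X \<Longrightarrow> distinct_lines y l"
  shows "\<exists>x. eval_poly y x = 0 \<and> (\<forall>l\<in>X. eval_poly l x \<noteq> 0)"
  using assms(1,3)
proof (induction X rule: finite_induct)
  case empty
  show ?case using eval_linear_zero[OF assms(2)] by blast
next
  case (insert k X)
  then obtain x where x: "eval_poly y x = 0" "\<forall>l\<in>X. eval_poly l x \<noteq> 0" by auto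
  obtain x' where x': "eval_poly y x' = 0" "eval_poly k x' \<noteq> 0"
    using insert.prems[of k] point_on_line_off_line by blast
  have lin: "homogeneous 1 l" if "l \<in> insert k X" for l
    using insert.prems[OF that] by (simp add: distinct_lines_def)
  have "finite {t. eval_poly l x + t * eval_poly l x' = 0}" if "l \<in> insert k X" for l
  proof (cases "eval_poly l x' = 0")
    case True
    then have "l \<in> X" using that x'(2) by auto
    then show ?thesis using True x(2) by simp
  next
    case False
    then have "{t. eval_poly l x + t * eval_poly l x' = 0} \<subseteq> {- eval_poly l x / eval_poly l x'}"
      by (auto simp: field_simps eq_neg_iff_add_eq_0 add.commute)
    then show ?thesis using finite_subset by blast
  qed
  then have "finite (\<Union>l\<in>insert k X. {t. eval_poly l x + t * eval_poly l x' = 0})"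
    using insert(1) by blast
  then obtain t where t: "\<And>l. l \<in> insert k X \<Longrightarrow> eval_poly l x + t * eval_poly l x' \<noteq> 0"
    using ex_new_if_finite[OF infinite_UNIV_char_0] by blast
  have "eval_poly l (x + t *s x') = eval_poly l x + t * eval_poly l x'" if "homogeneous 1 l" for l
    using that by (simp add: eval_linear_add eval_linear_scale)
  then have "eval_poly y (x + t *s x') = 0" "\<forall>l\<in>insert k X. eval_poly l (x + t *s x') \<noteq> 0"
    using x x' t lin assms(2) by auto
  then show ?case by blast
qed

lemma witnessed_2: "witnessed [u, v] \<longleftrightarrow>
    (\<exists>x. eval_poly v x = 0 \<and> eval_poly u x \<noteq> 0) \<and> (\<exists>x. eval_poly u x = 0 \<and> eval_poly v x \<noteq> 0)"
  by (auto simp: witnessed_def All_less_Suc numeral_2_eq_2)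

lemma witnessed_3: "witnessed [u, v, w] \<longleftrightarrow>
    (\<exists>x. eval_poly v x = 0 \<and> eval_poly w x = 0 \<and> eval_poly u x \<noteq> 0) \<and>
    (\<exists>x. eval_poly u x = 0 \<and> eval_poly w x = 0 \<and> eval_poly v x \<noteq> 0) \<and>
    (\<exists>x. eval_poly u x = 0 \<and> eval_poly v x = 0 \<and> eval_poly w x \<noteq> 0)"
  by (auto simp: witnessed_def All_less_Suc)

lemma witnessed_4: "witnessed [u, v, w, z] \<longleftrightarrow>
    (\<exists>x. eval_poly v x = 0 \<and> eval_poly w x = 0 \<and> eval_poly z x = 0 \<and> eval_poly u x \<noteq> 0) \<and>
    (\<exists>x. eval_poly u x = 0 \<and> eval_poly w x = 0 \<and> eval_poly z x = 0 \<and> eval_poly v x \<noteq> 0) \<and>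
    (\<exists>x. eval_poly u x = 0 \<and> eval_poly v x = 0 \<and> eval_poly z x = 0 \<and> eval_poly w x \<noteq> 0) \<and>
    (\<exists>x. eval_poly u x = 0 \<and> eval_poly v x = 0 \<and> eval_poly w x = 0 \<and> eval_poly z x \<noteq> 0)"
  by (auto simp: witnessed_def All_less_Suc)

(* From here on, membership is shown by divisibility by a generator, not by exhibiting a combination. *)
declare ideal_gen.simps [simp del]

lemma ideal_gen_dvdI: "\<exists>g\<in>set gs. g dvd x \<Longrightarrow> x \<in> ideal_gen gs"
  using ideal_gen_dvd by blast

lemma ideal2_eq_ideal_gen': "ideal2 x y = ideal_gen [y, x]"
  using ideal2_eq_ideal_gen[of y x] by (simp add: ideal2_sym)

lemma homogeneous_prod2: "homogeneous 1 x \<Longrightarrow> homogeneous 1 y \<Longrightarrow> homogeneous 2 (x * y)"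
  using homogeneous_mult[of 1 x 1 y] by simp

lemma homogeneous_prod3: "homogeneous 1 x \<Longrightarrow> homogeneous 1 y \<Longrightarrow> homogeneous 1 z \<Longrightarrow> homogeneous 3 (x * y * z)"
  using homogeneous_mult[OF homogeneous_prod2, of x y 1 z] by simp

lemma witnessed_2I:
  assumes "eval_poly v x = 0" "eval_poly u x \<noteq> 0" "eval_poly u y = 0" "eval_poly v y \<noteq> 0"
  shows "witnessed [u, v]"
  using assms unfolding witnessed_2 by blast

lemma witnessed_3I:
  assumes "eval_poly v x = 0" "eval_poly w x = 0" "eval_poly u x \<noteq> 0"
    "eval_poly u y = 0" "eval_poly w y = 0" "eval_poly v y \<noteq> 0"
    "eval_poly u z = 0" "eval_poly v z = 0" "eval_poly w z \<noteq> 0"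
  shows "witnessed [u, v, w]"
  using assms unfolding witnessed_3 by blast

lemma in_span_exchange:
  assumes "in_span y d x" "distinct_lines y x"
  shows "in_span y x d"
proof -
  obtain s t where st: "x = Const s * y + Const t * d" using assms(1) by (auto simp: in_span_def)
  have "t \<noteq> 0" using st assms(2) by (auto simp: distinct_lines_def)
  then have "d = Const (1 / t) * (Const t * d)" by (simp add: mult.assoc[symmetric] Const_mult[symmetric])
  also have "\<dots> = Const (- (s / t)) * y + Const (1 / t) * x"
    by (simp add: st Const_minus algebra_simps Const_mult[symmetric] mult.assoc[symmetric])
  finally show ?thesis unfolding in_span_def by blast
qed

context pencil
begin

text \<open>The exponents together with the further information that each case yields: \<open>(3, 4)\<close> belongs to the free
  arrangements, and in all other cases the least degree of a relation is 4.\<close>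

definition outcome :: "nat list \<Rightarrow> bool" where
  "outcome es \<longleftrightarrow> exponents F = es \<and>
     (if es = [3, 4] then \<exists>X. S3.independent X \<and> S3.span X = AR F else mdr F = 4)"

lemma outcome_proper:
  assumes "slopes Os = ideal_gen vs" "list_all2 homogeneous ds vs" "witnessed vs" "sorted ds" "0 \<notin> set ds"
  shows "outcome (4 # map (\<lambda>d. d + 3) ds)"
  using exponents_of_proper_slope_ideal[OF assms] by (simp add: outcome_def)

lemma outcome_unit: "slopes Os = UNIV \<Longrightarrow> outcome [3, 4]"
  using exponents_of_unit_slope_ideal by (simp add: outcome_def)

lemma Os_nonzerodivisor:
  assumes "x \<in> Os" "y \<in> Os" "z \<in> Os" "y \<noteq> z" "\<not> in_span y z x"
  shows "nonzerodivisor_mod y z x"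
  using assms by (intro nonzerodivisor_mod_line Os_distinct_lines Os)

text \<open>Points that lie on exactly one line of \<open>Os\<close>; they are the witnesses in most of the cases below.\<close>

definition general_point :: "spoly \<Rightarrow> complex ^ 3" where
  "general_point y = (SOME x. eval_poly y x = 0 \<and> (\<forall>l\<in>Os - {y}. eval_poly l x \<noteq> 0))"

lemma general_point [simp]:
  assumes "y \<in> Os"
  shows "eval_poly y (general_point y) = 0"
    and "l \<in> Os \<Longrightarrow> l \<noteq> y \<Longrightarrow> eval_poly l (general_point y) \<noteq> 0"
proof -
  have "\<exists>x. eval_poly y x = 0 \<and> (\<forall>l\<in>Os - {y}. eval_poly l x \<noteq> 0)"
    using assms Os by (intro point_on_line_off_lines) (auto intro: Os_distinct_lines)
  from someI_ex[OF this, folded general_point_def]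
  show "eval_poly y (general_point y) = 0" "l \<in> Os \<Longrightarrow> l \<noteq> y \<Longrightarrow> eval_poly l (general_point y) \<noteq> 0"
    by auto
qed

end

text \<open>A labelling of the four lines off \<open>p\<close> such that \<open>d\<close> meets the others in three distinct points. This holds
  for every labelling of lines in general position and, if exactly three lines are concurrent, whenever \<open>d\<close> is the
  fourth.\<close>

locale four_lines = pencil +
  fixes a b c d :: spoly
  assumes Os_eq: "Os = {a, b, c, d}" and distinct: "distinct [a, b, c, d]"
    and transversal: "\<not> in_span a b d" "\<not> in_span a c d" "\<not> in_span b c d"
begin

lemma mem [simp]: "a \<in> Os" "b \<in> Os" "c \<in> Os" "d \<in> Os"
  by (simp_all add: Os_eq)

lemma ne [simp]: "a \<noteq> b" "a \<noteq> c" "a \<noteq> d" "b \<noteq> c" "b \<noteq> d" "c \<noteq> d"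
    "b \<noteq> a" "c \<noteq> a" "d \<noteq> a" "c \<noteq> b" "d \<noteq> b" "d \<noteq> c"
  using distinct by auto

lemma hom1 [simp]: "homogeneous 1 a" "homogeneous 1 b" "homogeneous 1 c" "homogeneous 1 d"
  by (simp_all add: Os)

definition pair :: "spoly \<Rightarrow> spoly \<Rightarrow> spoly set" where
  "pair x y = (if off x y then ideal2 x y else UNIV)"

lemma pair_eq: "x \<in> Os \<Longrightarrow> y \<in> Os \<Longrightarrow> x \<noteq> y \<Longrightarrow> slopes {x, y} = pair x y"
  by (simp add: pair_def slope_ideal_pair)

lemma slope_ideal_star: "slopes Os = slopes {a, b, c} \<inter> (pair a d \<inter> pair b d \<inter> pair c d)"
proof -
  have "slopes (insert d {a, b, c}) = slopes {a, b, c} \<inter> (\<Inter>l\<in>{a, b, c}. slopes {l, d})"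
  proof (rule slope_ideal_insert_transversal)
    show "{a, b, c} \<subseteq> Os" "d \<in> Os" "d \<notin> {a, b, c}" by auto
    show "\<not> in_span l l' d" if "l \<in> {a, b, c}" "l' \<in> {a, b, c}" "l \<noteq> l'" for l l'
      using that transversal transversal[unfolded in_span_sym[of _ _ d]]
        by (metis in_span_sym insertE singletonD)
  qed
  moreover have "insert d {a, b, c} = Os" by (auto simp: Os_eq)
  ultimately show ?thesis by (simp add: pair_eq Int_assoc)
qed

lemma not_in_span_exchange: "\<not> in_span a d b" "\<not> in_span b d a" "\<not> in_span a d c" "\<not> in_span c d a"
    "\<not> in_span b d c" "\<not> in_span c d b"
  using transversal in_span_exchange Os_distinct_lines in_span_sym by (metis mem ne)+

lemma nzd [simp]: "nonzerodivisor_mod a d b" "nonzerodivisor_mod b d a" "nonzerodivisor_mod a d c"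
    "nonzerodivisor_mod c d a" "nonzerodivisor_mod b d c" "nonzerodivisor_mod c d b"
  using not_in_span_exchange by (auto intro!: Os_nonzerodivisor)

lemma ideal_two_on_d: "ideal2 a d \<inter> ideal2 b d = ideal_gen [d, a * b]"
proof -
  have "ideal2 a d \<inter> ideal2 b d = ideal_gen [b * a, d * a, d]"
    unfolding ideal2_eq_ideal_gen[of a d] by (rule ideal_gen_meet) auto
  also have "\<dots> = ideal_gen [d, a * b]"
    by (rule ideal_gen_eqI) (auto intro!: ideal_gen_dvdI simp: mult_ac)
  finally show ?thesis .
qed

lemma ideal_three_on_d: "ideal2 a d \<inter> ideal2 b d \<inter> ideal2 c d = ideal_gen [d, a * b * c]"
proof -
  have "ideal_gen [a * b, d] \<inter> ideal2 c d = ideal_gen [c * (a * b), d * (a * b), d]"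
    by (rule ideal_gen_meet) (auto intro: nonzerodivisor_mod_mult)
  also have "\<dots> = ideal_gen [d, a * b * c]"
    by (rule ideal_gen_eqI) (auto intro!: ideal_gen_dvdI simp: mult_ac)
  also have "ideal_gen [a * b, d] = ideal_gen [d, a * b]" by (rule ideal_gen_eqI) (auto intro!: ideal_gen_dvdI)
  finally show ?thesis unfolding ideal_two_on_d .
qed

lemma outcome_one_point:
  assumes "slopes Os = ideal2 a d"
  shows "outcome [4, 4, 4]"
proof -
  have "witnessed [a, d]" by (rule witnessed_2I[of _ "general_point d" _ "general_point a"]) simp_all
  then show ?thesis
    using outcome_proper[of "[a, d]" "[1, 1]"] assms by (simp add: ideal2_eq_ideal_gen)
qed

lemma outcome_two_on_d:
  assumes "slopes Os = ideal2 a d \<inter> ideal2 b d"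
  shows "outcome [4, 4, 5]"
proof -
  have "witnessed [d, a * b]" by (rule witnessed_2I[of "a * b" "general_point a" d "general_point d"]) simp_all
  then show ?thesis
    using outcome_proper[of "[d, a * b]" "[1, 2]"] assms by (simp add: ideal_two_on_d homogeneous_prod2)
qed

lemma outcome_three_on_d:
  assumes "slopes Os = ideal2 a d \<inter> ideal2 b d \<inter> ideal2 c d"
  shows "outcome [4, 4, 6]"
proof -
  have "witnessed [d, a * b * c]" by (rule witnessed_2I[of _ "general_point a" d "general_point d"]) simp_all
  then show ?thesis
    using outcome_proper[of "[d, a * b * c]" "[1, 3]"] assms by (simp add: ideal_three_on_d homogeneous_prod3)
qed

end

section \<open>Four lines in general position\<close>

text \<open>The slope ideal is the ideal of those of the six intersection points that are off the four lines through \<open>p\<close>.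
  They are regarded as the edges of a graph on \<open>a, b, c, d\<close>. The generators of the ideal are products of lines, one
  for each minimal vertex cover of the graph, with the exception of two disjoint edges, where the line
  through the two points has to be added and makes some of the products redundant. The lemmas treat one graph each, up to relabelling.\<close>

locale generic_lines = four_lines +
  assumes transversal': "\<not> in_span a b c"
begin

lemma slope_ideal_generic:
  "slopes Os = (pair a b \<inter> pair a c \<inter> pair b c) \<inter> (pair a d \<inter> pair b d \<inter> pair c d)"
proof -
  have "slopes (insert c {a, b}) = slopes {a, b} \<inter> (\<Inter>l\<in>{a, b}. slopes {l, c})"
  proof (rule slope_ideal_insert_transversal)
    show "{a, b} \<subseteq> Os" "c \<in> Os" "c \<notin> {a, b}" by auto
    show "\<not> in_span l l' c" if "l \<in> {a, b}" "l' \<in> {a, b}" "l \<noteq> l'" for l l'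
      using that transversal' by (metis in_span_sym insertE singletonD)
  qed
  moreover have "insert c {a, b} = {a, b, c}" by auto
  ultimately have "slopes {a, b, c} = pair a b \<inter> pair a c \<inter> pair b c" by (simp add: pair_eq Int_assoc)
  then show ?thesis unfolding slope_ideal_star by simp
qed

lemma nzd' [simp]: "nonzerodivisor_mod a b c" "nonzerodivisor_mod a b d" "nonzerodivisor_mod a c b"
    "nonzerodivisor_mod a c d" "nonzerodivisor_mod b c a" "nonzerodivisor_mod b c d"
proof -
  have "\<not> in_span a c b" "\<not> in_span b c a"
    using transversal' in_span_exchange Os_distinct_lines in_span_sym by (metis mem ne)+
  then show "nonzerodivisor_mod a b c" "nonzerodivisor_mod a b d" "nonzerodivisor_mod a c b"
    "nonzerodivisor_mod a c d" "nonzerodivisor_mod b c a" "nonzerodivisor_mod b c d"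
    using transversal transversal' by (auto intro!: Os_nonzerodivisor)
qed

text \<open>The line \<open>m\<close> joins the two points; it is a combination of \<open>a\<close> and \<open>b\<close> as well as of \<open>c\<close> and \<open>d\<close>.\<close>

lemma outcome_two_disjoint:
  assumes "slopes Os = ideal2 a b \<inter> ideal2 c d"
  shows "outcome [4, 4, 5]"
proof -
  obtain w where w: "w \<noteq> 0" "eval_poly c w = 0" "eval_poly d w = 0"
    using common_zero_exists[OF Os_distinct_lines, of c d] by auto
  have aw: "eval_poly a w \<noteq> 0" and bw: "eval_poly b w \<noteq> 0"
    using in_span_if_common_zero[OF Os_distinct_lines w, of a] in_span_if_common_zero[OF Os_distinct_lines w, of b]
      not_in_span_exchange by auto
  define m where "m = Const (eval_poly a w) * b - Const (eval_poly b w) * a"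
  have hm: "homogeneous 1 m" unfolding m_def by (intro homogeneous_diff homogeneous_Const_mult hom1)
  have "eval_poly m w = 0" by (simp add: m_def)
  then obtain s t where st: "m = Const s * c + Const t * d"
    using in_span_if_common_zero[OF Os_distinct_lines w hm] by (auto simp: in_span_def)
  have b: "b = Const (1 / eval_poly a w) * m + Const (eval_poly b w / eval_poly a w) * a"
    using aw by (simp add: m_def right_diff_distrib mult.assoc[symmetric] Const_mult[symmetric])
  have am: "distinct_lines m a"
    unfolding distinct_lines_def
  proof (intro conjI allI notI)
    show "homogeneous 1 m" "homogeneous 1 a" by (simp_all add: hm)
    have nb: "b \<noteq> Const k * a" for k using Os_distinct_lines[of a b] by (simp add: distinct_lines_def)
    show "a = 0 \<Longrightarrow> False" using Os_nz[of a] by simp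
    show "m = 0 \<Longrightarrow> False" using b nb[of "eval_poly b w / eval_poly a w"] by simp
    fix k assume k: "a = Const k * m"
    have "k \<noteq> 0" using k Os_nz[OF mem(1)] by auto
    then have mk: "m = Const (1 / k) * a" using k by (simp add: mult.assoc[symmetric] Const_mult[symmetric])
    have "b = Const (1 / eval_poly a w * (1 / k) + eval_poly b w / eval_poly a w) * a"
      by (subst b) (simp only: mk Const_add Const_mult distrib_right mult.assoc)
    then show False using nb by blast
  qed
  have mc: "distinct_lines m c"
    unfolding distinct_lines_def
  proof (intro conjI allI notI)
    show "homogeneous 1 m" "homogeneous 1 c" by (simp_all add: hm)
    show "c = 0 \<Longrightarrow> False" using Os_nz[of c] by simp
    show "m = 0 \<Longrightarrow> False" using am by (simp add: distinct_lines_def)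
    fix k assume "c = Const k * m"
    then have "c = Const (- (k * eval_poly b w)) * a + Const (k * eval_poly a w) * b"
      by (simp add: m_def algebra_simps Const_minus Const_mult)
    then show False using transversal' unfolding in_span_def by blast
  qed
  have "t \<noteq> 0"
  proof
    assume "t = 0"
    then have "m = Const s * c" using st by simp
    then show False using distinct_lines_sym[OF mc] by (simp add: distinct_lines_def)
  qed
  then have "d = Const (1 / t) * (Const t * d)" by (simp add: mult.assoc[symmetric] Const_mult[symmetric])
  also have "Const t * d = m - Const s * c" using st by simp
  finally have d: "d = Const (1 / t) * (m - Const s * c)" .
  have "ideal2 a b = ideal_gen [a, m]"
    unfolding ideal2_eq_ideal_gen
  proof (rule ideal_gen_eqI)
    have "b \<in> ideal_gen [a, m]"
      by (subst b) (intro ideal_gen_add ideal_gen_mult ideal_gen_base; simp)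
    then show "g \<in> ideal_gen [a, m]" if "g \<in> set [a, b]" for g
      using that by (auto intro: ideal_gen_base)
    have "m \<in> ideal_gen [a, b]"
      unfolding m_def by (intro ideal_gen_diff ideal_gen_mult ideal_gen_base; simp)
    then show "g \<in> ideal_gen [a, b]" if "g \<in> set [a, m]" for g
      using that by (auto intro: ideal_gen_base)
  qed
  moreover have "ideal_gen [a, m] \<inter> ideal2 c d = ideal_gen [c * a, d * a, m]"
  proof (rule ideal_gen_meet)
    fix x assume "x \<in> set [m]"
    then show "x \<in> ideal2 c d" unfolding ideal2_def using st by auto
  qed simp
  moreover have "\<dots> = ideal_gen [m, a * c]"
  proof (rule ideal_gen_eqI)
    have "d * a = Const (1 / t) * a * m - Const (1 / t) * Const s * (a * c)"
      by (subst d) (simp add: algebra_simps)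
    then have "d * a \<in> ideal_gen [m, a * c]"
      by (simp only:) (intro ideal_gen_diff ideal_gen_mult ideal_gen_base; simp)
    moreover have "c * a \<in> ideal_gen [m, a * c]" "m \<in> ideal_gen [m, a * c]"
      by (intro ideal_gen_dvdI; simp add: mult.commute)+
    ultimately show "g \<in> ideal_gen [m, a * c]" if "g \<in> set [c * a, d * a, m]" for g
      using that by auto
    show "g \<in> ideal_gen [c * a, d * a, m]" if "g \<in> set [m, a * c]" for g
      using that by (auto intro!: ideal_gen_dvdI simp: mult_ac)
  qed
  ultimately have I: "slopes Os = ideal_gen [m, a * c]" using assms by simp
  obtain x where x: "eval_poly a x = 0" "eval_poly m x \<noteq> 0"
    using point_on_line_off_line[OF distinct_lines_sym[OF am]] .
  obtain y where y: "eval_poly m y = 0" "eval_poly a y \<noteq> 0" "eval_poly c y \<noteq> 0"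
    using point_on_line_off_lines[of "{a, c}" m] hm am mc by auto
  have "witnessed [m, a * c]" by (rule witnessed_2I[of _ x _ y]) (simp_all add: x y)
  then show ?thesis
    using outcome_proper[OF I, of "[1, 2]"] hm by (simp add: homogeneous_prod2)
qed

lemma outcome_triangle:
  assumes "slopes Os = ideal2 a b \<inter> ideal2 a c \<inter> ideal2 b c"
  shows "outcome [4, 5, 5, 5]"
proof -
  have "ideal2 a b \<inter> ideal2 a c = ideal_gen [a * b, c * b, a]"
    unfolding ideal2_eq_ideal_gen'[of a b] by (rule ideal_gen_meet) auto
  also have "\<dots> = ideal_gen [a, b * c]"
    by (rule ideal_gen_eqI) (auto intro!: ideal_gen_dvdI simp: mult_ac)
  also have "\<dots> \<inter> ideal2 b c = ideal_gen [b * a, c * a, b * c]"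
    by (rule ideal_gen_meet) auto
  finally have I: "slopes Os = ideal_gen [b * a, c * a, b * c]" using assms by simp
  have "witnessed [b * a, c * a, b * c]" by (rule witnessed_3I[of _ "general_point c" _ _ "general_point b" "general_point a"]) simp_all
  then show ?thesis
    using outcome_proper[OF I, of "[2, 2, 2]"] by (simp add: homogeneous_prod2)
qed

text \<open>The generator \<open>c b\<close> has its witness in a vertex of the configuration, the point \<open>a = d = 0\<close>; on a general point
  of any of the four lines one of the other two generators is non-zero or \<open>c b\<close> vanishes.\<close>

lemma outcome_path:
  assumes "slopes Os = ideal2 a b \<inter> ideal2 b c \<inter> ideal2 c d"
  shows "outcome [4, 5, 5, 5]"
proof -
  have "ideal2 a b \<inter> ideal2 b c = ideal_gen [b * a, c * a, b]"
    unfolding ideal2_eq_ideal_gen[of a b] by (rule ideal_gen_meet) auto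
  also have "\<dots> = ideal_gen [b, a * c]"
    by (rule ideal_gen_eqI) (auto intro!: ideal_gen_dvdI simp: mult_ac)
  also have "\<dots> \<inter> ideal2 c d = ideal_gen [c * b, d * b, a * c]"
    by (rule ideal_gen_meet) auto
  finally have I: "slopes Os = ideal_gen [c * b, d * b, a * c]" using assms by simp
  obtain z where z: "z \<noteq> 0" "eval_poly a z = 0" "eval_poly d z = 0"
    using common_zero_exists[OF Os_distinct_lines, of a d] by auto
  have "eval_poly b z \<noteq> 0" "eval_poly c z \<noteq> 0"
    using in_span_if_common_zero[OF Os_distinct_lines z, of b] in_span_if_common_zero[OF Os_distinct_lines z, of c]
      not_in_span_exchange by auto
  then have "witnessed [c * b, d * b, a * c]"
    by (intro witnessed_3I[of _ z _ _ "general_point c" "general_point b"]) (simp_all add: z)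
  then show ?thesis
    using outcome_proper[OF I, of "[2, 2, 2]"] by (simp add: homogeneous_prod2)
qed

lemma ideal_cycle: "ideal2 a c \<inter> ideal2 a d \<inter> ideal2 b c \<inter> ideal2 b d = ideal_gen [a * b, c * d]"
proof -
  have "ideal2 a c \<inter> ideal2 a d = ideal_gen [a * c, d * c, a]"
    unfolding ideal2_eq_ideal_gen'[of a c] by (rule ideal_gen_meet) auto
  also have "\<dots> = ideal_gen [a, c * d]"
    by (rule ideal_gen_eqI) (auto intro!: ideal_gen_dvdI simp: mult_ac)
  also have "\<dots> \<inter> ideal2 b c = ideal_gen [b * a, c * a, c * d]"
    by (rule ideal_gen_meet) auto
  also have "\<dots> = ideal_gen [c * a, b * a, c * d]"
    by (rule ideal_gen_eqI) (auto intro!: ideal_gen_dvdI)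
  also have "\<dots> \<inter> ideal2 b d = ideal_gen [b * (c * a), d * (c * a), b * a, c * d]"
    by (rule ideal_gen_meet) (auto intro: nonzerodivisor_mod_mult)
  also have "\<dots> = ideal_gen [a * b, c * d]"
    by (rule ideal_gen_eqI) (auto intro!: ideal_gen_dvdI simp: mult_ac)
  finally show ?thesis .
qed

lemma outcome_cycle:
  assumes "slopes Os = ideal2 a c \<inter> ideal2 a d \<inter> ideal2 b c \<inter> ideal2 b d"
  shows "outcome [4, 5, 5]"
proof -
  have I: "slopes Os = ideal_gen [a * b, c * d]" using assms ideal_cycle by simp
  have "witnessed [a * b, c * d]" by (rule witnessed_2I[of _ "general_point c" _ "general_point a"]) simp_all
  then show ?thesis
    using outcome_proper[OF I, of "[2, 2]"] by (simp add: homogeneous_prod2)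
qed

lemma outcome_paw:
  assumes "slopes Os = ideal2 a d \<inter> ideal2 b d \<inter> ideal2 c d \<inter> ideal2 b c"
  shows "outcome [4, 5, 5, 6]"
proof -
  have "ideal_gen [d, a * b * c] \<inter> ideal2 b c = ideal_gen [b * d, c * d, a * b * c]"
    by (rule ideal_gen_meet) auto
  then have I: "slopes Os = ideal_gen [b * d, c * d, a * b * c]" using assms ideal_three_on_d by simp
  have "witnessed [b * d, c * d, a * b * c]"
    by (rule witnessed_3I[of _ "general_point c" _ _ "general_point b" "general_point d"]) simp_all
  then show ?thesis
    using outcome_proper[OF I, of "[2, 2, 3]"] by (simp add: homogeneous_prod2 homogeneous_prod3)
qed

lemma ideal_five: "ideal2 a c \<inter> ideal2 a d \<inter> ideal2 b c \<inter> ideal2 b d \<inter> ideal2 c d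
    = ideal_gen [c * d, a * b * c, a * b * d]"
proof -
  have "ideal_gen [a * b, c * d] \<inter> ideal2 c d = ideal_gen [c * (a * b), d * (a * b), c * d]"
    by (rule ideal_gen_meet) (auto intro: nonzerodivisor_mod_mult)
  also have "\<dots> = ideal_gen [c * d, a * b * c, a * b * d]"
    by (rule ideal_gen_eqI) (auto intro!: ideal_gen_dvdI simp: mult_ac)
  finally show ?thesis unfolding ideal_cycle .
qed

lemma outcome_five:
  assumes "slopes Os = ideal2 a c \<inter> ideal2 a d \<inter> ideal2 b c \<inter> ideal2 b d \<inter> ideal2 c d"
  shows "outcome [4, 5, 6, 6]"
proof -
  have I: "slopes Os = ideal_gen [c * d, a * b * c, a * b * d]" using assms ideal_five by simp
  have "witnessed [c * d, a * b * c, a * b * d]"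
    by (rule witnessed_3I[of _ "general_point a" _ _ "general_point d" "general_point c"]) simp_all
  then show ?thesis
    using outcome_proper[OF I, of "[2, 3, 3]"] by (simp add: homogeneous_prod2 homogeneous_prod3)
qed

lemma outcome_six:
  assumes "slopes Os = ideal2 a c \<inter> ideal2 a d \<inter> ideal2 b c \<inter> ideal2 b d \<inter> ideal2 c d \<inter> ideal2 a b"
  shows "outcome [4, 6, 6, 6, 6]"
proof -
  have "ideal_gen [c * d, a * b * c, a * b * d] \<inter> ideal2 a b = ideal_gen [a * (c * d), b * (c * d), a * b * c, a * b * d]"
    by (rule ideal_gen_meet) (auto intro: nonzerodivisor_mod_mult)
  also have "\<dots> = ideal_gen [a * c * d, b * c * d, a * b * c, a * b * d]" by (simp add: mult.assoc)
  finally have I: "slopes Os = ideal_gen [a * c * d, b * c * d, a * b * c, a * b * d]"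
    using assms ideal_five by simp
  have "witnessed [a * c * d, b * c * d, a * b * c, a * b * d]"
    unfolding witnessed_4
    by (intro conjI exI[of _ "general_point b"] exI[of _ "general_point a"] exI[of _ "general_point d"] exI[of _ "general_point c"]) simp_all
  then show ?thesis
    using outcome_proper[OF I, of "[3, 3, 3, 3]"] by (simp add: homogeneous_prod3)
qed

end

section \<open>Three or four concurrent lines\<close>

text \<open>Three concurrent lines \<open>a\<close>, \<open>b\<close>, \<open>c\<close> meeting off the four lines through \<open>p\<close>. The line \<open>m\<close> joins their common
  point to \<open>p\<close>, and the slope ideal of the three lines is that of the tangent direction \<open>m\<close> there.\<close>

locale triple_off = four_lines +
  assumes concurrent: "in_span a b c" and off_ab: "off a b"
begin

definition m :: spoly where "m = b - a"

lemmas m_facts = pencil_difference[OF mem(1,2) ne(1), folded m_def]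

lemma differences_dvd: "m dvd b - a" "m dvd c - a"
proof -
  show "m dvd b - a" by (simp add: m_def)
  obtain t where "c = a + Const t * (b - a)" using pencil_member[OF mem(1,2) ne(1) mem(3) concurrent] by blast
  then show "m dvd c - a" by (simp add: m_def)
qed

lemma slope_ideal_triple: "slopes {a, b, c} = ideal_gen [m, a * b]"
proof -
  have "slopes {a, b, c} = ideal2 m (a ^ 2)"
    unfolding m_def using off_ab concurrent in_span_self
    by (intro slope_ideal_concurrent_off) auto
  also have "\<dots> = ideal_gen [m, a * b]"
    unfolding ideal2_eq_ideal_gen
  proof (rule ideal_gen_eqI)
    have sq: "a ^ 2 = a * b - a * m" by (simp add: m_def power2_eq_square algebra_simps)
    have "a ^ 2 \<in> ideal_gen [m, a * b]"
      unfolding sq by (intro ideal_gen_diff ideal_gen_mult ideal_gen_base; simp)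
    then show "g \<in> ideal_gen [m, a * b]" if "g \<in> set [m, a ^ 2]" for g
      using that by (auto intro: ideal_gen_base)
    have ab: "a * b = a ^ 2 + a * m" by (simp add: m_def power2_eq_square algebra_simps)
    have "a * b \<in> ideal_gen [m, a ^ 2]"
      unfolding ab by (intro ideal_gen_add ideal_gen_mult ideal_gen_base; simp)
    then show "g \<in> ideal_gen [m, a ^ 2]" if "g \<in> set [m, a * b]" for g
      using that by (auto intro: ideal_gen_base)
  qed
  finally show ?thesis .
qed

lemma m_lin: "homogeneous 1 m" and m_nz: "m \<noteq> 0" and m_p: "eval_poly m p = 0"
  using m_facts by auto

lemma m_distinct: "x \<in> Os \<Longrightarrow> distinct_lines m x"
  using pencil_Os_distinct_lines[OF m_lin m_nz m_p] .

lemma eval_cong: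
  assumes "eval_poly m z = 0"
  shows "eval_poly b z = eval_poly a z" "eval_poly c z = eval_poly a z"
proof -
  obtain k k' where "b - a = m * k" "c - a = m * k'" using differences_dvd by (auto elim!: dvdE)
  then have "eval_poly (b - a) z = 0" "eval_poly (c - a) z = 0" using assms by simp_all
  then show "eval_poly b z = eval_poly a z" "eval_poly c z = eval_poly a z" by simp_all
qed

lemma m_not_in_span: "\<not> in_span a d m" "\<not> in_span b d m"
proof -
  obtain z where z: "z \<noteq> 0" "eval_poly a z = 0" "eval_poly d z = 0"
    using common_zero_exists[OF Os_distinct_lines, of a d] by auto
  have "eval_poly b z \<noteq> 0"
    using in_span_if_common_zero[OF Os_distinct_lines z, of b] not_in_span_exchange by auto
  then have "eval_poly m z \<noteq> 0" using eval_cong z by auto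
  then show "\<not> in_span a d m" using in_span_zero z by blast
  obtain z' where z': "z' \<noteq> 0" "eval_poly b z' = 0" "eval_poly d z' = 0"
    using common_zero_exists[OF Os_distinct_lines, of b d] by auto
  have "eval_poly a z' \<noteq> 0"
    using in_span_if_common_zero[OF Os_distinct_lines z', of a] not_in_span_exchange by auto
  then have "eval_poly m z' \<noteq> 0" using eval_cong z' by auto
  then show "\<not> in_span b d m" using in_span_zero z' by blast
qed

lemma nzd_m [simp]: "nonzerodivisor_mod a d m" "nonzerodivisor_mod b d m"
  using m_not_in_span by (auto intro!: nonzerodivisor_mod_line Os_distinct_lines m_lin)

lemma point_on_m:
  obtains y where "eval_poly m y = 0" "eval_poly a y \<noteq> 0" "eval_poly b y \<noteq> 0" "eval_poly c y \<noteq> 0" "eval_poly d y \<noteq> 0"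
proof -
  have "\<exists>y. eval_poly m y = 0 \<and> (\<forall>l\<in>Os. eval_poly l y \<noteq> 0)"
    using Os(1) m_lin m_distinct by (intro point_on_line_off_lines) auto
  then show ?thesis using that by (auto simp: Os_eq)
qed

lemma point_on_a:
  obtains x where "eval_poly a x = 0" "eval_poly m x \<noteq> 0" "eval_poly d x \<noteq> 0"
  using point_on_line_off_lines[of "{m, d}" a] distinct_lines_sym[OF m_distinct[of a]] Os_distinct_lines[of a d] that
  by auto

lemma outcome_tangent:
  assumes "slopes Os = slopes {a, b, c}"
  shows "outcome [4, 4, 5]"
proof -
  have I: "slopes Os = ideal_gen [m, a * b]" using assms slope_ideal_triple by simp
  obtain y where y: "eval_poly m y = 0" "eval_poly a y \<noteq> 0" "eval_poly b y \<noteq> 0" using point_on_m by blast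
  obtain x where x: "eval_poly a x = 0" "eval_poly m x \<noteq> 0" using point_on_a by blast
  have "witnessed [m, a * b]" by (rule witnessed_2I[of _ x _ y]) (simp_all add: x y)
  then show ?thesis using outcome_proper[OF I, of "[1, 2]"] by (simp add: homogeneous_prod2 m_lin)
qed

lemma ideal_tangent_one: "slopes {a, b, c} \<inter> ideal2 a d = ideal_gen [a * m, d * m, a * b]"
  unfolding slope_ideal_triple by (rule ideal_gen_meet) auto

text \<open>The witness of \<open>a m\<close> is the point where \<open>b\<close> and \<open>d\<close> meet; it is not on \<open>m\<close>, since on \<open>m\<close> the forms \<open>a\<close>, \<open>b\<close>, \<open>c\<close>
  take the same value.\<close>

lemma outcome_tangent_one:
  assumes "slopes Os = slopes {a, b, c} \<inter> ideal2 a d"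
  shows "outcome [4, 5, 5, 5]"
proof -
  have I: "slopes Os = ideal_gen [a * m, d * m, a * b]" using assms ideal_tangent_one by simp
  obtain y where y: "eval_poly m y = 0" "eval_poly a y \<noteq> 0" "eval_poly b y \<noteq> 0" using point_on_m by blast
  obtain x where x: "eval_poly a x = 0" "eval_poly m x \<noteq> 0" "eval_poly d x \<noteq> 0" using point_on_a by blast
  obtain z where z: "z \<noteq> 0" "eval_poly b z = 0" "eval_poly d z = 0"
    using common_zero_exists[OF Os_distinct_lines, of b d] by auto
  have za: "eval_poly a z \<noteq> 0"
    using in_span_if_common_zero[OF Os_distinct_lines z, of a] not_in_span_exchange by auto
  then have zm: "eval_poly m z \<noteq> 0" using eval_cong z by auto
  have "witnessed [a * m, d * m, a * b]" by (rule witnessed_3I[of _ z _ _ x y]) (simp_all add: x y z za zm)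
  then show ?thesis using outcome_proper[OF I, of "[2, 2, 2]"] by (simp add: homogeneous_prod2 m_lin)
qed

lemma ideal_tangent_two: "slopes {a, b, c} \<inter> ideal2 a d \<inter> ideal2 b d = ideal_gen [d * m, a * b]"
proof -
  have "ideal_gen [a * m, d * m, a * b] \<inter> ideal2 b d = ideal_gen [b * (a * m), d * (a * m), d * m, a * b]"
    by (rule ideal_gen_meet) (auto intro: nonzerodivisor_mod_mult)
  also have "\<dots> = ideal_gen [d * m, a * b]"
    by (rule ideal_gen_eqI) (auto intro!: ideal_gen_dvdI simp: mult_ac)
  finally show ?thesis unfolding ideal_tangent_one .
qed

lemma outcome_tangent_two:
  assumes "slopes Os = slopes {a, b, c} \<inter> ideal2 a d \<inter> ideal2 b d"
  shows "outcome [4, 5, 5]"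
proof -
  have I: "slopes Os = ideal_gen [d * m, a * b]" using assms ideal_tangent_two by simp
  obtain y where y: "eval_poly m y = 0" "eval_poly a y \<noteq> 0" "eval_poly b y \<noteq> 0" using point_on_m by blast
  obtain x where x: "eval_poly a x = 0" "eval_poly m x \<noteq> 0" "eval_poly d x \<noteq> 0" using point_on_a by blast
  have "witnessed [d * m, a * b]" by (rule witnessed_2I[of _ x _ y]) (simp_all add: x y)
  then show ?thesis using outcome_proper[OF I, of "[2, 2]"] by (simp add: homogeneous_prod2 m_lin)
qed

text \<open>The third generator is \<open>a b (c + d)\<close> instead of \<open>a b c\<close> so that \<open>a b d\<close> has a witness: the point where \<open>m\<close> and
  \<open>c + d\<close> meet, which differs from the common point of \<open>a, b, c\<close> because \<open>d\<close> does not pass through the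
  latter.\<close>

lemma outcome_tangent_three:
  assumes "slopes Os = slopes {a, b, c} \<inter> ideal2 a d \<inter> ideal2 b d \<inter> ideal2 c d"
  shows "outcome [4, 5, 6, 6]"
proof -
  let ?q = "c + d"
  have "ideal_gen [a * b, d * m] \<inter> ideal2 c d = ideal_gen [c * (a * b), d * (a * b), d * m]"
    by (rule ideal_gen_meet) (auto intro: nonzerodivisor_mod_mult)
  also have "\<dots> = ideal_gen [d * m, a * b * d, a * b * ?q]"
  proof (rule ideal_gen_eqI)
    fix g assume g: "g \<in> set [c * (a * b), d * (a * b), d * m]"
    have "a * b * ?q - a * b * d \<in> ideal_gen [d * m, a * b * d, a * b * ?q]"
      by (intro ideal_gen_diff ideal_gen_base; simp)
    moreover have "a * b * ?q - a * b * d = c * (a * b)" by (simp add: algebra_simps)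
    ultimately have "c * (a * b) \<in> ideal_gen [d * m, a * b * d, a * b * ?q]" by simp
    moreover have "d * (a * b) \<in> ideal_gen [d * m, a * b * d, a * b * ?q]"
      "d * m \<in> ideal_gen [d * m, a * b * d, a * b * ?q]"
      by (intro ideal_gen_dvdI; simp add: mult_ac)+
    ultimately show "g \<in> ideal_gen [d * m, a * b * d, a * b * ?q]" using g by auto
  next
    fix g assume g: "g \<in> set [d * m, a * b * d, a * b * ?q]"
    have "c * (a * b) + d * (a * b) \<in> ideal_gen [c * (a * b), d * (a * b), d * m]"
      by (intro ideal_gen_add ideal_gen_base; simp)
    moreover have "c * (a * b) + d * (a * b) = a * b * ?q" by (simp add: algebra_simps)
    ultimately have "a * b * ?q \<in> ideal_gen [c * (a * b), d * (a * b), d * m]" by simp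
    moreover have "a * b * d \<in> ideal_gen [c * (a * b), d * (a * b), d * m]"
      "d * m \<in> ideal_gen [c * (a * b), d * (a * b), d * m]"
      by (intro ideal_gen_dvdI; simp add: mult_ac)+
    ultimately show "g \<in> ideal_gen [c * (a * b), d * (a * b), d * m]" using g by auto
  qed
  also have "ideal_gen [a * b, d * m] = ideal_gen [d * m, a * b]"
    by (rule ideal_gen_eqI) (auto intro!: ideal_gen_base)
  finally have I: "slopes Os = ideal_gen [d * m, a * b * d, a * b * ?q]"
    using assms ideal_tangent_two by simp
  have q_lin: "homogeneous 1 ?q" by (intro homogeneous_add hom1)
  obtain x where x: "eval_poly a x = 0" "eval_poly m x \<noteq> 0" "eval_poly d x \<noteq> 0" using point_on_a by blast
  have "distinct_lines m ?q"
    unfolding distinct_lines_def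
  proof (intro conjI allI notI m_lin q_lin)
    have qp: "eval_poly ?q p = 2" using Os(4)[of c] Os(4)[of d] by simp
    show "m = 0 \<Longrightarrow> False" using m_nz by simp
    show "?q = 0 \<Longrightarrow> False" using qp by (metis eval_0 zero_neq_numeral)
    fix k assume "?q = Const k * m"
    then have "eval_poly ?q p = eval_poly (Const k * m) p" by (rule arg_cong)
    then show False using qp m_p by simp
  qed
  then obtain z where z: "z \<noteq> 0" "eval_poly m z = 0" "eval_poly ?q z = 0"
    using common_zero_exists by blast
  have zs: "eval_poly b z = eval_poly a z" "eval_poly c z = eval_poly a z" using eval_cong z by auto
  then have zd: "eval_poly d z = - eval_poly a z" using z(3) by (simp add: eq_neg_iff_add_eq_0 add.commute)
  have za: "eval_poly a z \<noteq> 0"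
  proof
    assume "eval_poly a z = 0"
    then have "in_span a b d"
      using in_span_if_common_zero[OF Os_distinct_lines z(1), of a b d] zs zd by auto
    then show False using transversal by simp
  qed
  have "witnessed [d * m, a * b * d, a * b * ?q]"
  proof (rule witnessed_3I[of _ x _ _ z "general_point d"])
    show "eval_poly (a * b * ?q) z = 0" using z(3) by (simp del: eval_add)
  qed (use x z zs zd za in simp_all)
  then show ?thesis
    using outcome_proper[OF I, of "[2, 3, 3]"]
    by (simp add: homogeneous_prod2 homogeneous_prod3 m_lin q_lin)
qed

end

context pencil
begin

lemma outcome_four_concurrent:
  assumes Os_eq: "Os = {a, b, c, d}" and dist: "distinct [a, b, c, d]"
    and con: "in_span a b c" "in_span a b d" and off: "off a b"
  shows "outcome [4, 4, 6]"
proof -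
  have O: "a \<in> Os" "b \<in> Os" "a \<noteq> b" using Os_eq dist by auto
  define m where "m = b - a"
  note pd = pencil_difference[OF O, folded m_def]
  have "slopes Os = ideal2 m (a ^ 3)"
    unfolding m_def using O off Os(2) in_span_self con by (intro slope_ideal_concurrent_off) (auto simp: Os_eq)
  then have I: "slopes Os = ideal_gen [m, a ^ 3]" by (simp add: ideal2_eq_ideal_gen)
  obtain x where x: "eval_poly a x = 0" "eval_poly m x \<noteq> 0"
    using point_on_line_off_line[OF distinct_lines_sym[OF pd(1)]] .
  obtain y where y: "eval_poly m y = 0" "eval_poly a y \<noteq> 0" using point_on_line_off_line[OF pd(1)] .
  have "witnessed [m, a ^ 3]" by (rule witnessed_2I[of _ x _ y]) (simp_all add: x y)
  moreover have "homogeneous 3 (a ^ 3)"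
    using homogeneous_prod3[of a a a] Os(3)[OF O(1)] by (simp add: power3_eq_cube)
  ultimately show ?thesis using outcome_proper[OF I, of "[1, 3]"] pd(4) by simp
qed

end

section \<open>Counting points\<close>

lemma vanishes_on_span:
  assumes "homogeneous 1 l"
  shows "(\<forall>v\<in>vec.span {q}. eval_poly l v = 0) \<longleftrightarrow> eval_poly l q = 0"
proof
  assume "\<forall>v\<in>vec.span {q}. eval_poly l v = 0"
  moreover have "q \<in> vec.span {q}" by (rule vec.span_base) simp
  ultimately show "eval_poly l q = 0" by blast
next
  assume "eval_poly l q = 0"
  then show "\<forall>v\<in>vec.span {q}. eval_poly l v = 0"
    using eval_linear_scale[OF assms] by (auto simp: vec.span_singleton)
qed

definition pt :: "spoly \<Rightarrow> spoly \<Rightarrow> (complex ^ 3) set" where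
  "pt l l' = vec.span {cross l l'}"

lemma cross_zero:
  assumes "homogeneous 1 l" "homogeneous 1 l'"
  shows "eval_poly l (cross l l') = 0" "eval_poly l' (cross l l') = 0"
  by (simp_all add: eval_linear3[OF assms(1)] eval_linear3[OF assms(2)] cross_def algebra_simps)

lemma pt_in_proj_plane: "distinct_lines l l' \<Longrightarrow> pt l l' \<in> proj_plane"
  using cross_nonzero by (auto simp: pt_def proj_plane_def)

lemma pt_eq_span:
  assumes "distinct_lines l l'" "q \<noteq> 0" "eval_poly l q = 0" "eval_poly l' q = 0"
  shows "vec.span {q} = pt l l'"
proof -
  have h: "homogeneous 1 l" "homogeneous 1 l'" using assms by (auto simp: distinct_lines_def)
  obtain c where c: "q = c *s cross l l'"
    using common_zero_unique[OF assms(1) cross_nonzero[OF assms(1)] cross_zero[OF h] assms(3,4)] .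
  obtain c' where c': "cross l l' = c' *s q"
    using common_zero_unique[OF assms(1,2,3,4) cross_zero[OF h]] .
  have "vec.span {q} \<subseteq> vec.span {cross l l'}"
    by (rule vec.span_minimal) (auto simp: c intro: vec.span_scale vec.span_base)
  moreover have "vec.span {cross l l'} \<subseteq> vec.span {q}"
    by (rule vec.span_minimal) (auto simp: c' intro: vec.span_scale vec.span_base)
  ultimately show ?thesis by (simp add: pt_def)
qed

lemma mult_at_span:
  assumes "\<And>l. l \<in> X \<Longrightarrow> homogeneous 1 l"
  shows "mult_at X (vec.span {q}) = card {l \<in> X. eval_poly l q = 0}"
  unfolding mult_at_def by (rule arg_cong[of _ _ card]) (use vanishes_on_span assms in blast)

lemma cross_zero_iff_in_span:
  assumes "distinct_lines l l'" "homogeneous 1 x"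
  shows "eval_poly x (cross l l') = 0 \<longleftrightarrow> in_span l l' x"
proof -
  have h: "homogeneous 1 l" "homogeneous 1 l'" using assms by (auto simp: distinct_lines_def)
  show ?thesis
    using in_span_if_common_zero[OF assms(1) cross_nonzero[OF assms(1)] cross_zero[OF h] assms(2)]
      in_span_zero cross_zero[OF h] by blast
qed

lemma pt_eq_in_span:
  assumes "distinct_lines x y" "distinct_lines z w" "pt x y = pt z w"
  shows "in_span x y z" "in_span x y w"
proof -
  have h: "homogeneous 1 z" "homogeneous 1 w" using assms by (auto simp: distinct_lines_def)
  have "\<forall>v\<in>pt x y. eval_poly z v = 0" "\<forall>v\<in>pt x y. eval_poly w v = 0"
    unfolding assms(3) unfolding pt_def using vanishes_on_span[OF h(1)] vanishes_on_span[OF h(2)] cross_zero[OF h] by blast+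
  then have "eval_poly z (cross x y) = 0" "eval_poly w (cross x y) = 0"
    by (auto simp: pt_def intro: vec.span_base)
  then show "in_span x y z" "in_span x y w" using cross_zero_iff_in_span[OF assms(1)] h by auto
qed

lemma pt_eq_if_in_span:
  assumes "distinct_lines x y" "distinct_lines x z" "in_span x y z"
  shows "pt x z = pt x y"
proof -
  have h: "homogeneous 1 x" "homogeneous 1 y" using assms by (auto simp: distinct_lines_def)
  have "eval_poly z (cross x y) = 0" using assms(3) in_span_zero cross_zero[OF h] by blast
  then have "vec.span {cross x y} = pt x z"
    by (intro pt_eq_span assms(2) cross_nonzero[OF assms(1)] cross_zero h)
  then show ?thesis by (simp add: pt_def)
qed

lemma pt_sym: "distinct_lines x y \<Longrightarrow> pt y x = pt x y"
proof -
  assume d: "distinct_lines x y"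
  then have h: "homogeneous 1 x" "homogeneous 1 y" by (auto simp: distinct_lines_def)
  have "vec.span {cross x y} = pt y x"
    by (intro pt_eq_span distinct_lines_sym[OF d] cross_nonzero[OF d] cross_zero h)
  then show ?thesis by (simp add: pt_def)
qed

lemma line_arrangement_distinct_lines:
  "line_arrangement A \<Longrightarrow> x \<in> A \<Longrightarrow> y \<in> A \<Longrightarrow> x \<noteq> y \<Longrightarrow> distinct_lines x y"
  by (auto simp: line_arrangement_def distinct_lines_def pairwise_def)

text \<open>Two distinct lines meet in one point, and a point of multiplicity \<open>k\<close> is the meeting point of
  \<open>k (k - 1)\<close> ordered pairs.\<close>

theorem pair_count:
  assumes A: "line_arrangement A"
  shows "(\<Sum>k = 2..card A. num_points A k * (k * (k - 1))) = card A * (card A - 1)"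
proof -
  have fin: "finite A" and lin: "\<And>l. l \<in> A \<Longrightarrow> homogeneous 1 l" using A by (auto simp: line_arrangement_def)
  have dl: "distinct_lines x y" if "x \<in> A" "y \<in> A" "x \<noteq> y" for x y
    using line_arrangement_distinct_lines[OF A] that by blast
  define P where "P = (SIGMA x:A. A - {x})"
  have finP: "finite P" using fin by (simp add: P_def)
  have cardS: "card (SIGMA x:X. X - {x}) = card X * (card X - 1)" if "finite X" for X :: "spoly set"
    using that by (simp add: card_SigmaI)
  define f where "f = (\<lambda>(x, y). pt x y)"
  define A' where "A' Q = {l \<in> A. \<forall>v\<in>Q. eval_poly l v = 0}" for Q
  have mA': "mult_at A Q = card (A' Q)" for Q by (simp add: mult_at_def A'_def)
  have fib: "f (x, y) = Q \<longleftrightarrow> x \<in> A' Q \<and> y \<in> A' Q" if xy: "x \<in> A" "y \<in> A" "x \<noteq> y"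
    and Q: "Q \<in> proj_plane" for x y Q
  proof -
    obtain q where q: "q \<noteq> 0" "Q = vec.span {q}" using Q by (auto simp: proj_plane_def)
    have "Q = pt x y" if "x \<in> A' Q" "y \<in> A' Q"
    proof -
      have "q \<in> Q" unfolding q(2) by (rule vec.span_base) simp
      then show ?thesis using pt_eq_span[OF dl[OF xy] q(1)] that q(2) by (simp add: A'_def)
    qed
    moreover have "x \<in> A' Q \<and> y \<in> A' Q" if Qe: "Q = pt x y"
    proof -
      have "\<forall>v\<in>Q. eval_poly x v = 0" "\<forall>v\<in>Q. eval_poly y v = 0"
        unfolding Qe pt_def vanishes_on_span[OF lin[OF xy(1)]] vanishes_on_span[OF lin[OF xy(2)]]
        by (rule cross_zero[OF lin[OF xy(1)] lin[OF xy(2)]])+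
      then show ?thesis using xy by (simp add: A'_def)
    qed
    ultimately show ?thesis unfolding f_def case_prod_conv by blast
  qed
  define T where "T = f ` P"
  have finT: "finite T" using finP by (simp add: T_def)
  have Tpp: "Q \<in> proj_plane" if "Q \<in> T" for Q
    using that pt_in_proj_plane dl by (auto simp: T_def P_def f_def)
  have T: "Q \<in> T \<longleftrightarrow> Q \<in> proj_plane \<and> 2 \<le> mult_at A Q" for Q
  proof
    assume Q: "Q \<in> T"
    then obtain x y where xy: "x \<in> A" "y \<in> A" "x \<noteq> y" "f (x, y) = Q" by (auto simp: T_def P_def)
    then have "{x, y} \<subseteq> A' Q" using fib Tpp[OF Q] by blast
    then have "card {x, y} \<le> card (A' Q)" using fin by (intro card_mono) (auto simp: A'_def)
    then show "Q \<in> proj_plane \<and> 2 \<le> mult_at A Q" using xy(3) Tpp[OF Q] by (simp add: mA')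
  next
    assume Q: "Q \<in> proj_plane \<and> 2 \<le> mult_at A Q"
    then have "2 \<le> card (A' Q)" by (simp add: mA')
    then obtain D where D: "D \<subseteq> A' Q" "card D = 2" by (rule obtain_subset_with_card_n)
    then obtain x y where xy: "D = {x, y}" "x \<noteq> y" by (auto simp: card_2_iff)
    then have A'xy: "x \<in> A' Q" "y \<in> A' Q" using D(1) by auto
    then have Axy: "x \<in> A" "y \<in> A" by (auto simp: A'_def)
    then have "f (x, y) = Q" using fib[OF Axy xy(2)] Q A'xy by blast
    moreover have "(x, y) \<in> P" using Axy xy(2) by (auto simp: P_def)
    ultimately show "Q \<in> T" unfolding T_def by (rule image_eqI[OF sym])
  qed
  have fiber: "card {pr \<in> P. f pr = Q} = mult_at A Q * (mult_at A Q - 1)" if Q: "Q \<in> T" for Q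
  proof -
    have "{pr \<in> P. f pr = Q} = (SIGMA x:A' Q. A' Q - {x})"
    proof (rule set_eqI)
      fix pr :: "spoly \<times> spoly"
      obtain x y where pr: "pr = (x, y)" by (cases pr)
      have sub: "x \<in> A' Q \<Longrightarrow> x \<in> A" for x by (simp add: A'_def)
      show "pr \<in> {pr \<in> P. f pr = Q} \<longleftrightarrow> pr \<in> (SIGMA x:A' Q. A' Q - {x})"
        using fib[of x y Q] Tpp[OF Q] sub unfolding pr P_def by auto
    qed
    moreover have "finite (A' Q)" using fin by (simp add: A'_def)
    ultimately show ?thesis using cardS by (simp add: mA')
  qed
  have bound: "mult_at A Q \<le> card A" for Q
    unfolding mult_at_def using fin by (intro card_mono) auto
  have "card A * (card A - 1) = (\<Sum>pr\<in>P. 1)" using cardS[OF fin] by (simp add: P_def)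
  also have "\<dots> = (\<Sum>Q\<in>T. \<Sum>pr\<in>{pr \<in> P. f pr = Q}. 1)" unfolding T_def by (rule sum.image_gen[OF finP])
  also have "\<dots> = (\<Sum>Q\<in>T. mult_at A Q * (mult_at A Q - 1))"
    by (rule sum.cong) (simp_all add: fiber)
  also have "\<dots> = (\<Sum>k = 2..card A. \<Sum>Q\<in>{Q \<in> T. mult_at A Q = k}. mult_at A Q * (mult_at A Q - 1))"
    using T bound by (intro sum.group[symmetric] finT) auto
  also have "\<dots> = (\<Sum>k = 2..card A. num_points A k * (k * (k - 1)))"
  proof (rule sum.cong)
    fix k assume k: "k \<in> {2..card A}"
    have "{Q \<in> T. mult_at A Q = k} = {Q \<in> proj_plane. mult_at A Q = k}" using T k by auto
    then show "(\<Sum>Q\<in>{Q \<in> T. mult_at A Q = k}. mult_at A Q * (mult_at A Q - 1)) = num_points A k * (k * (k - 1))"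
      by (simp add: num_points_def)
  qed simp
  finally show ?thesis by simp
qed

context pencil
begin

text \<open>At most one of the four lines passes through the point: otherwise it would be \<open>[p]\<close>, which is off \<open>x\<close>.\<close>

lemma mult_pt:
  assumes "x \<in> Os" "y \<in> Os" "x \<noteq> y"
  shows "mult_at B (pt x y) = card {z \<in> Os. in_span x y z} + (if off x y then 0 else 1)"
proof -
  let ?P = "{\<alpha>, \<beta>, \<gamma>, \<delta>}"
  note d = Os_distinct_lines[OF assms]
  have "mult_at B (pt x y) = card {z \<in> B. eval_poly z (cross x y) = 0}"
    unfolding pt_def by (rule mult_at_span[OF B_lin])
  also have "{z \<in> B. eval_poly z (cross x y) = 0} = {z \<in> Os. in_span x y z} \<union> {g \<in> ?P. in_span x y g}"
    using cross_zero_iff_in_span[OF d B_lin] by (auto simp: B_def)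
  also have "card \<dots> = card {z \<in> Os. in_span x y z} + card {g \<in> ?P. in_span x y g}"
    using Os(1) not_in_Os by (intro card_Un_disjoint) auto
  also have "card {g \<in> ?P. in_span x y g} = (if off x y then 0 else 1)"
  proof (cases "off x y")
    case True
    then have "{g \<in> ?P. in_span x y g} = {}" by (auto simp: off_def)
    then show ?thesis using True by simp
  next
    case False
    then obtain g where g: "g \<in> ?P" "in_span x y g" by (auto simp: off_def)
    have "g' = g" if g': "g' \<in> ?P" "in_span x y g'" for g'
    proof (rule ccontr)
      assume ne: "g' \<noteq> g"
      have "g' \<in> B" "g \<in> B" using g(1) g'(1) by (auto simp: B_def)
      then have dg: "distinct_lines g' g" using B_distinct_lines ne by blast
      have lg: "homogeneous 1 g'" "homogeneous 1 g" "eval_poly g' p = 0" "eval_poly g p = 0"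
        using g(1) g'(1) lin p by auto
      have "eval_poly g' (cross x y) = 0" "eval_poly g (cross x y) = 0"
        using cross_zero_iff_in_span[OF d] lg g(2) g'(2) by auto
      then obtain c where c: "cross x y = c *s p"
        using common_zero_unique[OF dg p(1) lg(3,4)] by blast
      have "c \<noteq> 0" using c cross_nonzero[OF d] by auto
      moreover have "eval_poly x (cross x y) = c * eval_poly x p"
        unfolding c by (rule eval_linear_scale[OF Os(3)[OF assms(1)]])
      ultimately show False
        using cross_zero(1)[OF Os(3)[OF assms(1)] Os(3)[OF assms(2)]] Os(4)[OF assms(1)] by simp
    qed
    then have "{g \<in> ?P. in_span x y g} = {g}" using g by blast
    then show ?thesis using False by simp
  qed
  finally show ?thesis .
qed

lemma mult_base_point: "mult_at B (vec.span {p}) = 4"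
proof -
  have "mult_at B (vec.span {p}) = card {l \<in> B. eval_poly l p = 0}" by (rule mult_at_span[OF B_lin])
  also have "{l \<in> B. eval_poly l p = 0} = {\<alpha>, \<beta>, \<gamma>, \<delta>}" using p Os(4) by (auto simp: B_def)
  also have "card \<dots> = 4" using distinct_four by simp
  finally show ?thesis .
qed

text \<open>A point of multiplicity at least 3 other than \<open>[p]\<close> is on at most one of the four lines and hence on
  two lines in \<open>Os\<close>. So only the intersection points of these, listed without repetition in \<open>PL\<close>, have to be
  examined.\<close>

lemma num_points_count:
  assumes k: "3 \<le> k" and PL: "distinct PL" "set PL = {pt x y | x y. x \<in> Os \<and> y \<in> Os \<and> x \<noteq> y}"
  shows "num_points B k = (if k = 4 then 1 else 0) + length (filter (\<lambda>Q. mult_at B Q = k) PL)"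
proof -
  let ?P = "{\<alpha>, \<beta>, \<gamma>, \<delta>}" and ?base = "vec.span {p}"
  have pp: "?base \<in> proj_plane" using p(1) by (auto simp: proj_plane_def)
  have PLpp: "Q \<in> proj_plane" if "Q \<in> set PL" for Q
    using that PL(2) pt_in_proj_plane Os_distinct_lines by auto
  have P0: "?base \<notin> set PL"
  proof
    assume "?base \<in> set PL"
    then obtain x y where xy: "x \<in> Os" "y \<in> Os" "x \<noteq> y" "?base = pt x y" using PL(2) by auto
    have "\<forall>v\<in>pt x y. eval_poly x v = 0"
      unfolding pt_def vanishes_on_span[OF Os(3)[OF xy(1)]]
        by (rule cross_zero(1)[OF Os(3)[OF xy(1)] Os(3)[OF xy(2)]])
    moreover have "p \<in> pt x y" unfolding xy(4)[symmetric] by (rule vec.span_base) simp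
    ultimately show False using Os(4)[OF xy(1)] by simp
  qed
  have big: "Q \<in> set PL" if Q: "Q \<in> proj_plane" "3 \<le> mult_at B Q" "Q \<noteq> ?base" for Q
  proof -
    obtain q where q: "q \<noteq> 0" "Q = vec.span {q}" using Q by (auto simp: proj_plane_def)
    let ?O = "{l \<in> Os. eval_poly l q = 0}" and ?G = "{l \<in> ?P. eval_poly l q = 0}"
    have "mult_at B Q = card {l \<in> B. eval_poly l q = 0}" unfolding q(2) by (rule mult_at_span[OF B_lin])
    also have "{l \<in> B. eval_poly l q = 0} = ?O \<union> ?G" by (auto simp: B_def)
    also have "card (?O \<union> ?G) \<le> card ?O + card ?G" by (rule card_Un_le)
    finally have le: "3 \<le> card ?O + card ?G" using Q(2) by simp
    have uniq: "g = g'" if g: "g \<in> ?G" "g' \<in> ?G" for g g'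
    proof (rule ccontr)
      assume "g \<noteq> g'"
      then have dg: "distinct_lines g g'" using g by (intro B_distinct_lines) (auto simp: B_def)
      have "eval_poly g p = 0" "eval_poly g' p = 0" using g p by auto
      then have "?base = pt g g'" by (intro pt_eq_span dg p(1))
      moreover have "Q = pt g g'" unfolding q(2) using g q(1) by (intro pt_eq_span dg) auto
      ultimately show False using Q(3) by simp
    qed
    have "\<forall>g\<in>?G. \<forall>g'\<in>?G. g = g'" by (intro ballI) (rule uniq)
    moreover have "finite ?G" by simp
    ultimately have "card ?G \<le> Suc 0" by (simp only: card_le_Suc0_iff_eq)
    then have "2 \<le> card ?O" using le by simp
    then obtain D where D: "D \<subseteq> ?O" "card D = 2" by (rule obtain_subset_with_card_n)
    then obtain x y where xy: "D = {x, y}" "x \<noteq> y" by (auto simp: card_2_iff)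
    then have O: "x \<in> Os" "y \<in> Os" "eval_poly x q = 0" "eval_poly y q = 0" using D(1) by auto
    then have "Q = pt x y" unfolding q(2) using q(1) xy(2) by (intro pt_eq_span Os_distinct_lines)
    then show ?thesis using O(1,2) xy(2) unfolding PL(2) by blast
  qed
  have "{Q \<in> proj_plane. mult_at B Q = k} = (if k = 4 then {?base} else {}) \<union> {Q \<in> set PL. mult_at B Q = k}"
  proof (intro set_eqI iffI)
    fix Q assume "Q \<in> {Q \<in> proj_plane. mult_at B Q = k}"
    then show "Q \<in> (if k = 4 then {?base} else {}) \<union> {Q \<in> set PL. mult_at B Q = k}"
      using big[of Q] k mult_base_point by (cases "Q = ?base") auto
  next
    fix Q assume "Q \<in> (if k = 4 then {?base} else {}) \<union> {Q \<in> set PL. mult_at B Q = k}"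
    then show "Q \<in> {Q \<in> proj_plane. mult_at B Q = k}"
      using PLpp[of Q] pp mult_base_point by (auto split: if_splits)
  qed
  then have "num_points B k = card ((if k = 4 then {?base} else {}) \<union> {Q \<in> set PL. mult_at B Q = k})"
    by (simp add: num_points_def)
  also have "\<dots> = card (if k = 4 then {?base} else {}) + card {Q \<in> set PL. mult_at B Q = k}"
    using P0 by (intro card_Un_disjoint) auto
  also have "card {Q \<in> set PL. mult_at B Q = k} = length (filter (\<lambda>Q. mult_at B Q = k) PL)"
    using distinct_card[OF distinct_filter[OF PL(1)]] by (simp only: set_filter)
  finally show ?thesis by (simp split: if_splits)
qed

lemma pt_eq_Os:
  assumes "x \<in> Os" "y \<in> Os" "x \<noteq> y" "z \<in> Os" "w \<in> Os" "z \<noteq> w" "pt x y = pt z w"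
  shows "in_span x y z" "in_span x y w"
  using pt_eq_in_span[OF Os_distinct_lines[OF assms(1-3)] Os_distinct_lines[OF assms(4-6)] assms(7)] by auto

lemma pt_Os_sym: "x \<in> Os \<Longrightarrow> y \<in> Os \<Longrightarrow> x \<noteq> y \<Longrightarrow> pt y x = pt x y"
  using pt_sym Os_distinct_lines by blast

lemma off_sym: "off x y = off y x"
  by (simp add: off_def in_span_sym)

lemma in_span_trans: "in_span x y z \<Longrightarrow> in_span x z w \<Longrightarrow> in_span x y w"
proof -
  assume "in_span x y z" "in_span x z w"
  then obtain s t s' t' where "z = Const s * x + Const t * y" "w = Const s' * x + Const t' * z"
    by (auto simp: in_span_def)
  then have "w = Const (s' + t' * s) * x + Const (t' * t) * y"
    by (simp add: Const_add Const_mult algebra_simps)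
  then show ?thesis unfolding in_span_def by blast
qed

definition generic :: bool where
  "generic \<longleftrightarrow> (\<forall>x\<in>Os. \<forall>y\<in>Os. \<forall>z\<in>Os. x \<noteq> y \<longrightarrow> x \<noteq> z \<longrightarrow> y \<noteq> z \<longrightarrow> \<not> in_span x y z)"

lemma generic_lines_label:
  assumes generic "Os = {x, y, z, w}" "distinct [x, y, z, w]"
  shows "generic_lines p e \<alpha> \<beta> \<gamma> \<delta> Os x y z w"
proof (intro generic_lines.intro four_lines.intro four_lines_axioms.intro generic_lines_axioms.intro)
  have "x \<in> Os" "y \<in> Os" "z \<in> Os" "w \<in> Os" "x \<noteq> y" "x \<noteq> z" "x \<noteq> w" "y \<noteq> z" "y \<noteq> w" "z \<noteq> w"
    using assms(2,3) by auto
  then show "\<not> in_span x y w" "\<not> in_span x z w" "\<not> in_span y z w" "\<not> in_span x y z"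
    using assms(1) unfolding generic_def by blast+
qed (rule pencil_axioms assms)+

end

text \<open>Applied to \<open>off x y\<close>: the number of lines through \<open>p\<close> that pass through the point where \<open>x\<close> and \<open>y\<close> meet.\<close>

abbreviation unless :: "bool \<Rightarrow> nat" where
  "unless b \<equiv> (if b then 0 else 1)"

context generic_lines
begin

lemma generic_num_points:
  "num_points B 3 = unless (off a b) + unless (off a c) + unless (off a d) + unless (off b c) + unless (off b d) + unless (off c d)"
  "num_points B 4 = 1"
proof -
  have gen: "z \<in> {x, y}" if "x \<in> Os" "y \<in> Os" "z \<in> Os" "x \<noteq> y" "in_span x y z" for x y z
  proof (rule ccontr)
    assume z: "z \<notin> {x, y}"
    have base: "\<not> in_span a b c" "\<not> in_span a b d" "\<not> in_span a c d" "\<not> in_span b c d"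
      "\<not> in_span a d b" "\<not> in_span b d a" "\<not> in_span a d c" "\<not> in_span c d a" "\<not> in_span b d c" "\<not> in_span c d b"
      using transversal transversal' not_in_span_exchange by auto
    have "\<not> in_span a c b" "\<not> in_span b c a"
      using transversal' in_span_exchange Os_distinct_lines in_span_sym by (metis mem ne)+
    with base show False using that z in_span_sym[of x y z] unfolding Os_eq by auto
  qed
  let ?PL = "[pt a b, pt a c, pt a d, pt b c, pt b d, pt c d]"
  have pe: "z \<in> {x, y} \<and> w \<in> {x, y}" if "x \<in> Os" "y \<in> Os" "x \<noteq> y" "z \<in> Os" "w \<in> Os" "z \<noteq> w" "pt x y = pt z w" for x y z w
    using gen[OF that(1,2,4,3) pt_eq_Os(1)[OF that]] gen[OF that(1,2,5,3) pt_eq_Os(2)[OF that]] by (rule conjI)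
  have pn: "pt x y \<noteq> pt z w" if "x \<in> Os" "y \<in> Os" "x \<noteq> y" "z \<in> Os" "w \<in> Os" "z \<noteq> w"
    "\<not> (z \<in> {x, y} \<and> w \<in> {x, y})" for x y z w
    using pe[OF that(1-6)] that(7) by (rule contrapos_nn[rotated])
  have dist: "distinct ?PL" by (simp add: pn)
  have sym: "pt b a = pt a b" "pt c a = pt a c" "pt d a = pt a d" "pt c b = pt b c" "pt d b = pt b d" "pt d c = pt c d"
    by (rule pt_Os_sym; simp)+
  have set: "set ?PL = {pt x y | x y. x \<in> Os \<and> y \<in> Os \<and> x \<noteq> y}" (is "_ = ?R")
  proof
    have r: "pt x y \<in> ?R" if "x \<in> Os" "y \<in> Os" "x \<noteq> y" for x y using that by blast
    show "set ?PL \<subseteq> ?R" unfolding list.set by (intro insert_subsetI empty_subsetI r mem ne)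
    show "?R \<subseteq> set ?PL"
    proof
      fix Q assume "Q \<in> ?R"
      then obtain x y where "Q = pt x y" "x \<in> {a, b, c, d}" "y \<in> {a, b, c, d}" "x \<noteq> y" unfolding Os_eq by blast
      then show "Q \<in> set ?PL" by (elim insertE emptyE) (simp_all add: sym)
    qed
  qed
  have card2: "card {z \<in> Os. in_span x y z} = 2" if "x \<in> Os" "y \<in> Os" "x \<noteq> y" for x y
  proof -
    have "{z \<in> Os. in_span x y z} = {x, y}" using gen[OF that(1,2) _ that(3)] that in_span_self by blast
    then show ?thesis using that(3) by simp
  qed
  have m: "mult_at B (pt x y) = 2 + unless (off x y)" if "x \<in> Os" "y \<in> Os" "x \<noteq> y" for x y
    using mult_pt[OF that] card2[OF that] by simp
  have "length (filter (\<lambda>Q. mult_at B Q = 3) ?PL) =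
      unless (off a b) + unless (off a c) + unless (off a d) + unless (off b c) + unless (off b d) + unless (off c d)"
    by (simp add: m)
  then show "num_points B 3 = unless (off a b) + unless (off a c) + unless (off a d) + unless (off b c) + unless (off b d) + unless (off c d)"
    using num_points_count[OF _ dist set, of 3] by simp
  have "filter (\<lambda>Q. mult_at B Q = 4) ?PL = []" by (simp add: m)
  then show "num_points B 4 = 1" using num_points_count[OF _ dist set, of 4] by simp
qed

end

context four_lines
begin

lemma triple_num_points:
  assumes con: "in_span a b c"
  shows "num_points B 3 = (if off a b then 1 else 0) + unless (off a d) + unless (off b d) + unless (off c d)"
    and "num_points B 4 = 1 + unless (off a b)"
proof -
  have con': "in_span a c b" "in_span b c a"
    using con in_span_exchange Os_distinct_lines in_span_sym by (metis mem ne)+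
  let ?PL = "[pt a b, pt a d, pt b d, pt c d]"
  have "pt a b \<noteq> pt a d" "pt a b \<noteq> pt b d" "pt a b \<noteq> pt c d" "pt a d \<noteq> pt b d" "pt a d \<noteq> pt c d" "pt b d \<noteq> pt c d"
    using pt_eq_Os(2)[of a b a d] pt_eq_Os(2)[of a b b d] pt_eq_Os(2)[of a b c d] transversal
      pt_eq_Os(1)[of a d b d] pt_eq_Os(1)[of a d c d] pt_eq_Os(1)[of b d c d] not_in_span_exchange
    by (simp_all, blast+)
  then have dist: "distinct ?PL" by simp
  have sym: "pt b a = pt a b" "pt c a = pt a c" "pt d a = pt a d" "pt c b = pt b c" "pt d b = pt b d" "pt d c = pt c d"
    by (rule pt_Os_sym; simp)+
  have eqs: "pt a c = pt a b" "pt b c = pt a b"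
    using pt_eq_if_in_span[OF Os_distinct_lines Os_distinct_lines con]
      pt_eq_if_in_span[OF Os_distinct_lines Os_distinct_lines, of b a c] con in_span_sym[of a b c] pt_Os_sym[of a b] by auto
  have set: "set ?PL = {pt x y | x y. x \<in> Os \<and> y \<in> Os \<and> x \<noteq> y}" (is "_ = ?R")
  proof
    have r: "pt x y \<in> ?R" if "x \<in> Os" "y \<in> Os" "x \<noteq> y" for x y using that by blast
    show "set ?PL \<subseteq> ?R" unfolding list.set by (intro insert_subsetI empty_subsetI r mem ne)
    show "?R \<subseteq> set ?PL"
    proof
      fix Q assume "Q \<in> ?R"
      then obtain x y where "Q = pt x y" "x \<in> {a, b, c, d}" "y \<in> {a, b, c, d}" "x \<noteq> y" unfolding Os_eq by blast
      then show "Q \<in> set ?PL" by (elim insertE emptyE) (simp_all add: sym eqs)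
    qed
  qed
  have "{z \<in> Os. in_span a b z} = {a, b, c}" using transversal con in_span_self by (auto simp: Os_eq)
  then have m1: "mult_at B (pt a b) = 3 + unless (off a b)" using mult_pt[of a b] by simp
  have "{z \<in> Os. in_span a d z} = {a, d}" "{z \<in> Os. in_span b d z} = {b, d}" "{z \<in> Os. in_span c d z} = {c, d}"
    using not_in_span_exchange in_span_self by (auto simp: Os_eq)
  then have m2: "mult_at B (pt a d) = 2 + unless (off a d)" "mult_at B (pt b d) = 2 + unless (off b d)"
    "mult_at B (pt c d) = 2 + unless (off c d)"
    using mult_pt[of a d] mult_pt[of b d] mult_pt[of c d] by simp_all
  have "length (filter (\<lambda>Q. mult_at B Q = 3) ?PL) = (if off a b then 1 else 0) + unless (off a d) + unless (off b d) + unless (off c d)"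
    by (simp add: m1 m2)
  then show "num_points B 3 = (if off a b then 1 else 0) + unless (off a d) + unless (off b d) + unless (off c d)"
    using num_points_count[OF _ dist set, of 3] by simp
  have "length (filter (\<lambda>Q. mult_at B Q = 4) ?PL) = unless (off a b)" by (simp add: m1 m2)
  then show "num_points B 4 = 1 + unless (off a b)"
    using num_points_count[OF _ dist set, of 4] by simp
qed

lemma four_lines_relabel:
  "four_lines p e \<alpha> \<beta> \<gamma> \<delta> Os b a c d" "four_lines p e \<alpha> \<beta> \<gamma> \<delta> Os c a b d"
  "four_lines p e \<alpha> \<beta> \<gamma> \<delta> Os a c b d" "four_lines p e \<alpha> \<beta> \<gamma> \<delta> Os b c a d"
proof -
  have "\<not> in_span b a d" "\<not> in_span c a d" "\<not> in_span c b d" using transversal in_span_sym by metis+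
  moreover have "Os = {b, a, c, d}" "Os = {c, a, b, d}" "Os = {a, c, b, d}" "Os = {b, c, a, d}"
    using Os_eq by auto
  ultimately show "four_lines p e \<alpha> \<beta> \<gamma> \<delta> Os b a c d" "four_lines p e \<alpha> \<beta> \<gamma> \<delta> Os c a b d"
    "four_lines p e \<alpha> \<beta> \<gamma> \<delta> Os a c b d" "four_lines p e \<alpha> \<beta> \<gamma> \<delta> Os b c a d"
    using transversal distinct
    by (intro four_lines.intro[OF pencil_axioms] four_lines_axioms.intro; simp)+
qed

end

section \<open>The table of outcomes\<close>

text \<open>The possible triples of \<open>n\<^sub>3\<close>, \<open>n\<^sub>4\<close> and the exponents.\<close>

definition outcome_table :: "(nat \<times> nat \<times> nat list) set" where
  "outcome_table = {(6, 1, [3, 4]), (5, 1, [4, 4, 4]), (4, 1, [4, 4, 5]), (3, 1, [4, 4, 6]),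
     (3, 1, [4, 5, 5, 5]), (2, 1, [4, 5, 5]), (2, 1, [4, 5, 5, 6]), (1, 1, [4, 5, 6, 6]),
     (0, 1, [4, 6, 6, 6, 6]),
     (3, 2, [3, 4]), (2, 2, [4, 4, 4]), (1, 2, [4, 4, 5]), (0, 2, [4, 4, 6])}"

text \<open>The eleven isomorphism types of graphs on four vertices, each in the labelling in which the lemmas on lines in general
  position treat it.\<close>

definition canonical_graph :: "('a \<Rightarrow> 'a \<Rightarrow> bool) \<Rightarrow> 'a \<Rightarrow> 'a \<Rightarrow> 'a \<Rightarrow> 'a \<Rightarrow> bool" where
  "canonical_graph K a b c d \<longleftrightarrow>
    (K a b, K a c, K a d, K b c, K b d, K c d) \<in>
      {(False, False, False, False, False, False), (False, False, True, False, False, False),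
       (False, False, True, False, True, False), (True, False, False, False, False, True),
       (False, False, True, False, True, True), (True, True, False, True, False, False),
       (True, False, False, True, False, True), (False, True, True, True, True, False),
       (False, False, True, True, True, True), (False, True, True, True, True, True),
       (True, True, True, True, True, True)}"

lemma graph_has_canonical_labelling:
  assumes "distinct [a, b, c, d]" "\<And>x y. K x y = K y x"
  shows "\<exists>x y z w. {x, y, z, w} = {a, b, c, d} \<and> distinct [x, y, z, w] \<and> canonical_graph K x y z w"
proof -
  have sym: "K b a = K a b" "K c a = K a c" "K d a = K a d" "K c b = K b c" "K d b = K b d" "K d c = K c d"
    using assms(2) by auto
  (* These 14 permutations already bring each of the 64 graphs into canonical form. *)
  have "canonical_graph K a b c d \<or>
      canonical_graph K a c d b \<or>
      canonical_graph K a d b c \<or>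
      canonical_graph K b c d a \<or>
      canonical_graph K b d a c \<or>
      canonical_graph K d c a b \<or>
      canonical_graph K c a b d \<or>
      canonical_graph K b c a d \<or>
      canonical_graph K c d b a \<or>
      canonical_graph K d b c a \<or>
      canonical_graph K b a d c \<or>
      canonical_graph K d a b c \<or>
      canonical_graph K a d c b \<or>
      canonical_graph K c a d b"
    by (cases "K a b"; cases "K a c"; cases "K a d"; cases "K b c"; cases "K b d"; cases "K c d")
      (simp_all add: canonical_graph_def sym)
  then show ?thesis
  proof (elim disjE)
    assume "canonical_graph K a b c d"
    then show ?thesis using assms(1) by (intro exI[of _ a] exI[of _ b] exI[of _ c] exI[of _ d]) auto
  next
    assume "canonical_graph K a c d b"
    then show ?thesis using assms(1) by (intro exI[of _ a] exI[of _ c] exI[of _ d] exI[of _ b]) auto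
  next
    assume "canonical_graph K a d b c"
    then show ?thesis using assms(1) by (intro exI[of _ a] exI[of _ d] exI[of _ b] exI[of _ c]) auto
  next
    assume "canonical_graph K b c d a"
    then show ?thesis using assms(1) by (intro exI[of _ b] exI[of _ c] exI[of _ d] exI[of _ a]) auto
  next
    assume "canonical_graph K b d a c"
    then show ?thesis using assms(1) by (intro exI[of _ b] exI[of _ d] exI[of _ a] exI[of _ c]) auto
  next
    assume "canonical_graph K d c a b"
    then show ?thesis using assms(1) by (intro exI[of _ d] exI[of _ c] exI[of _ a] exI[of _ b]) auto
  next
    assume "canonical_graph K c a b d"
    then show ?thesis using assms(1) by (intro exI[of _ c] exI[of _ a] exI[of _ b] exI[of _ d]) auto
  next
    assume "canonical_graph K b c a d"
    then show ?thesis using assms(1) by (intro exI[of _ b] exI[of _ c] exI[of _ a] exI[of _ d]) auto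
  next
    assume "canonical_graph K c d b a"
    then show ?thesis using assms(1) by (intro exI[of _ c] exI[of _ d] exI[of _ b] exI[of _ a]) auto
  next
    assume "canonical_graph K d b c a"
    then show ?thesis using assms(1) by (intro exI[of _ d] exI[of _ b] exI[of _ c] exI[of _ a]) auto
  next
    assume "canonical_graph K b a d c"
    then show ?thesis using assms(1) by (intro exI[of _ b] exI[of _ a] exI[of _ d] exI[of _ c]) auto
  next
    assume "canonical_graph K d a b c"
    then show ?thesis using assms(1) by (intro exI[of _ d] exI[of _ a] exI[of _ b] exI[of _ c]) auto
  next
    assume "canonical_graph K a d c b"
    then show ?thesis using assms(1) by (intro exI[of _ a] exI[of _ d] exI[of _ c] exI[of _ b]) auto
  next
    assume "canonical_graph K c a d b"
    then show ?thesis using assms(1) by (intro exI[of _ c] exI[of _ a] exI[of _ d] exI[of _ b]) auto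
  qed
qed

context pencil
begin

lemma Os_labelling:
  obtains a b c d where "Os = {a, b, c, d}" "distinct [a, b, c, d]"
proof -
  obtain xs where xs: "set xs = Os" "distinct xs" using finite_distinct_list[OF Os(1)] by blast
  then have "length xs = 4" using Os(2) distinct_card by metis
  then obtain a b c d where "xs = [a, b, c, d]" by (auto simp: numeral_eq_Suc length_Suc_conv)
  then show ?thesis using that xs by auto
qed

text \<open>Case by case through the canonical graphs, whose edges are the intersection points off the lines through \<open>p\<close>.\<close>

lemma generic_outcome_in_table:
  assumes generic
  shows "\<exists>es. outcome es \<and> (num_points B 3, num_points B 4, es) \<in> outcome_table"
proof -
  obtain a b c d where O: "Os = {a, b, c, d}" "distinct [a, b, c, d]" using Os_labelling .
  obtain x y z w where L: "{x, y, z, w} = {a, b, c, d}" "distinct [x, y, z, w]"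
    and can: "canonical_graph off x y z w"
    using graph_has_canonical_labelling[OF O(2), of off] off_sym by blast
  have Os_eq: "Os = {x, y, z, w}" using O(1) L(1) by simp
  interpret gl: generic_lines p e \<alpha> \<beta> \<gamma> \<delta> Os x y z w
    by (rule generic_lines_label[OF assms Os_eq L(2)])
  note num = gl.generic_num_points
  show ?thesis
    using can unfolding canonical_graph_def insert_iff empty_iff prod.inject eq_False eq_True
  proof (elim disjE conjE FalseE)
    assume 1: "\<not> off x y" "\<not> off x z" "\<not> off x w" "\<not> off y z" "\<not> off y w" "\<not> off z w"
    then have "slopes Os = UNIV" unfolding gl.slope_ideal_generic by (auto simp: gl.pair_def)
    then have "outcome [3, 4]" by (rule outcome_unit)
    then show ?thesis using 1 by (intro exI[of _ "[3, 4]"]) (simp add: num outcome_table_def)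
  next
    assume 2: "\<not> off x y" "\<not> off x z" "off x w" "\<not> off y z" "\<not> off y w" "\<not> off z w"
    then have "slopes Os = ideal2 x w" unfolding gl.slope_ideal_generic by (auto simp: gl.pair_def)
    then have "outcome [4, 4, 4]" by (rule gl.outcome_one_point)
    then show ?thesis using 2 by (intro exI[of _ "[4, 4, 4]"]) (simp add: num outcome_table_def)
  next
    assume 3: "\<not> off x y" "\<not> off x z" "off x w" "\<not> off y z" "off y w" "\<not> off z w"
    then have "slopes Os = ideal2 x w \<inter> ideal2 y w" unfolding gl.slope_ideal_generic by (auto simp: gl.pair_def)
    then have "outcome [4, 4, 5]" by (rule gl.outcome_two_on_d)
    then show ?thesis using 3 by (intro exI[of _ "[4, 4, 5]"]) (simp add: num outcome_table_def)
  next
    assume 4: "off x y" "\<not> off x z" "\<not> off x w" "\<not> off y z" "\<not> off y w" "off z w"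
    then have "slopes Os = ideal2 x y \<inter> ideal2 z w" unfolding gl.slope_ideal_generic by (auto simp: gl.pair_def)
    then have "outcome [4, 4, 5]" by (rule gl.outcome_two_disjoint)
    then show ?thesis using 4 by (intro exI[of _ "[4, 4, 5]"]) (simp add: num outcome_table_def)
  next
    assume 5: "\<not> off x y" "\<not> off x z" "off x w" "\<not> off y z" "off y w" "off z w"
    then have "slopes Os = ideal2 x w \<inter> ideal2 y w \<inter> ideal2 z w" unfolding gl.slope_ideal_generic
      by (auto simp: gl.pair_def)
    then have "outcome [4, 4, 6]" by (rule gl.outcome_three_on_d)
    then show ?thesis using 5 by (intro exI[of _ "[4, 4, 6]"]) (simp add: num outcome_table_def)
  next
    assume 6: "off x y" "off x z" "\<not> off x w" "off y z" "\<not> off y w" "\<not> off z w"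
    then have "slopes Os = ideal2 x y \<inter> ideal2 x z \<inter> ideal2 y z" unfolding gl.slope_ideal_generic
      by (auto simp: gl.pair_def)
    then have "outcome [4, 5, 5, 5]" by (rule gl.outcome_triangle)
    then show ?thesis using 6 by (intro exI[of _ "[4, 5, 5, 5]"]) (simp add: num outcome_table_def)
  next
    assume 7: "off x y" "\<not> off x z" "\<not> off x w" "off y z" "\<not> off y w" "off z w"
    then have "slopes Os = ideal2 x y \<inter> ideal2 y z \<inter> ideal2 z w" unfolding gl.slope_ideal_generic
      by (auto simp: gl.pair_def)
    then have "outcome [4, 5, 5, 5]" by (rule gl.outcome_path)
    then show ?thesis using 7 by (intro exI[of _ "[4, 5, 5, 5]"]) (simp add: num outcome_table_def)
  next
    assume 8: "\<not> off x y" "off x z" "off x w" "off y z" "off y w" "\<not> off z w"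
    then have "slopes Os = ideal2 x z \<inter> ideal2 x w \<inter> ideal2 y z \<inter> ideal2 y w" unfolding gl.slope_ideal_generic
      by (auto simp: gl.pair_def)
    then have "outcome [4, 5, 5]" by (rule gl.outcome_cycle)
    then show ?thesis using 8 by (intro exI[of _ "[4, 5, 5]"]) (simp add: num outcome_table_def)
  next
    assume 9: "\<not> off x y" "\<not> off x z" "off x w" "off y z" "off y w" "off z w"
    then have "slopes Os = ideal2 x w \<inter> ideal2 y w \<inter> ideal2 z w \<inter> ideal2 y z" unfolding gl.slope_ideal_generic
      by (auto simp: gl.pair_def)
    then have "outcome [4, 5, 5, 6]" by (rule gl.outcome_paw)
    then show ?thesis using 9 by (intro exI[of _ "[4, 5, 5, 6]"]) (simp add: num outcome_table_def)
  next
    assume 10: "\<not> off x y" "off x z" "off x w" "off y z" "off y w" "off z w"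
    then have "slopes Os = ideal2 x z \<inter> ideal2 x w \<inter> ideal2 y z \<inter> ideal2 y w \<inter> ideal2 z w"
      unfolding gl.slope_ideal_generic by (auto simp: gl.pair_def)
    then have "outcome [4, 5, 6, 6]" by (rule gl.outcome_five)
    then show ?thesis using 10 by (intro exI[of _ "[4, 5, 6, 6]"]) (simp add: num outcome_table_def)
  next
    assume 11: "off x y" "off x z" "off x w" "off y z" "off y w" "off z w"
    then have "slopes Os = ideal2 x z \<inter> ideal2 x w \<inter> ideal2 y z \<inter> ideal2 y w \<inter> ideal2 z w \<inter> ideal2 x y"
      unfolding gl.slope_ideal_generic by (auto simp: gl.pair_def)
    then have "outcome [4, 6, 6, 6, 6]" by (rule gl.outcome_six)
    then show ?thesis using 11 by (intro exI[of _ "[4, 6, 6, 6, 6]"]) (simp add: num outcome_table_def)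
  qed
qed

end

text \<open>With three concurrent lines \<open>a\<close>, \<open>b\<close>, \<open>c\<close>, only the points on \<open>d\<close> matter besides the triple point. Relabelling
  reduces to the case where the points off the lines through \<open>p\<close> come first in the order \<open>a, b, c\<close>.\<close>

lemma (in four_lines) triple_outcome_sorted:
  assumes con: "in_span a b c" and order: "off b d \<Longrightarrow> off a d" "off c d \<Longrightarrow> off b d"
  shows "\<exists>es. outcome es \<and> (num_points B 3, num_points B 4, es) \<in> outcome_table"
proof -
  note num = triple_num_points[OF con]
  consider (none) "\<not> off a d" "\<not> off b d" "\<not> off c d" | (one) "off a d" "\<not> off b d" "\<not> off c d"
    | (two) "off a d" "off b d" "\<not> off c d" | (three) "off a d" "off b d" "off c d"
    using order by blast
  note cases = this
  show ?thesis
  proof (cases "off a b")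
    case False
    have J: "slopes {a, b, c} = UNIV"
      using False con by (intro slope_ideal_concurrent_on[of a _ b]) (auto intro: in_span_self)
    from cases show ?thesis
    proof cases
      case none
      then have "slopes Os = UNIV" unfolding slope_ideal_star J by (auto simp: pair_def)
      then have "outcome [3, 4]" by (rule outcome_unit)
      then show ?thesis using none False by (intro exI[of _ "[3, 4]"]) (simp add: num outcome_table_def)
    next
      case one
      then have "slopes Os = ideal2 a d" unfolding slope_ideal_star J by (auto simp: pair_def)
      then have "outcome [4, 4, 4]" by (rule outcome_one_point)
      then show ?thesis using one False by (intro exI[of _ "[4, 4, 4]"]) (simp add: num outcome_table_def)
    next
      case two
      then have "slopes Os = ideal2 a d \<inter> ideal2 b d" unfolding slope_ideal_star J by (auto simp: pair_def)
      then have "outcome [4, 4, 5]" by (rule outcome_two_on_d)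
      then show ?thesis using two False by (intro exI[of _ "[4, 4, 5]"]) (simp add: num outcome_table_def)
    next
      case three
      then have "slopes Os = ideal2 a d \<inter> ideal2 b d \<inter> ideal2 c d"
        unfolding slope_ideal_star J by (auto simp: pair_def)
      then have "outcome [4, 4, 6]" by (rule outcome_three_on_d)
      then show ?thesis using three False by (intro exI[of _ "[4, 4, 6]"]) (simp add: num outcome_table_def)
    qed
  next
    case True
    then interpret tr: triple_off p e \<alpha> \<beta> \<gamma> \<delta> Os a b c d
      using con by (intro triple_off.intro four_lines_axioms triple_off_axioms.intro)
    from cases show ?thesis
    proof cases
      case none
      then have "slopes Os = slopes {a, b, c}" unfolding slope_ideal_star by (auto simp: pair_def)
      then have "outcome [4, 4, 5]" by (rule tr.outcome_tangent)
      then show ?thesis using none True by (intro exI[of _ "[4, 4, 5]"]) (simp add: num outcome_table_def)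
    next
      case one
      then have "slopes Os = slopes {a, b, c} \<inter> ideal2 a d"
        unfolding slope_ideal_star by (auto simp: pair_def)
      then have "outcome [4, 5, 5, 5]" by (rule tr.outcome_tangent_one)
      then show ?thesis using one True by (intro exI[of _ "[4, 5, 5, 5]"]) (simp add: num outcome_table_def)
    next
      case two
      then have "slopes Os = slopes {a, b, c} \<inter> ideal2 a d \<inter> ideal2 b d"
        unfolding slope_ideal_star by (auto simp: pair_def)
      then have "outcome [4, 5, 5]" by (rule tr.outcome_tangent_two)
      then show ?thesis using two True by (intro exI[of _ "[4, 5, 5]"]) (simp add: num outcome_table_def)
    next
      case three
      then have "slopes Os = slopes {a, b, c} \<inter> ideal2 a d \<inter> ideal2 b d \<inter> ideal2 c d"
        unfolding slope_ideal_star by (auto simp: pair_def)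
      then have "outcome [4, 5, 6, 6]" by (rule tr.outcome_tangent_three)
      then show ?thesis using three True by (intro exI[of _ "[4, 5, 6, 6]"]) (simp add: num outcome_table_def)
    qed
  qed
qed

lemma (in four_lines) triple_outcome_in_table:
  assumes con: "in_span a b c"
  shows "\<exists>es. outcome es \<and> (num_points B 3, num_points B 4, es) \<in> outcome_table"
proof -
  have "in_span b a c" using con in_span_sym by blast
  moreover have "in_span a c b"
    using in_span_exchange con Os_distinct_lines in_span_sym by (metis mem ne)
  moreover have "in_span b c a"
    using in_span_exchange con Os_distinct_lines in_span_sym by (metis mem ne)
  moreover have "in_span c a b" using \<open>in_span a c b\<close> in_span_sym by blast
  ultimately show ?thesis
    using triple_outcome_sorted[OF con] four_lines.triple_outcome_sorted[OF four_lines_relabel(1)]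
      four_lines.triple_outcome_sorted[OF four_lines_relabel(2)]
      four_lines.triple_outcome_sorted[OF four_lines_relabel(3)]
      four_lines.triple_outcome_sorted[OF four_lines_relabel(4)]
    by blast
qed

context pencil
begin

text \<open>The four lines off \<open>p\<close> are in general position, or exactly three are concurrent, or all four are. In the last
  case their common point is off the lines through \<open>p\<close>, because otherwise its multiplicity would be 5.\<close>

theorem outcome_in_table:
  assumes max4: "\<And>Q. Q \<in> proj_plane \<Longrightarrow> mult_at B Q \<le> 4"
  shows "\<exists>es. outcome es \<and> (num_points B 3, num_points B 4, es) \<in> outcome_table"
proof (cases generic)
  case True
  then show ?thesis by (rule generic_outcome_in_table)
next
  case False
  then obtain a b c where abc: "a \<in> Os" "b \<in> Os" "c \<in> Os" "a \<noteq> b" "a \<noteq> c" "b \<noteq> c" and con: "in_span a b c"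
    unfolding generic_def by blast
  have "card (Os - {a, b, c}) = 1" using abc Os(1,2) by (simp add: card_Diff_subset)
  then obtain d where d: "Os - {a, b, c} = {d}" by (rule card_1_singletonE)
  have Os_eq: "Os = {a, b, c, d}" and dist: "distinct [a, b, c, d]" using d abc by auto
  have dO: "d \<in> Os" using Os_eq by simp
  show ?thesis
  proof (cases "in_span a b d")
    case True
    have "{z \<in> Os. in_span a b z} = Os" using con True in_span_self by (auto simp: Os_eq)
    then have m: "mult_at B (pt a b) = 4 + unless (off a b)" using mult_pt[OF abc(1,2,4)] Os(2) by simp
    have off: "off a b"
      using m max4[OF pt_in_proj_plane[OF Os_distinct_lines[OF abc(1,2,4)]]] by (auto split: if_splits)
    have "outcome [4, 4, 6]" by (rule outcome_four_concurrent[OF Os_eq dist con True off])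
    moreover have set: "set [pt a b] = {pt x y | x y. x \<in> Os \<and> y \<in> Os \<and> x \<noteq> y}"
    proof -
      have all: "pt x y = pt a b" if xy: "x \<in> Os" "y \<in> Os" "x \<noteq> y" for x y
      proof -
        have "eval_poly z (cross a b) = 0" if "z \<in> Os" for z
          using cross_zero_iff_in_span[OF Os_distinct_lines[OF abc(1,2,4)] Os(3)[OF that]] that con True in_span_self
          by (auto simp: Os_eq)
        then have "vec.span {cross a b} = pt x y"
          using xy by (intro pt_eq_span Os_distinct_lines cross_nonzero[OF Os_distinct_lines] abc)
        then show ?thesis by (simp add: pt_def)
      qed
      show ?thesis
      proof (intro equalityI subsetI)
        fix Q assume "Q \<in> set [pt a b]"
        then have "Q = pt a b" by simp
        then show "Q \<in> {pt x y | x y. x \<in> Os \<and> y \<in> Os \<and> x \<noteq> y}" using abc(1,2,4) by blast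
      next
        fix Q assume "Q \<in> {pt x y | x y. x \<in> Os \<and> y \<in> Os \<and> x \<noteq> y}"
        then obtain x y where "Q = pt x y" "x \<in> Os" "y \<in> Os" "x \<noteq> y" by blast
        then have "Q = pt a b" using all by (simp only:)
        then show "Q \<in> set [pt a b]" by simp
      qed
    qed
    have "num_points B 3 = 0" "num_points B 4 = 2"
      using num_points_count[OF _ _ set, of 3] num_points_count[OF _ _ set, of 4] m off by simp_all
    ultimately show ?thesis by (intro exI[of _ "[4, 4, 6]"]) (simp add: outcome_table_def)
  next
    case False
    have "\<not> in_span a c d" using False in_span_trans[OF con] by blast
    moreover have "\<not> in_span b c d"
    proof
      assume "in_span b c d"
      moreover have "in_span b a c" using con in_span_sym by blast
      ultimately have "in_span b a d" using in_span_trans by blast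
      then show False using False in_span_sym by blast
    qed
    ultimately interpret fl: four_lines p e \<alpha> \<beta> \<gamma> \<delta> Os a b c d
      using False Os_eq dist by (intro four_lines.intro[OF pencil_axioms] four_lines_axioms.intro)
    show ?thesis by (rule fl.triple_outcome_in_table[OF con])
  qed
qed

end

section \<open>The classification\<close>

text \<open>Scaling the lines off the point of multiplicity four changes the defining polynomial by a constant factor only, which
  puts the arrangement in the form studied above. Counting pairs of lines gives \<open>2 n\<^sub>2 + 6 n\<^sub>3 + 12 n\<^sub>4 = 56\<close>, hence
  \<open>\<tau> = 28 + n\<^sub>3 + 3 n\<^sub>4\<close>, and the theorem is read off from the table.\<close>

theorem theorem4p1:
  fixes A :: "spoly set" and f :: spoly and r \<tau> n3 n4 :: nat and es :: "nat list"
  assumes "line_arrangement A" and "card A = 8" and "max_mult A = 4"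
    and "f = defining_poly A" and "r = mdr f" and "es = exponents f"
    and "\<tau> = total_tjurina A" and "n3 = num_points A 3" and "n4 = num_points A 4"
  shows "\<tau> \<in> {31, 32, 33, 34, 35, 36, 37} \<and>
    (\<tau> = 37 \<longrightarrow> free_arr A \<and> es = [3, 4]) \<and>
    (\<tau> = 36 \<longrightarrow> nearly_free A \<and> es = [4, 4, 4]) \<and>
    (\<tau> = 35 \<longrightarrow> minimal_POG A \<and> es = [4, 4, 5]) \<and>
    (\<tau> = 34 \<longrightarrow> r = 4 \<and> (n3, n4) \<in> {(0, 2), (3, 1)} \<and>
       ((n3, n4) = (0, 2) \<longrightarrow> POG A \<and> es = [4, 4, 6]) \<and>
       ((n3, n4) = (3, 1) \<longrightarrow>
          POG A \<and> es = [4, 4, 6] \<or> arr_type A = 2 \<and> es = [4, 5, 5, 5])) \<and>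
    (\<tau> = 33 \<longrightarrow> (n3, n4) = (2, 1) \<and> r = 4 \<and>
       (arr_type A = 2 \<and> es = [4, 5, 5] \<or> arr_type A = 2 \<and> es = [4, 5, 5, 6])) \<and>
    (\<tau> = 32 \<longrightarrow> arr_type A = 2 \<and> es = [4, 5, 6, 6]) \<and>
    (\<tau> = 31 \<longrightarrow> arr_type A = 3 \<and> es = [4, 6, 6, 6, 6])"
proof -
  have fin: "finite A" and lin: "\<And>l. l \<in> A \<Longrightarrow> homogeneous 1 l" and nz: "\<And>l. l \<in> A \<Longrightarrow> l \<noteq> 0"
    using assms(1) by (auto simp: line_arrangement_def)
  note dl = line_arrangement_distinct_lines[OF assms(1)]
  have bound: "mult_at A Q \<le> card A" for Q
    unfolding mult_at_def using fin by (intro card_mono) auto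
  have finm: "finite (mult_at A ` proj_plane)" 
    by (rule finite_subset[of _ "{..card A}"]) (simp_all add: image_subset_iff bound)
  have "vec.span {axis 1 1 :: complex ^ 3} \<in> proj_plane" by (auto simp: proj_plane_def axis_eq_0_iff)
  then have ne: "mult_at A ` proj_plane \<noteq> {}" by blast
  have max4: "mult_at A Q \<le> 4" if "Q \<in> proj_plane" for Q
    using Max_ge[OF finm, of "mult_at A Q"] assms(3) that by (simp add: max_mult_def)
  obtain P where P: "P \<in> proj_plane" "mult_at A P = 4"
    using Max_in[OF finm ne] assms(3) by (auto simp: max_mult_def)
  then obtain p where p: "p \<noteq> 0" "P = vec.span {p}" by (auto simp: proj_plane_def)
  define S where "S = {l \<in> A. eval_poly l p = 0}"
  have cS: "card S = 4" using P(2) mult_at_span[OF lin] by (simp add: p(2) S_def)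
  have finS: "finite S" using fin by (simp add: S_def)
  obtain xs where xs: "set xs = S" "distinct xs" using finite_distinct_list[OF finS] by blast
  then have "length xs = 4" using cS distinct_card by metis
  then obtain \<alpha> \<beta> \<gamma> \<delta> where xs4: "xs = [\<alpha>, \<beta>, \<gamma>, \<delta>]" by (auto simp: numeral_eq_Suc length_Suc_conv)
  have S4: "S = {\<alpha>, \<beta>, \<gamma>, \<delta>}" using xs(1) xs4 by auto
  have ne4: "\<alpha> \<noteq> \<beta>" "\<alpha> \<noteq> \<gamma>" "\<alpha> \<noteq> \<delta>" "\<beta> \<noteq> \<gamma>" "\<beta> \<noteq> \<delta>" "\<gamma> \<noteq> \<delta>" using xs(2) xs4 by auto
  have "{\<alpha>, \<beta>, \<gamma>, \<delta>} \<subseteq> {l \<in> A. eval_poly l p = 0}" unfolding S4[symmetric] S_def by blast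
  then have in4: "\<alpha> \<in> A" "\<beta> \<in> A" "\<gamma> \<in> A" "\<delta> \<in> A"
    and p4: "eval_poly \<alpha> p = 0" "eval_poly \<beta> p = 0" "eval_poly \<gamma> p = 0" "eval_poly \<delta> p = 0" by auto
  obtain e0 where e0: "eval_poly \<beta> e0 = 0" "eval_poly \<alpha> e0 \<noteq> 0"
    using point_on_line_off_line[OF dl[OF in4(2,1) ne4(1)[symmetric]]] .
  define e where "e = (1 / eval_poly \<alpha> e0) *s e0"
  have e: "eval_poly \<alpha> e = 1" "eval_poly \<beta> e = 0"
    using e0 by (simp_all add: e_def eval_linear_scale lin in4)
  (* The scaling factors: 1 on the four lines through p, and l(p) becomes 1 on the others. *)
  define c where "c l = (if eval_poly l p = 0 then 1 else 1 / eval_poly l p)" for l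
  have c0: "c l \<noteq> 0" for l by (simp add: c_def)
  define \<phi> where "\<phi> l = Const (c l) * l" for l
  have inj: "inj_on \<phi> A"
  proof (rule inj_onI, rule ccontr)
    fix l l' assume l: "l \<in> A" "l' \<in> A" "\<phi> l = \<phi> l'" "l \<noteq> l'"
    have "Const (1 / c l') * \<phi> l' = l'" using c0[of l']
      by (simp add: \<phi>_def mult.assoc[symmetric] Const_mult[symmetric])
    then have "l' = Const (1 / c l') * \<phi> l" unfolding l(3) by (rule sym)
    then have "l' = Const (1 / c l' * c l) * l" by (simp only: \<phi>_def Const_mult mult.assoc)
    then show False using dl[OF l(1,2,4)] unfolding distinct_lines_def by blast
  qed
  have eval\<phi>: "eval_poly (\<phi> l) v = 0 \<longleftrightarrow> eval_poly l v = 0" for l v using c0[of l] by (simp add: \<phi>_def)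
  define Os where "Os = \<phi> ` (A - S)"
  have "pencil p e \<alpha> \<beta> \<gamma> \<delta> Os"
  proof
    show "distinct_lines \<alpha> \<beta>" "distinct_lines \<alpha> \<gamma>" "distinct_lines \<alpha> \<delta>" "distinct_lines \<beta> \<gamma>"
      "distinct_lines \<beta> \<delta>" "distinct_lines \<gamma> \<delta>" using in4 ne4 by (auto intro: dl)
    show "finite Os" using fin by (simp add: Os_def)
    have "card (A - S) = 4" using fin finS cS assms(2) by (subst card_Diff_subset) (auto simp: S_def)
    then show "card Os = 4" unfolding Os_def using inj by (subst card_image) (auto intro: inj_on_subset)
    show "homogeneous 1 l" if "l \<in> Os" for l
      using that lin by (auto simp: Os_def \<phi>_def intro: homogeneous_Const_mult)
    show "eval_poly l p = 1" if "l \<in> Os" for l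
      using that by (auto simp: Os_def \<phi>_def S_def c_def split: if_splits)
  qed (use p p4 e in auto)
  then interpret pencil p e \<alpha> \<beta> \<gamma> \<delta> Os .
  have "\<phi> l = l" if "l \<in> S" for l using that by (simp add: \<phi>_def c_def S_def)
  then have \<phi>S: "\<phi> ` S = S" by force
  have AS: "S \<union> (A - S) = A" by (auto simp: S_def)
  have "B = S \<union> Os" unfolding B_def S4 by (rule refl)
  also have "\<dots> = \<phi> ` S \<union> \<phi> ` (A - S)" by (simp only: \<phi>S Os_def)
  also have "\<dots> = \<phi> ` A" by (simp only: image_Un[symmetric] AS)
  finally have B\<phi>: "B = \<phi> ` A" .
  have mult_eq: "mult_at B Q = mult_at A Q" for Q
  proof -
    have "{l \<in> B. \<forall>v\<in>Q. eval_poly l v = 0} = \<phi> ` {l \<in> A. \<forall>v\<in>Q. eval_poly l v = 0}"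
      unfolding B\<phi> using eval\<phi> by auto
    then show ?thesis unfolding mult_at_def using inj by (simp add: card_image inj_on_subset)
  qed
  then have num_eq: "num_points B k = num_points A k" for k by (simp add: num_points_def)
  have "F = (\<Prod>l\<in>A. \<phi> l)" unfolding F_def B\<phi> using inj by (simp add: prod.reindex)
  also have "\<dots> = Const (\<Prod>l\<in>A. c l) * \<Prod>A"
    using fin by (induction A rule: finite_induct) (simp_all add: \<phi>_def Const_mult mult_ac)
  finally have "F = Const (\<Prod>l\<in>A. c l) * f" by (simp add: assms(4) defining_poly_def)
  moreover have "(\<Prod>l\<in>A. c l) \<noteq> 0" using c0 fin by simp
  ultimately have AR: "AR F = AR f" using AR_Const_mult by simp
  have ex: "exponents F = es" and md: "mdr F = r" using assms(5,6) by (simp_all add: exponents_def mdr_def AR)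
  obtain es' where out: "outcome es'" and tab': "(num_points B 3, num_points B 4, es') \<in> outcome_table"
    using outcome_in_table max4 mult_eq by metis
  have es': "es' = es" using out ex by (simp add: outcome_def)
  have tab: "(n3, n4, es) \<in> outcome_table" using tab' by (simp add: es' num_eq assms(8,9))
  have r: "es \<noteq> [3, 4] \<Longrightarrow> r = 4" using out md by (simp add: outcome_def es')
  have free: "es = [3, 4] \<Longrightarrow> free_arr A"
    using out by (simp add: outcome_def es' free_arr_def AR assms(4))
  have zero: "num_points A k = 0" if "4 < k" for k
  proof -
    have "{Q \<in> proj_plane. mult_at A Q = k} = {}" using max4 that by fastforce
    then show ?thesis by (simp only: num_points_def card.empty)
  qed
  have range: "{2..8::nat} = {2, 3, 4, 5, 6, 7, 8}" by auto
  have "num_points A 2 * 2 + n3 * 6 + n4 * 12 = 56"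
    using pair_count[OF assms(1)] by (simp add: assms(2,8,9) range zero)
  moreover have "\<tau> = num_points A 2 + n3 * 4 + n4 * 9"
    by (simp add: assms(2,7,8,9) total_tjurina_def range zero)
  ultimately have \<tau>: "\<tau> = 28 + n3 + 3 * n4" by linarith
  have expo: "exponents (defining_poly A) = es" using assms(4,6) by simp
  show ?thesis
    using tab r free
    unfolding outcome_table_def nearly_free_def minimal_POG_def POG_def arr_type_def Let_def expo assms(2)
    by (elim insertE emptyE) (simp_all add: \<tau>)
qed

end
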